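(* Let $n\ge 1$ and let $p$ be a positive integer. Let $V_p$ be the irreducible $q(n+1)$-module described in the context. Its character is $$\operatorname{ch} V_p = h_{p-n}e_n+h_{p-n-2}\,\!'\ldots$$ that is, written out unambiguously, $$\operatorname{ch} V_p=\sum_{\substack{0\le q\le n\\ q\equiv n \ (\mathrm{mod}\ 2)}} h_{p-q}\,e_q ,$$ where $e_r$ (resp. $h_r$) is the $r$th elementary (resp. complete) symmetric function in $x_0,\ldots,x_n$, with $h_r=0$ for $r<0$; the sum ends with the term $h_p$ if $n$ is even and with $h_{p-1}e_1$ if $n$ is odd.
   Context: The Lie superalgebra $G=q(n+1)$ over $\mathbb{C}$ has even basis elements $e_{ij}^{\bar 0}$ and odd basis elements $e_{ij}^{\bar 1}$ ($i,j=0,1,\ldots,n$) with superbracket $[\![ e_{ij}^\sigma, e_{kl}^\theta ]\!] = \delta_{jk} e_{il}^{\sigma+\theta} - (-1)^{\sigma\theta}\delta_{il} e_{kj}^{\sigma+\theta}$, $\sigma,\theta\in\mathbb{Z}_2=\{\bar 0,\bar 1\}$. A $G$-module is a complex vector space $V$ (not required to be $\mathbb{Z}_2$-graded) with a linear map $\rho:G\to \mathrm{End}(V)$ such that $\rho([\![x,y]\!])=\rho(x)\rho(y)-(-1)^{\sigma\theta}\rho(y)\rho(x)$ for $x\in G_\sigma$, $y\in G_\theta$; submodules are likewise not required to be graded. Let $q(1)=\mathrm{span}\{e_{00}^{\bar 0},e_{00}^{\bar 1}\}$, $q(n)=\mathrm{span}\{e_{ij}^{\sigma}: 1\le i,j\le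 n,\ \sigma\in\mathbb{Z}_2\}$, $\tilde G=q(1)\oplus q(n)$, and $P=\mathrm{span}\{e_{0i}^{\bar 0},e_{0i}^{\bar 1}: 1\le i\le n\}$; $\tilde G+P$ is a subalgebra of $G$. Let $\mathbb{C}v_0$ be the one-dimensional $(\tilde G+P)$-module with $e_{00}^{\bar 0}v_0=p\,v_0$, $e_{00}^{\bar 1}v_0=\sqrt{p}\,v_0$, and $xv_0=0$ for $x\in q(n)$ and $x\in P$. Define $\bar V_p=\mathrm{Ind}_{\tilde G+P}^{G}\mathbb{C}v_0 = U(G)\otimes_{U(\tilde G+P)}\mathbb{C}v_0$. $M_p$ denotes the maximal $G$-submodule of $\bar V_p$ different from $\bar V_p$ (so $v\in M_p$ if and only if $v_0\notin U(G)v$), and $V_p=\bar V_p/M_p$. The character of a finite-dimensional $G$-module $V$ is $\operatorname{ch}V=\sum_\lambda \dim V(\lambda)\,x_0^{\lambda_0}\cdots x_n^{\lambda_n}$, where $V(\lambda)$ is the simultaneous eigenspace of $e_{00}^{\bar 0},\ldots,e_{nn}^{\bar 0}$ with eigenvalues $\lambda=(\lambda_0,\ldots,\lambda_n)$ and $x_0,\ldots,x_n$ are formal variables. *)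

theory Defs
  imports
    Complex_Main
    "HOL-Library.Z2"
    "HOL-Library.Poly_Mapping"
    "HOL-Library.Multiset"
    "HOL-Algebra.QuotRing"
    "Jordan_Normal_Form.VS_Connect"
begin

section \<open>The Lie superalgebra \<open>q(n+1)\<close>\<close>

text \<open>The triple \<open>(i, j, \<sigma>)\<close> indexes the basis vector \<open>e\<^sub>i\<^sub>j\<^sup>\<sigma>\<close>; the type \<open>bit\<close> plays the
  role of \<open>\<int>\<^sub>2\<close>.  A (sub)algebra is given by a set \<open>S\<close> of indices and consists of the finitely
  supported complex functions on \<open>S\<close>.\<close>

type_synonym qidx = "nat \<times> nat \<times> bit"
type_synonym qelt = "qidx \<Rightarrow>\<^sub>0 complex"

definition pscale :: "complex \<Rightarrow> ('a \<Rightarrow>\<^sub>0 complex) \<Rightarrow> ('a \<Rightarrow>\<^sub>0 complex)" where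
  "pscale c f = Poly_Mapping.map ((*) c) f"

definition q_e :: "nat \<Rightarrow> nat \<Rightarrow> bit \<Rightarrow> qelt" where
  "q_e i j \<sigma> = Poly_Mapping.single (i, j, \<sigma>) 1"

definition super_sign :: "bit \<Rightarrow> bit \<Rightarrow> complex" where
  "super_sign \<sigma> \<theta> = (if \<sigma> * \<theta> = 1 then - 1 else 1)"

fun basis_bracket :: "qidx \<Rightarrow> qidx \<Rightarrow> qelt" where
  "basis_bracket (i, j, \<sigma>) (k, l, \<theta>) =
     (if j = k then q_e i l (\<sigma> + \<theta>) else 0)
     - pscale (super_sign \<sigma> \<theta>) (if i = l then q_e k j (\<sigma> + \<theta>) else 0)"

definition q_bracket :: "qelt \<Rightarrow> qelt \<Rightarrow> qelt" where
  "q_bracket x y = (\<Sum>a\<in>Poly_Mapping.keys x. \<Sum>b\<in>Poly_Mapping.keys y.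
     pscale (Poly_Mapping.lookup x a * Poly_Mapping.lookup y b) (basis_bracket a b))"

definition lie_span :: "qidx set \<Rightarrow> qelt set" where
  "lie_span S = {x. Poly_Mapping.keys x \<subseteq> S}"

definition lie_homog :: "qidx set \<Rightarrow> bit \<Rightarrow> qelt set" where
  "lie_homog S \<sigma> = {x. Poly_Mapping.keys x \<subseteq> {(i, j, \<tau>). (i, j, \<tau>) \<in> S \<and> \<tau> = \<sigma>}}"

definition G_idx :: "nat \<Rightarrow> qidx set" where
  "G_idx n = {(i, j, \<sigma>). i \<le> n \<and> j \<le> n}"

definition q1_idx :: "qidx set" where
  "q1_idx = {(0, 0, \<sigma>) | \<sigma>. True}"

definition qn_idx :: "nat \<Rightarrow> qidx set" where
  "qn_idx n = {(i, j, \<sigma>). i \<in> {1..n} \<and> j \<in> {1..n}}"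

definition P_idx :: "nat \<Rightarrow> qidx set" where
  "P_idx n = {(0, i, \<sigma>) | i \<sigma>. i \<in> {1..n}}"

text \<open>The subalgebra \<open>(q(1) \<oplus> q(n)) + P\<close>.\<close>
definition H_idx :: "nat \<Rightarrow> qidx set" where
  "H_idx n = q1_idx \<union> qn_idx n \<union> P_idx n"


section \<open>Universal enveloping algebras\<close>

text \<open>The tensor algebra of \<open>lie_span S\<close> is the free associative algebra on \<open>S\<close>, that is, the
  monoid algebra of the free monoid.  Words need a type of their own, since the convolution product
  on \<open>\<Rightarrow>\<^sub>0\<close> uses the additive monoid structure of the key type.\<close>

datatype 'a fmon = Word (letters: "'a list")

instantiation fmon :: (type) monoid_add
begin

definition zero_fmon :: "'a fmon" where "0 = Word []"

definition plus_fmon :: "'a fmon \<Rightarrow> 'a fmon \<Rightarrow> 'a fmon" where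
  "u + v = Word (letters u @ letters v)"

instance
  by standard (simp_all add: zero_fmon_def plus_fmon_def)

end

type_synonym tens = "qidx fmon \<Rightarrow>\<^sub>0 complex"

definition tensor_alg :: "qidx set \<Rightarrow> tens ring" where
  "tensor_alg S = \<lparr>carrier = {t. \<forall>w\<in>Poly_Mapping.keys t. set (letters w) \<subseteq> S},
     mult = (*), one = 1, zero = 0, add = (+)\<rparr>"

definition tens_of :: "qelt \<Rightarrow> tens" where
  "tens_of x = (\<Sum>a\<in>Poly_Mapping.keys x. Poly_Mapping.single (Word [a]) (Poly_Mapping.lookup x a))"

definition env_ideal :: "qidx set \<Rightarrow> tens set" where
  "env_ideal S = genideal (tensor_alg S)
     {tens_of x * tens_of y - pscale (super_sign \<sigma> \<theta>) (tens_of y * tens_of x)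
        - tens_of (q_bracket x y) | x y \<sigma> \<theta>. x \<in> lie_homog S \<sigma> \<and> y \<in> lie_homog S \<theta>}"

definition env :: "qidx set \<Rightarrow> tens set ring" where
  "env S = tensor_alg S Quot env_ideal S"

definition env_of :: "qidx set \<Rightarrow> qelt \<Rightarrow> tens set" where
  "env_of S x = env_ideal S +>\<^bsub>tensor_alg S\<^esub> tens_of x"

text \<open>For \<open>S' \<subseteq> S\<close>, the homomorphism \<open>U(S') \<rightarrow> U(S)\<close> induced by the inclusion: the coset \<open>t + I'\<close>
  is sent to \<open>I + t + I' = t + I\<close>.\<close>
definition env_map :: "qidx set \<Rightarrow> tens set \<Rightarrow> tens set" where
  "env_map S Y = env_ideal S <+>\<^bsub>tensor_alg S\<^esub> Y"


section \<open>Modules\<close>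

text \<open>A module is a complex vector space together with the operators by which the elements of the
  Lie superalgebra act; no grading is present.  The fields \<open>mult\<close> and \<open>one\<close> inherited
  from the record of rings have no meaning for a vector space.\<close>

record 'v qmodule = "(complex, 'v) module" +
  act :: "qelt \<Rightarrow> 'v \<Rightarrow> 'v"

definition is_submodule :: "qidx set \<Rightarrow> 'v qmodule \<Rightarrow> 'v set \<Rightarrow> bool" where
  "is_submodule S V N \<longleftrightarrow> subspace class_ring N V \<and> (\<forall>x\<in>lie_span S. \<forall>v\<in>N. act V x v \<in> N)"

text \<open>The map induced by \<open>f\<close> on cosets of \<open>N\<close> sends \<open>v + N\<close> to \<open>N + f (v + N) = f v + N\<close>
  whenever \<open>f N \<subseteq> N\<close>.\<close>
definition coset_map :: "'v qmodule \<Rightarrow> 'v set \<Rightarrow> ('v \<Rightarrow> 'v) \<Rightarrow> 'v set \<Rightarrow> 'v set" where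
  "coset_map V N f Z = N <+>\<^bsub>V\<^esub> (f ` Z)"

definition quot_module :: "'v qmodule \<Rightarrow> 'v set \<Rightarrow> 'v set qmodule" where
  "quot_module V N = \<lparr>carrier = a_rcosets\<^bsub>V\<^esub> N, mult = undefined, one = undefined,
     zero = N, add = set_add V,
     smult = (\<lambda>c. coset_map V N (\<lambda>v. c \<odot>\<^bsub>V\<^esub> v)), act = (\<lambda>x. coset_map V N (act V x))\<rparr>"

text \<open>A module \<open>W\<close> over \<open>lie_span S\<close> is a module over \<open>env S\<close>: a word acts by the composition of
  its letters, and any representative of a coset may be used.\<close>

definition tens_act :: "'w qmodule \<Rightarrow> tens \<Rightarrow> 'w \<Rightarrow> 'w" where
  "tens_act W t w = (\<Oplus>\<^bsub>W\<^esub>m\<in>Poly_Mapping.keys t. Poly_Mapping.lookup t m \<odot>\<^bsub>W\<^esub>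
     foldr (\<lambda>a. act W (Poly_Mapping.single a 1)) (letters m) w)"

definition env_act :: "'w qmodule \<Rightarrow> tens set \<Rightarrow> 'w \<Rightarrow> 'w" where
  "env_act W Y w = the_elem ((\<lambda>t. tens_act W t w) ` Y)"


subsection \<open>Induced modules\<close>

text \<open>\<open>Ind W = U(S) \<otimes>\<^bsub>U(S')\<^esub> W\<close> is the quotient of the vector space with basis
  \<open>U(S) \<times> W\<close> by the usual relations, with \<open>S\<close> acting by left multiplication on the first factor.
  Linearity over the scalars in the first argument follows from the last two families of
  relations, because \<open>U(S')\<close> contains the scalars.\<close>

definition free_tensor :: "qidx set \<Rightarrow> 'w qmodule \<Rightarrow> (tens set \<times> 'w \<Rightarrow>\<^sub>0 complex) qmodule" where
  "free_tensor S W = \<lparr>carrier = {f. Poly_Mapping.keys f \<subseteq> carrier (env S) \<times> carrier W},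
     mult = undefined, one = undefined, zero = 0, add = (+), smult = pscale,
     act = (\<lambda>x f. \<Sum>(u, w)\<in>Poly_Mapping.keys f.
       Poly_Mapping.single (env_of S x \<otimes>\<^bsub>env S\<^esub> u, w) (Poly_Mapping.lookup f (u, w)))\<rparr>"

abbreviation pure_tensor :: "tens set \<Rightarrow> 'w \<Rightarrow> (tens set \<times> 'w \<Rightarrow>\<^sub>0 complex)" where
  "pure_tensor u w \<equiv> Poly_Mapping.single (u, w) 1"

definition tensor_relations ::
    "qidx set \<Rightarrow> qidx set \<Rightarrow> 'w qmodule \<Rightarrow> (tens set \<times> 'w \<Rightarrow>\<^sub>0 complex) set" where
  "tensor_relations S S' W =
     {pure_tensor (u \<oplus>\<^bsub>env S\<^esub> u') w - pure_tensor u w - pure_tensor u' w | u u' w.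
        u \<in> carrier (env S) \<and> u' \<in> carrier (env S) \<and> w \<in> carrier W}
   \<union> {pure_tensor u (w \<oplus>\<^bsub>W\<^esub> w') - pure_tensor u w - pure_tensor u w' | u w w'.
        u \<in> carrier (env S) \<and> w \<in> carrier W \<and> w' \<in> carrier W}
   \<union> {pure_tensor u (c \<odot>\<^bsub>W\<^esub> w) - pscale c (pure_tensor u w) | c u w.
        u \<in> carrier (env S) \<and> w \<in> carrier W}
   \<union> {pure_tensor (u \<otimes>\<^bsub>env S\<^esub> env_map S y) w - pure_tensor u (env_act W y w) | u y w.
        u \<in> carrier (env S) \<and> y \<in> carrier (env S') \<and> w \<in> carrier W}"

definition induced ::
    "qidx set \<Rightarrow> qidx set \<Rightarrow> 'w qmodule \<Rightarrow> (tens set \<times> 'w \<Rightarrow>\<^sub>0 complex) set qmodule" where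
  "induced S S' W = quot_module (free_tensor S W)
     (LinearCombinations.module.span class_ring (free_tensor S W) (tensor_relations S S' W))"


subsection \<open>The modules \<open>V\<^sub>p\<close>\<close>

text \<open>On the one-dimensional module, with \<open>v\<^sub>0 = 1\<close>, the elements of \<open>q(n)\<close> and \<open>P\<close> act by zero.\<close>
definition Cv0 :: "nat \<Rightarrow> complex qmodule" where
  "Cv0 p = \<lparr>carrier = UNIV, mult = (*), one = 1, zero = 0, add = (+), smult = (*),
     act = (\<lambda>x c. (of_nat p * Poly_Mapping.lookup x (0, 0, 0)
       + of_real (sqrt (real p)) * Poly_Mapping.lookup x (0, 0, 1)) * c)\<rparr>"

type_synonym vbar = "(tens set \<times> complex \<Rightarrow>\<^sub>0 complex) set"

definition Vbar :: "nat \<Rightarrow> nat \<Rightarrow> vbar qmodule" where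
  "Vbar n p = induced (G_idx n) (H_idx n) (Cv0 p)"

definition Mp :: "nat \<Rightarrow> nat \<Rightarrow> vbar set" where
  "Mp n p = (GREATEST N. is_submodule (G_idx n) (Vbar n p) N \<and> N \<noteq> carrier (Vbar n p))"

definition Vp :: "nat \<Rightarrow> nat \<Rightarrow> vbar set qmodule" where
  "Vp n p = quot_module (Vbar n p) (Mp n p)"


section \<open>Characters and symmetric functions\<close>

text \<open>A weight \<open>\<mu> \<in> \<complex>\<^sup>n\<^sup>+\<^sup>1\<close> is a function supported on \<open>{0..n}\<close>.  As weights are a priori
  arbitrary complex vectors, characters live in the group ring of the additive group of weights;
  \<open>formal_exp \<mu>\<close> is the monomial \<open>x\<^sub>0^\<mu>\<^sub>0 \<cdots> x\<^sub>n^\<mu>\<^sub>n\<close>.\<close>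

type_synonym weight = "nat \<Rightarrow>\<^sub>0 complex"
type_synonym char_ring = "weight \<Rightarrow>\<^sub>0 int"

definition formal_exp :: "weight \<Rightarrow> char_ring" where
  "formal_exp \<mu> = Poly_Mapping.single \<mu> 1"

definition weight_space :: "nat \<Rightarrow> 'v qmodule \<Rightarrow> weight \<Rightarrow> 'v set" where
  "weight_space n V \<mu> = {v \<in> carrier V.
     \<forall>i\<le>n. act V (q_e i i 0) v = Poly_Mapping.lookup \<mu> i \<odot>\<^bsub>V\<^esub> v}"

text \<open>Meaningful for finite-dimensional \<open>V\<close>, where only finitely many weight spaces are
  nonzero.\<close>
definition character :: "nat \<Rightarrow> 'v qmodule \<Rightarrow> char_ring" where
  "character n V =
     (\<Sum>\<mu> | Poly_Mapping.keys \<mu> \<subseteq> {..n} \<and> weight_space n V \<mu> \<noteq> {\<zero>\<^bsub>V\<^esub>}.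
        of_nat (vectorspace.dim class_ring (V\<lparr>carrier := weight_space n V \<mu>\<rparr>)) * formal_exp \<mu>)"

definition x_var :: "nat \<Rightarrow> char_ring" where
  "x_var i = formal_exp (Poly_Mapping.single i 1)"

definition elem_sym :: "nat \<Rightarrow> nat \<Rightarrow> char_ring" where
  "elem_sym n r = (\<Sum>A | A \<subseteq> {..n} \<and> card A = r. \<Prod>i\<in>A. x_var i)"

definition complete_sym :: "nat \<Rightarrow> int \<Rightarrow> char_ring" where
  "complete_sym n r = (if r < 0 then 0
     else \<Sum>A | set_mset A \<subseteq> {..n} \<and> size A = nat r. \<Prod>i\<in>#A. x_var i)"

end

theory Submission
  imports Defs "HOL-Library.Function_Algebras"
begin

text \<open>The idea is to realise \<open>V\<^sub>p\<close> inside the superpolynomials of degree \<open>p\<close> in even variables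
  \<open>x\<^sub>0, \<dots>, x\<^sub>n\<close> and odd variables \<open>\<theta>\<^sub>0, \<dots>, \<theta>\<^sub>n\<close>, on which \<open>q(n+1)\<close> acts by the derivations
  \<open>x\<^sub>i \<partial>/\<partial>x\<^sub>j + \<theta>\<^sub>i \<partial>/\<partial>\<theta>\<^sub>j\<close> and \<open>x\<^sub>i \<partial>/\<partial>\<theta>\<^sub>j + \<theta>\<^sub>i \<partial>/\<partial>x\<^sub>j\<close>.  The odd operator
  \<open>J = \<Sum>\<^sub>k \<theta>\<^sub>k \<partial>/\<partial>x\<^sub>k - x\<^sub>k \<partial>/\<partial>\<theta>\<^sub>k\<close> commutes with the even derivations, anticommutes with the odd ones
  and satisfies \<open>J\<^sup>2 = -p\<close>.  Hence the superpolynomials whose number of \<open>\<theta>\<close>'s is congruent to \<open>n\<close>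
  modulo 2 form an ungraded module, on which an odd element acts by its derivation composed with
  \<open>\<plusminus>J/\<surd>p\<close>; its character is visibly the required sum of products \<open>h\<^sub>p\<^sub>-\<^sub>q e\<^sub>q\<close>.

  This module is irreducible: the only vectors killed by all \<open>e\<^sub>0\<^sub>i\<^sup>\<sigma>\<close> with \<open>i \<ge> 1\<close> are the multiples of
  the top vector, which is the image of \<open>v\<^sub>0\<close>.  On the other hand every element of the induced module is a sum
  of eigenvectors of \<open>e\<^sub>0\<^sub>0\<close> with eigenvalues \<open>p, p - 1, \<dots>\<close>, the first of which occurs only on
  multiples of \<open>v\<^sub>0\<close>.  So a submodule that is not contained in the kernel of the projection onto
  the irreducible module contains \<open>v\<^sub>0\<close>, and that kernel is \<open>M\<^sub>p\<close>.\<close>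

section \<open>Operators on functions\<close>

text \<open>The twist by \<open>J\<close> answers an obstacle: v_0 is an eigenvector of the odd
  e_00, whereas odd derivations change the parity of the number of \<theta>'s. For odd derivations d
  and d', anticommutation gives (d J)(d' J) = - d d' J^2 = p d d'. With the factor 1/\<surd>p the
  products d J therefore satisfy the same relations as the d, and they preserve the parity.
  \<open>J\<close> exchanges the two parity classes and intertwines the two twisted modules up to
  the sign of \<surd>p. The class of n is chosen because it excludes monomials with n + 1 odd
  variables, which gives the range q \<le> n of the sum; it costs the sign (-1)^n. A vector of the
  induced module is a coset of formal combinations of cosets. The arguments are therefore carried
  out in the free algebra: a tensor t stands for t v_0, and a submodule for its preimage, a left
  ideal modulo which letters are straightened. The map to superpolynomials gives the converse
  information, that t v_0 is nonzero whenever its image is.\<close>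

definition fscale :: "complex \<Rightarrow> ('a \<Rightarrow> complex) \<Rightarrow> 'a \<Rightarrow> complex" where
  "fscale c f = (\<lambda>k. c * f k)"

lemma fscale_apply [simp]: "fscale c f k = c * f k"
  by (simp add: fscale_def)

lemma fscale_add: "fscale c (f + g) = fscale c f + fscale c g"
  by (rule ext) (simp add: algebra_simps)

lemma fscale_add_left: "fscale (c + d) f = fscale c f + fscale d f"
  by (rule ext) (simp add: algebra_simps)

lemma fscale_fscale [simp]: "fscale c (fscale d f) = fscale (c * d) f"
  by (rule ext) (simp add: algebra_simps)

lemma fscale_one [simp]: "fscale 1 f = f"
  by (rule ext) simp

lemma fscale_zero_right [simp]: "fscale c 0 = 0"
  by (rule ext) simp

lemma fscale_zero_left [simp]: "fscale 0 f = 0"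
  by (rule ext) simp

lemma fscale_minus_one: "fscale (-1) f = - f"
  by (rule ext) simp

lemma fscale_uminus [simp]: "fscale c (- f) = - fscale c f"
  by (rule ext) simp

lemma fscale_diff: "fscale c (f - g) = fscale c f - fscale c g"
  by (rule ext) (simp add: algebra_simps)

text \<open>A type of operators, because it can be made an instance of \<open>ring_1\<close>:
  operator identities are then proved by \<open>algebra_simps\<close>, and \<open>word_rep\<close>
  can take its values here. Compatibility with \<open>fscale\<close> is what makes the scalars
  central.\<close>

typedef 'a endo = "{T :: ('a \<Rightarrow> complex) \<Rightarrow> 'a \<Rightarrow> complex.
    (\<forall>f g. T (f + g) = T f + T g) \<and> (\<forall>c f. T (fscale c f) = fscale c (T f))}"
  morphisms app Endo
  by (rule exI[of _ "\<lambda>f. f"]) simp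

setup_lifting type_definition_endo

lemma app_add [simp]: "app T (f + g) = app T f + app T g"
  using app[of T] by blast

lemma app_fscale [simp]: "app T (fscale c f) = fscale c (app T f)"
  using app[of T] by blast

lemma app_zero [simp]: "app T 0 = 0"
  using app_add[of T 0 0] by simp

lemma app_uminus [simp]: "app T (- f) = - app T f"
  using app_fscale[of T "-1" f] by (simp only: fscale_minus_one)

instantiation endo :: (type) ring_1
begin

lift_definition zero_endo :: "'a endo" is "\<lambda>f. 0" by simp
lift_definition one_endo :: "'a endo" is "\<lambda>f. f" by simp
lift_definition plus_endo :: "'a endo \<Rightarrow> 'a endo \<Rightarrow> 'a endo" is "\<lambda>S T f. S f + T f"
  by (intro conjI allI ext) (simp_all add: algebra_simps)
lift_definition uminus_endo :: "'a endo \<Rightarrow> 'a endo" is "\<lambda>T f. - T f"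
  by (intro conjI allI ext) simp_all
lift_definition minus_endo :: "'a endo \<Rightarrow> 'a endo \<Rightarrow> 'a endo" is "\<lambda>S T f. S f - T f"
  by (intro conjI allI ext) (simp_all add: algebra_simps)
lift_definition times_endo :: "'a endo \<Rightarrow> 'a endo \<Rightarrow> 'a endo" is "\<lambda>S T f. S (T f)"
  by simp

instance
proof
  fix a b c :: "'a endo"
  show "a + b + c = a + (b + c)" by transfer (rule ext, rule add.assoc)
  show "a + b = b + a" by transfer (rule ext, rule add.commute)
  show "0 + a = a" by transfer (rule ext, rule add_0)
  show "- a + a = 0" by transfer (rule ext, rule left_minus)
  show "a - b = a + - b" by transfer (rule ext, rule diff_conv_add_uminus)
  show "a * b * c = a * (b * c)" by transfer (rule refl)
  show "1 * a = a" by transfer (rule refl)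
  show "a * 1 = a" by transfer (rule refl)
  show "(a + b) * c = a * c + b * c" by transfer (rule refl)
  show "a * (b + c) = a * b + a * c" by transfer (rule ext, metis)
  \<comment> \<open>Types are nonempty, so there is a nonzero function to separate the two
    operators.\<close>
  show "(0 :: 'a endo) \<noteq> 1"
  proof
    assume "(0 :: 'a endo) = 1"
    then have "app (0 :: 'a endo) (\<lambda>_. 1) undefined = app 1 (\<lambda>_. 1) undefined"
      by (simp only:)
    then show False
      by (simp add: zero_endo.rep_eq one_endo.rep_eq)
  qed
qed

end

lemma app_simps [simp]:
  "app 0 f = 0" "app 1 f = f" "app (S + T) f = app S f + app T f" "app (- S) f = - app S f"
  "app (S - T) f = app S f - app T f" "app (S * T) f = app S (app T f)"
  by (simp_all only: zero_endo.rep_eq one_endo.rep_eq plus_endo.rep_eq uminus_endo.rep_eq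
      minus_endo.rep_eq times_endo.rep_eq)

lemma app_sum_left: "app (sum S I) f = (\<Sum>i\<in>I. app (S i) f)"
  by (rule additive.sum[of "\<lambda>S. app S f"]) (simp add: additive_def)

lemma endo_eqI: "(\<And>f k. app S f k = app T f k) \<Longrightarrow> S = T"
  by (metis app_inject ext)

section \<open>Superpolynomials and the commutation rules of their generators\<close>

type_synonym fkey = "nat multiset \<times> nat set"

lemma fkey_endo_eqI:
  fixes S T :: "fkey endo"
  shows "(\<And>f a A. app S f (a, A) = app T f (a, A)) \<Longrightarrow> S = T"
  by (rule endo_eqI) auto

text \<open>The sign of carrying \<theta>_i past the factors of \<theta>_A with smaller index, where
  \<theta>_A is the product in increasing order.\<close>

definition fermi_sign :: "nat \<Rightarrow> nat set \<Rightarrow> complex" where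
  "fermi_sign i A = (- 1) ^ card {j \<in> A. j < i}"

lemma fermi_sign_insert: "j \<notin> A \<Longrightarrow> fermi_sign i (insert j A) = (if j < i then - fermi_sign i A else fermi_sign i A)"
proof -
  assume j: "j \<notin> A"
  have "{k \<in> insert j A. k < i} = (if j < i then insert j {k \<in> A. k < i} else {k \<in> A. k < i})"
    by auto
  then show ?thesis using j by (simp add: fermi_sign_def)
qed

lemma fermi_sign_remove: "j \<in> A \<Longrightarrow> fermi_sign i (A - {j}) = (if j < i then - fermi_sign i A else fermi_sign i A)"
  using fermi_sign_insert[of j "A - {j}" i] by (auto simp: insert_absorb)

lemma fermi_sign_square [simp]: "fermi_sign i A * fermi_sign i A = 1"
  by (simp add: fermi_sign_def flip: power_mult_distrib)

lemma fermi_sign_square' [simp]: "fermi_sign i A * (fermi_sign i A * z) = z"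
  by (simp flip: mult.assoc)

lemma fermi_sign_nonzero [simp]: "fermi_sign i A \<noteq> 0"
  by (simp add: fermi_sign_def)

text \<open>A function \<open>f\<close> stands for the element \<open>\<Sum> f (a, A) x\<^sup>a/a! \<theta>\<^sub>A\<close>; with divided powers it is the multiplication
  by \<open>x\<^sub>i\<close>, not \<open>\<partial>/\<partial>x\<^sub>i\<close>, that carries the multiplicity.  \<open>Th\<close> and \<open>Dt\<close> are \<open>\<theta>\<^sub>i\<close> and \<open>\<partial>/\<partial>\<theta>\<^sub>i\<close>.\<close>

lift_definition X :: "nat \<Rightarrow> fkey endo" is
  "\<lambda>i f (a, A). of_nat (count a i) * f (a - {#i#}, A)"
  by (intro conjI allI ext) (auto simp: algebra_simps)
lift_definition D :: "nat \<Rightarrow> fkey endo" is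
  "\<lambda>i f (a, A). f (add_mset i a, A)"
  by (intro conjI allI ext) (auto simp: algebra_simps)
lift_definition Th :: "nat \<Rightarrow> fkey endo" is
  "\<lambda>i f (a, A). if i \<in> A then fermi_sign i A * f (a, A - {i}) else 0"
  by (intro conjI allI ext) (auto simp: algebra_simps)
lift_definition Dt :: "nat \<Rightarrow> fkey endo" is
  "\<lambda>i f (a, A). if i \<in> A then 0 else fermi_sign i A * f (a, insert i A)"
  by (intro conjI allI ext) (auto simp: algebra_simps)

lemma app_X: "app (X i) f (a, A) = of_nat (count a i) * f (a - {#i#}, A)"
  and app_D: "app (D i) f (a, A) = f (add_mset i a, A)"
  and app_Th: "app (Th i) f (a, A) = (if i \<in> A then fermi_sign i A * f (a, A - {i}) else 0)"
  and app_Dt: "app (Dt i) f (a, A) = (if i \<in> A then 0 else fermi_sign i A * f (a, insert i A))"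
  by (simp_all only: X.rep_eq D.rep_eq Th.rep_eq Dt.rep_eq prod.case)

lemmas app_gens = app_X app_D app_Th app_Dt

definition \<delta> :: "nat \<Rightarrow> nat \<Rightarrow> 'a :: zero_neq_one" where
  "\<delta> i j = of_bool (i = j)"

text \<open>\<open>D i\<close> enlarges the multiset before \<open>X j\<close> reads the
  multiplicity, so for \<open>i = j\<close> the two orders differ by one. If \<open>j\<close> does
  not occur in \<open>a\<close>, the truncated difference \<open>a - {#j#}\<close> does no harm, as
  its coefficient \<open>count a j\<close> is 0.\<close>

lemma comm_DX: "D i * X j = X j * D i + \<delta> i j"
proof (rule fkey_endo_eqI)
  fix f a A
  show "app (D i * X j) f (a, A) = app (X j * D i + \<delta> i j) f (a, A)"
  proof (cases "j \<in># a")
    case True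
    then obtain b where "a = add_mset j b" by (blast dest: multi_member_split)
    then show ?thesis by (simp add: app_gens \<delta>_def algebra_simps)
  next
    case False
    then show ?thesis by (simp add: app_gens \<delta>_def not_in_iff)
  qed
qed

lemma comm_XX: "X i * X j = X j * X i"
proof (rule fkey_endo_eqI)
  fix f a A
  show "app (X i * X j) f (a, A) = app (X j * X i) f (a, A)"
    by (cases "i = j") (simp_all add: app_gens diff_right_commute mult.left_commute add_mset_commute)
qed

lemma comm_DD: "D i * D j = D j * D i"
  by (rule fkey_endo_eqI) (simp add: app_gens add_mset_commute)

lemma comm_ThX: "Th i * X j = X j * Th i"
  by (rule fkey_endo_eqI) (simp add: app_gens)

lemma comm_ThD: "Th i * D j = D j * Th i"
  by (rule fkey_endo_eqI) (simp add: app_gens)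

lemma comm_DtX: "Dt i * X j = X j * Dt i"
  by (rule fkey_endo_eqI) (simp add: app_gens)

lemma comm_DtD: "Dt i * D j = D j * Dt i"
  by (rule fkey_endo_eqI) (simp add: app_gens)

text \<open>Of two distinct indices exactly one lies below the other, so removing the first index
  flips the second sign in exactly one of the two orders.\<close>

lemma comm_ThTh: "Th i * Th j = - (Th j * Th i)"
proof (rule fkey_endo_eqI)
  fix f a A
  have "A - {i} - {j} = A - {j} - {i}" by auto
  then show "app (Th i * Th j) f (a, A) = app (- (Th j * Th i)) f (a, A)"
    by (cases i j rule: linorder_cases) (simp_all add: app_gens fermi_sign_remove)
qed

lemma comm_DtDt: "Dt i * Dt j = - (Dt j * Dt i)"
proof (rule fkey_endo_eqI)
  fix f a A
  have "insert i (insert j A) = insert j (insert i A)" by auto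
  then show "app (Dt i * Dt j) f (a, A) = app (- (Dt j * Dt i)) f (a, A)"
    by (cases i j rule: linorder_cases) (simp_all add: app_gens fermi_sign_insert)
qed

lemma comm_DtTh: "Dt i * Th j = \<delta> i j - Th j * Dt i"
proof (rule fkey_endo_eqI)
  fix f a A
  have "i \<noteq> j \<Longrightarrow> insert i (A - {j}) = insert i A - {j}" by auto
  moreover have "fermi_sign i (A - {i}) = fermi_sign i A" "fermi_sign i (insert i A) = fermi_sign i A"
    by (simp_all add: fermi_sign_def) (metis nless_le)+
  ultimately show "app (Dt i * Th j) f (a, A) = app (\<delta> i j - Th j * Dt i) f (a, A)"
    by (cases i j rule: linorder_cases)
      (auto simp: app_gens \<delta>_def fermi_sign_insert fermi_sign_remove insert_absorb)
qed

section \<open>Brackets of the quadratic operators\<close>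

text \<open>\<open>algebra_simps\<close> nests products to the right, so a rule for
  \<open>a * b\<close> must also apply inside \<open>a * (b * z)\<close>.\<close>

lemma mult_eq_assoc: "a * b = c \<Longrightarrow> a * (b * z) = c * z" for a b c z :: "'a :: semigroup_mult"
  by (metis mult.assoc)

lemma mult_commute_assoc: "a * b = b * a \<Longrightarrow> a * (b * z) = b * (a * z)" for a b z :: "'a :: semigroup_mult"
  by (metis mult.assoc)

text \<open>Oriented towards the normal order \<open>X\<close>, \<open>D\<close>, \<open>Th\<close>,
  \<open>Dt\<close>; commuting generators of one kind are sorted by ordered rewriting. The rules for
  two \<open>Th\<close> or two \<open>Dt\<close> stay out: with their minus sign they are not
  permutative and would loop, so they are instantiated at each use.\<close>

lemmas comm_gens = comm_DX comm_ThX comm_ThD comm_DtX comm_DtD comm_DtTh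
lemmas comm_gens' = comm_gens comm_gens[THEN mult_eq_assoc] comm_XX comm_DD
  comm_XX[THEN mult_commute_assoc] comm_DD[THEN mult_commute_assoc]

text \<open>The class \<open>ring_1\<close> does not make 2 cancellable; complex values do. Squares
  of odd operators come out as half an anticommutator, so their identities appear doubled.\<close>

lemma endo_double_cancel: "S + S = T + T \<Longrightarrow> S = T" for S T :: "'a endo"
proof (rule endo_eqI)
  fix f k assume "S + S = T + T"
  then have "app (S + S) f k = app (T + T) f k" by (simp only:)
  then show "app S f k = app T f k" by simp
qed

lemma Th_Th_same: "Th i * Th i = 0"
proof (rule endo_double_cancel)
  show "Th i * Th i + Th i * Th i = 0 + 0"
    by (subst (1) comm_ThTh) simp
qed

lemma Dt_Dt_same: "Dt i * Dt i = 0"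
proof (rule endo_double_cancel)
  show "Dt i * Dt i + Dt i * Dt i = 0 + 0"
    by (subst (1) comm_DtDt) simp
qed

definition even_op :: "nat \<Rightarrow> nat \<Rightarrow> fkey endo" where
  "even_op i j = X i * D j + Th i * Dt j"

definition odd_op :: "nat \<Rightarrow> nat \<Rightarrow> fkey endo" where
  "odd_op i j = X i * Dt j + Th i * D j"

text \<open>The commutators of the derivations with the four kinds of generators are collected so
  that the brackets below need no expansion of products of four generators.\<close>

lemma even_op_X: "even_op i j * X k = X k * even_op i j + \<delta> j k * X i"
  by (cases "j = k") (simp_all add: even_op_def \<delta>_def algebra_simps comm_gens')

lemma even_op_D: "even_op i j * D k = D k * even_op i j - \<delta> i k * D j"
  by (cases "i = k") (simp_all add: even_op_def \<delta>_def algebra_simps comm_gens')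

lemma even_op_Th: "even_op i j * Th k = Th k * even_op i j + \<delta> j k * Th i"
  by (cases "j = k") (simp_all add: even_op_def \<delta>_def algebra_simps comm_gens'
      comm_ThTh[of k i] comm_ThTh[of k i, THEN mult_eq_assoc])

lemma even_op_Dt: "even_op i j * Dt k = Dt k * even_op i j - \<delta> i k * Dt j"
  by (cases "i = k") (simp_all add: even_op_def \<delta>_def algebra_simps comm_gens'
      comm_DtDt[of k j] comm_DtDt[of k j, THEN mult_eq_assoc])

lemma odd_op_X: "odd_op i j * X k = X k * odd_op i j + \<delta> j k * Th i"
  by (cases "j = k") (simp_all add: odd_op_def \<delta>_def algebra_simps comm_gens')

lemma odd_op_D: "odd_op i j * D k = D k * odd_op i j - \<delta> i k * Dt j"
  by (cases "i = k") (simp_all add: odd_op_def \<delta>_def algebra_simps comm_gens')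

lemma odd_op_Th: "odd_op i j * Th k = \<delta> j k * X i - Th k * odd_op i j"
  by (cases "j = k") (simp_all add: odd_op_def \<delta>_def algebra_simps comm_gens'
      comm_ThTh[of k i] comm_ThTh[of k i, THEN mult_eq_assoc])

lemma odd_op_Dt: "odd_op i j * Dt k = \<delta> i k * D j - Dt k * odd_op i j"
  by (cases "i = k") (simp_all add: odd_op_def \<delta>_def algebra_simps comm_gens'
      comm_DtDt[of k j] comm_DtDt[of k j, THEN mult_eq_assoc])

text \<open>This and the next two identities are the superbrackets of q(n+1). The left derivation is
  moved through both factors of each summand of the right one; passing the factor of index
  \<open>k\<close> gives the first delta, passing that of index \<open>l\<close> the second.\<close>

lemma even_op_even_op: "even_op i j * even_op k l = even_op k l * even_op i j + \<delta> j k * even_op i l - \<delta> i l * even_op k j"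
proof -
  have "even_op i j * even_op k l = even_op i j * X k * D l + even_op i j * Th k * Dt l"
    by (simp add: even_op_def[of k l] algebra_simps)
  also have "\<dots> = X k * (even_op i j * D l) + Th k * (even_op i j * Dt l) + \<delta> j k * even_op i l"
    by (simp only: even_op_X even_op_Th) (simp add: even_op_def[of i l] algebra_simps)
  also have "\<dots> = even_op k l * even_op i j + \<delta> j k * even_op i l - \<delta> i l * even_op k j"
    by (cases "i = l") (simp_all add: even_op_D even_op_Dt even_op_def[of k _] \<delta>_def algebra_simps)
  finally show ?thesis .
qed

lemma even_op_odd_op: "even_op i j * odd_op k l = odd_op k l * even_op i j + \<delta> j k * odd_op i l - \<delta> i l * odd_op k j"
proof -
  have "even_op i j * odd_op k l = even_op i j * X k * Dt l + even_op i j * Th k * D l"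
    by (simp add: odd_op_def[of k l] algebra_simps)
  also have "\<dots> = X k * (even_op i j * Dt l) + Th k * (even_op i j * D l) + \<delta> j k * odd_op i l"
    by (simp only: even_op_X even_op_Th) (simp add: odd_op_def[of i l] algebra_simps)
  also have "\<dots> = odd_op k l * even_op i j + \<delta> j k * odd_op i l - \<delta> i l * odd_op k j"
    by (cases "i = l") (simp_all add: even_op_D even_op_Dt odd_op_def[of k _] \<delta>_def algebra_simps)
  finally show ?thesis .
qed

lemma odd_op_odd_op: "odd_op i j * odd_op k l = \<delta> j k * even_op i l + \<delta> i l * even_op k j - odd_op k l * odd_op i j"
proof -
  have "odd_op i j * odd_op k l = odd_op i j * X k * Dt l + odd_op i j * Th k * D l"
    by (simp add: odd_op_def[of k l] algebra_simps)
  also have "\<dots> = X k * (odd_op i j * Dt l) - Th k * (odd_op i j * D l) + \<delta> j k * even_op i l"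
    by (simp only: odd_op_X odd_op_Th) (simp add: even_op_def[of i l] algebra_simps)
  also have "\<dots> = \<delta> j k * even_op i l + \<delta> i l * even_op k j - odd_op k l * odd_op i j"
    by (cases "i = l") (simp_all add: odd_op_D odd_op_Dt even_op_def[of k _] odd_op_def[of k _] \<delta>_def algebra_simps)
  finally show ?thesis .
qed

section \<open>The odd operator \<open>J\<close>\<close>

definition J_term :: "nat \<Rightarrow> fkey endo" where
  "J_term k = Th k * D k - X k * Dt k"

definition J :: "nat \<Rightarrow> fkey endo" where
  "J n = (\<Sum>k\<le>n. J_term k)"

lemma sum_\<delta>: "i \<le> n \<Longrightarrow> (\<Sum>k\<le>n. \<delta> k i * F k) = (F i :: 'a :: ring_1)"
proof -
  assume i: "i \<le> n"
  have "(\<Sum>k\<le>n. \<delta> k i * F k) = (\<Sum>k\<le>n. if k = i then F k else 0)"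
    by (rule sum.cong) (auto simp: \<delta>_def)
  also have "\<dots> = F i" using i by simp
  finally show ?thesis .
qed

text \<open>\<open>J\<close> is the odd superderivation with x_i sent to \<theta>_i and \<theta>_i
  to - x_i. It therefore commutes with \<open>X\<close> and \<open>D\<close> and anticommutes with
  \<open>Th\<close> and \<open>Dt\<close>, up to the correction terms; in each case only the summand
  \<open>k = i\<close> contributes one.\<close>

lemma J_X:
  assumes "i \<le> n"
  shows "J n * X i = X i * J n + Th i"
proof -
  have key: "J_term k * X i = X i * J_term k + \<delta> k i * Th k" for k
    by (cases "k = i") (simp_all add: J_term_def \<delta>_def algebra_simps comm_gens')
  have "J n * X i = (\<Sum>k\<le>n. X i * J_term k + \<delta> k i * Th k)"
    by (simp only: J_def sum_distrib_right key)
  also have "\<dots> = X i * J n + Th i"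
    by (simp only: J_def sum.distrib sum_subtractf sum_negf sum_distrib_left[symmetric] sum_\<delta>[OF assms])
  finally show ?thesis .
qed

lemma J_D:
  assumes "i \<le> n"
  shows "J n * D i = D i * J n + Dt i"
proof -
  have key: "J_term k * D i = D i * J_term k + \<delta> k i * Dt k" for k
    by (cases "k = i") (simp_all add: J_term_def \<delta>_def algebra_simps comm_gens')
  have "J n * D i = (\<Sum>k\<le>n. D i * J_term k + \<delta> k i * Dt k)"
    by (simp only: J_def sum_distrib_right key)
  also have "\<dots> = D i * J n + Dt i"
    by (simp only: J_def sum.distrib sum_subtractf sum_negf sum_distrib_left[symmetric] sum_\<delta>[OF assms])
  finally show ?thesis .
qed

lemma J_Th:
  assumes "i \<le> n"
  shows "J n * Th i = - (Th i * J n) - X i"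
proof -
  have key: "J_term k * Th i = - (Th i * J_term k) - \<delta> k i * X k" for k
  proof (cases "k = i")
    case True
    then show ?thesis
      by (simp add: J_term_def \<delta>_def algebra_simps comm_gens' Th_Th_same Th_Th_same[THEN mult_eq_assoc])
  next
    case False
    then show ?thesis
      by (simp add: J_term_def \<delta>_def algebra_simps comm_gens' comm_ThTh[of i k] comm_ThTh[of i k, THEN mult_eq_assoc])
  qed
  have "J n * Th i = (\<Sum>k\<le>n. - (Th i * J_term k) - \<delta> k i * X k)"
    by (simp only: J_def sum_distrib_right key)
  also have "\<dots> = - (Th i * J n) - X i"
    by (simp only: J_def sum.distrib sum_subtractf sum_negf sum_distrib_left[symmetric] sum_\<delta>[OF assms])
  finally show ?thesis .
qed

lemma J_Dt:
  assumes "i \<le> n"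
  shows "J n * Dt i = - (Dt i * J n) + D i"
proof -
  have key: "J_term k * Dt i = - (Dt i * J_term k) + \<delta> k i * D k" for k
  proof (cases "k = i")
    case True
    then show ?thesis
      by (simp add: J_term_def \<delta>_def algebra_simps comm_gens' Dt_Dt_same Dt_Dt_same[THEN mult_eq_assoc])
  next
    case False
    then show ?thesis
      by (simp add: J_term_def \<delta>_def algebra_simps comm_gens' comm_DtDt[of i k] comm_DtDt[of i k, THEN mult_eq_assoc])
  qed
  have "J n * Dt i = (\<Sum>k\<le>n. - (Dt i * J_term k) + \<delta> k i * D k)"
    by (simp only: J_def sum_distrib_right key)
  also have "\<dots> = - (Dt i * J n) + D i"
    by (simp only: J_def sum.distrib sum_subtractf sum_negf sum_distrib_left[symmetric] sum_\<delta>[OF assms])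
  finally show ?thesis .
qed

lemmas J_gens = J_X J_D J_Th J_Dt
lemmas J_gens' = J_gens J_gens[THEN mult_eq_assoc]

lemma J_even_op: "i \<le> n \<Longrightarrow> j \<le> n \<Longrightarrow> J n * even_op i j = even_op i j * J n"
  by (simp add: even_op_def algebra_simps J_gens')

lemma J_odd_op: "i \<le> n \<Longrightarrow> j \<le> n \<Longrightarrow> J n * odd_op i j = - (odd_op i j * J n)"
  by (simp add: odd_op_def algebra_simps J_gens')

text \<open>The square of an odd operator is half its anticommutator with itself. Each summand
  \<open>J_term k\<close> contributes minus twice \<open>even_op k k\<close>, which gives the
  doubled identity; the sum on the right is the Euler operator.\<close>

lemma J_J: "J n * J n = - (\<Sum>k\<le>n. even_op k k)"
proof (rule endo_double_cancel)
  have key: "J n * J_term k = - (J_term k * J n) - even_op k k - even_op k k" if "k \<le> n" for k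
    using that by (simp add: J_term_def even_op_def algebra_simps J_gens')
  have "J n * J n = (\<Sum>k\<le>n. J n * J_term k)"
    by (subst (2) J_def) (rule sum_distrib_left)
  also have "\<dots> = (\<Sum>k\<le>n. - (J_term k * J n) - even_op k k - even_op k k)"
    by (rule sum.cong[OF refl], rule key) simp
  also have "\<dots> = - (\<Sum>k\<le>n. J_term k * J n) - (\<Sum>k\<le>n. even_op k k) - (\<Sum>k\<le>n. even_op k k)"
    by (simp only: sum_subtractf sum_negf)
  also have "(\<Sum>k\<le>n. J_term k * J n) = J n * J n"
    by (subst (2) J_def) (rule sum_distrib_right[symmetric])
  finally have "J n * J n + J n * J n =
      - (J n * J n) - (\<Sum>k\<le>n. even_op k k) - (\<Sum>k\<le>n. even_op k k) + J n * J n"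
    by (rule arg_cong[where f = "\<lambda>x. x + J n * J n"])
  then show "J n * J n + J n * J n = - (\<Sum>k\<le>n. even_op k k) + - (\<Sum>k\<le>n. even_op k k)"
    by simp
qed

section \<open>The space of states\<close>

lift_definition scalar_op :: "complex \<Rightarrow> 'a endo" is fscale
  by (intro conjI allI fscale_add) (simp add: mult.commute)

lemma app_scalar_op [simp]: "app (scalar_op c) f = fscale c f"
  by (simp only: scalar_op.rep_eq)

lemma scalar_op_central: "scalar_op c * T = T * scalar_op c"
  by (rule endo_eqI) simp

lemma scalar_op_central': "T * (scalar_op c * S) = scalar_op c * (T * S)"
  by (rule endo_eqI) simp

lemma scalar_op_add: "scalar_op (c + d) = scalar_op c + scalar_op d"
  by (rule endo_eqI) (simp add: algebra_simps)

lemma scalar_op_mult: "scalar_op (c * d) = scalar_op c * scalar_op d"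
  by (rule endo_eqI) simp

lemma scalar_op_0 [simp]: "scalar_op 0 = 0" and scalar_op_1 [simp]: "scalar_op 1 = 1"
  by (rule endo_eqI, simp)+

lemma scalar_op_minus: "scalar_op (- c) = - scalar_op c"
  by (rule endo_eqI) simp

definition supp :: "'a set \<Rightarrow> ('a \<Rightarrow> complex) set" where
  "supp S = {f. \<forall>k. k \<notin> S \<longrightarrow> f k = 0}"

lemma supp_0 [simp]: "0 \<in> supp S"
  by (simp add: supp_def)

lemma supp_add: "f \<in> supp S \<Longrightarrow> g \<in> supp S \<Longrightarrow> f + g \<in> supp S"
  and supp_diff: "f \<in> supp S \<Longrightarrow> g \<in> supp S \<Longrightarrow> f - g \<in> supp S"
  and supp_fscale: "f \<in> supp S \<Longrightarrow> fscale c f \<in> supp S"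
  by (simp_all add: supp_def)

lemma supp_sum: "(\<And>i. i \<in> I \<Longrightarrow> f i \<in> supp S) \<Longrightarrow> sum f I \<in> supp S"
  by (induction I rule: infinite_finite_induct) (simp_all add: supp_add)

lemma supp_disjoint: "f \<in> supp S \<Longrightarrow> f \<in> supp T \<Longrightarrow> S \<inter> T = {} \<Longrightarrow> f = 0"
  by (auto simp: supp_def fun_eq_iff)

definition fkeys :: "nat \<Rightarrow> nat \<Rightarrow> bool \<Rightarrow> fkey set" where
  "fkeys n p e = {(a, A). set_mset a \<subseteq> {..n} \<and> A \<subseteq> {..n} \<and> size a + card A = p \<and> even (card A) = e}"

lemma finite_fkeys: "finite (fkeys n p e)"
proof (rule finite_subset)
  show "fkeys n p e \<subseteq> mset ` {xs. set xs \<subseteq> {..n} \<and> length xs \<le> p} \<times> Pow {..n}"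
  proof
    fix k assume "k \<in> fkeys n p e"
    then obtain a A where k: "k = (a, A)" "set_mset a \<subseteq> {..n}" "A \<subseteq> {..n}" "size a \<le> p"
      by (auto simp: fkeys_def)
    obtain xs where "mset xs = a" using ex_mset by blast
    then show "k \<in> mset ` {xs. set xs \<subseteq> {..n} \<and> length xs \<le> p} \<times> Pow {..n}"
      using k by (auto intro!: image_eqI[of _ _ xs])
  qed
  show "finite (mset ` {xs. set xs \<subseteq> {..n} \<and> length xs \<le> p} \<times> Pow {..n})"
    by (intro finite_cartesian_product finite_imageI finite_lists_length_le) auto
qed

lemma D_supp: "f \<in> supp (fkeys n (Suc p) e) \<Longrightarrow> i \<le> n \<Longrightarrow> app (D i) f \<in> supp (fkeys n p e)"
  by (auto simp: supp_def fkeys_def app_D)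

lemma X_supp:
  assumes "f \<in> supp (fkeys n p e)" "i \<le> n"
  shows "app (X i) f \<in> supp (fkeys n (Suc p) e)"
proof -
  have "app (X i) f (a, A) = 0" if "(a, A) \<notin> fkeys n (Suc p) e" for a A
  proof (cases "i \<in># a")
    case True
    then obtain b where "a = add_mset i b" by (blast dest: multi_member_split)
    then show ?thesis using that assms by (auto simp: supp_def fkeys_def app_X)
  qed (simp add: app_X not_in_iff)
  then show ?thesis by (auto simp: supp_def)
qed

lemma Dt_supp:
  assumes "f \<in> supp (fkeys n (Suc p) e)" "i \<le> n"
  shows "app (Dt i) f \<in> supp (fkeys n p (\<not> e))"
proof -
  have "(a, insert i A) \<notin> fkeys n (Suc p) e" if "(a, A) \<notin> fkeys n p (\<not> e)" "i \<notin> A" for a A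
    using that assms(2) finite_subset[of A "{..n}"] by (auto simp: fkeys_def)
  then show ?thesis using assms(1) by (auto simp: supp_def app_Dt)
qed

lemma Th_supp:
  assumes "f \<in> supp (fkeys n p e)" "i \<le> n"
  shows "app (Th i) f \<in> supp (fkeys n (Suc p) (\<not> e))"
proof -
  have "(a, A - {i}) \<notin> fkeys n p e" if nin: "(a, A) \<notin> fkeys n (Suc p) (\<not> e)" and i: "i \<in> A" for a A
  proof
    assume "(a, A - {i}) \<in> fkeys n p e"
    moreover obtain B where "A = insert i B" "i \<notin> B" using i by (blast dest: mk_disjoint_insert)
    ultimately show False
      using nin assms(2) finite_subset[of B "{..n}"] by (auto simp: fkeys_def)
  qed
  then show ?thesis using assms(1) by (auto simp: supp_def app_Th)
qed

lemma even_op_supp: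
  assumes "f \<in> supp (fkeys n p e)" "i \<le> n" "j \<le> n" "1 \<le> p"
  shows "app (even_op i j) f \<in> supp (fkeys n p e)"
proof -
  obtain q where p: "p = Suc q" using assms(4) by (cases p) auto
  have "app (Th i) (app (Dt j) f) \<in> supp (fkeys n (Suc q) (\<not> \<not> e))"
    using assms unfolding p by (intro Th_supp Dt_supp)
  moreover have "app (X i) (app (D j) f) \<in> supp (fkeys n (Suc q) e)"
    using assms unfolding p by (intro X_supp D_supp)
  ultimately show ?thesis by (simp add: even_op_def p supp_add)
qed

lemma XDt_supp: "f \<in> supp (fkeys n p e) \<Longrightarrow> i \<le> n \<Longrightarrow> j \<le> n \<Longrightarrow> 1 \<le> p \<Longrightarrow>
    app (X i) (app (Dt j) f) \<in> supp (fkeys n p (\<not> e))"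
  by (cases p) (auto intro!: X_supp Dt_supp)

lemma ThD_supp: "f \<in> supp (fkeys n p e) \<Longrightarrow> i \<le> n \<Longrightarrow> j \<le> n \<Longrightarrow> 1 \<le> p \<Longrightarrow>
    app (Th i) (app (D j) f) \<in> supp (fkeys n p (\<not> e))"
  by (cases p) (auto intro!: Th_supp D_supp)

lemma odd_op_supp: "f \<in> supp (fkeys n p e) \<Longrightarrow> i \<le> n \<Longrightarrow> j \<le> n \<Longrightarrow> 1 \<le> p \<Longrightarrow>
    app (odd_op i j) f \<in> supp (fkeys n p (\<not> e))"
  by (simp add: odd_op_def supp_add XDt_supp ThD_supp)

lemma J_supp: "f \<in> supp (fkeys n p e) \<Longrightarrow> 1 \<le> p \<Longrightarrow> app (J n) f \<in> supp (fkeys n p (\<not> e))"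
  by (auto simp: J_def J_term_def app_sum_left intro!: supp_sum supp_diff XDt_supp ThD_supp)

text \<open>Both summands are number operators, counting x_k and \<theta>_k. The keys thus
  diagonalize all even e_kk simultaneously, which makes the weight spaces visible later.\<close>

lemma even_op_diag: "app (even_op k k) f (a, A) = (of_nat (count a k) + of_bool (k \<in> A)) * f (a, A)"
proof -
  have "app (X k) (app (D k) f) (a, A) = of_nat (count a k) * f (a, A)"
    by (cases "k \<in># a") (auto simp: app_gens not_in_iff dest!: multi_member_split)
  moreover have "fermi_sign k (A - {k}) = fermi_sign k A" by (simp add: fermi_sign_def) (metis nless_le)
  then have "app (Th k) (app (Dt k) f) (a, A) = of_bool (k \<in> A) * f (a, A)"
    by (simp add: app_gens insert_absorb)
  ultimately show ?thesis by (simp add: even_op_def algebra_simps)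
qed

text \<open>Euler's formula: the number operators add up to the total degree, which is
  \<open>p\<close> on every key in the support.\<close>

lemma J_J_supp:
  assumes "f \<in> supp (fkeys n p e)"
  shows "app (J n) (app (J n) f) = fscale (- of_nat p) f"
proof -
  have "(\<Sum>k\<le>n. app (even_op k k) f) = fscale (of_nat p) f"
  proof
    fix x :: fkey
    obtain a A where x: "x = (a, A)" by (cases x)
    have "(\<Sum>k\<le>n. app (even_op k k) f) x = (\<Sum>k\<le>n. app (even_op k k) f (a, A))"
      by (simp add: x) (induction n; simp)
    also have "\<dots> = (\<Sum>k\<le>n. of_nat (count a k) + of_bool (k \<in> A)) * f (a, A)"
      by (simp only: even_op_diag sum_distrib_right)
    also have "\<dots> = of_nat p * f (a, A)"
    proof (cases "(a, A) \<in> fkeys n p e")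
      case True
      then have a: "set_mset a \<subseteq> {..n}" and A: "A \<subseteq> {..n}" and p: "size a + card A = p"
        by (auto simp: fkeys_def)
      have "(\<Sum>k\<le>n. count a k) = size a"
        unfolding size_multiset_overloaded_eq using a
        by (intro sum.mono_neutral_right) (auto simp: not_in_iff)
      moreover have "(\<Sum>k\<le>n. of_bool (k \<in> A)) = card A"
        using A by (simp add: Int_absorb1 flip: Int_def)
      ultimately have "(\<Sum>k\<le>n. count a k + of_bool (k \<in> A)) = p"
        using p by (simp add: sum.distrib)
      then have "of_nat p = (of_nat (\<Sum>k\<le>n. count a k + of_bool (k \<in> A)) :: complex)"
        by (simp only:)
      then show ?thesis by (simp add: sum.distrib)
    next
      case False
      then show ?thesis using assms by (simp add: supp_def)
    qed
    finally show "(\<Sum>k\<le>n. app (even_op k k) f) x = fscale (of_nat p) f x" by (simp add: x)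
  qed
  moreover have "app (J n) (app (J n) f) = app (J n * J n) f" by simp
  ultimately show ?thesis
    by (simp only: J_J app_simps app_sum_left) (rule ext, simp)
qed

text \<open>The sign makes the odd \<open>e\<^sub>0\<^sub>0\<close> act on the top vector by \<open>+\<surd>p\<close>, whatever the parity of \<open>n\<close>.\<close>

definition q_op :: "nat \<Rightarrow> nat \<Rightarrow> qidx \<Rightarrow> fkey endo" where
  "q_op n p = (\<lambda>(i, j, \<sigma>). if \<sigma> = 0 then even_op i j
     else scalar_op ((- 1) ^ n / of_real (sqrt (real p))) * (odd_op i j * J n))"

definition states :: "nat \<Rightarrow> nat \<Rightarrow> (fkey \<Rightarrow> complex) set" where
  "states n p = supp (fkeys n p (even n))"

lemma q_op_states:
  assumes "a \<in> G_idx n" "1 \<le> p" "w \<in> states n p"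
  shows "app (q_op n p a) w \<in> states n p"
proof -
  obtain i j \<sigma> where a: "a = (i, j, \<sigma>)" "i \<le> n" "j \<le> n" using assms(1) by (auto simp: G_idx_def)
  have "app (odd_op i j) (app (J n) w) \<in> supp (fkeys n p (\<not> \<not> even n))"
    using assms a by (intro odd_op_supp J_supp) (auto simp: states_def)
  then show ?thesis using assms a by (simp add: q_op_def states_def even_op_supp supp_fscale)
qed

lemma \<delta>_commute: "\<delta> i j = \<delta> j i"
  by (simp add: \<delta>_def eq_commute)

text \<open>If at most one of the two elements is odd, \<open>?R\<close> vanishes as an operator,
  being a bracket of derivations times at most one \<open>J\<close>. For two odd elements it
  vanishes only on \<open>states\<close>, where J^2 = -p. The difference has the shape of
  \<open>ev_basis_rel\<close>, so it says that \<open>basis_rel\<close> acts by zero.\<close>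

lemma q_op_bracket:
  assumes "i \<le> n" "j \<le> n" "k \<le> n" "l \<le> n" "1 \<le> p" "w \<in> states n p"
  shows "app (q_op n p (i, j, \<sigma>) * q_op n p (k, l, \<theta>)
      - scalar_op (super_sign \<sigma> \<theta>) * (q_op n p (k, l, \<theta>) * q_op n p (i, j, \<sigma>))
      - (\<delta> j k * q_op n p (i, l, \<sigma> + \<theta>) - scalar_op (super_sign \<sigma> \<theta>) * (\<delta> i l * q_op n p (k, j, \<sigma> + \<theta>)))) w = 0"
    (is "app ?R w = 0")
proof -
  define c :: complex where "c = (- 1) ^ n / of_real (sqrt (real p))"
  have \<delta>_scalar_op: "\<delta> x y * (scalar_op c * T) = scalar_op c * (\<delta> x y * T)" for x y T
    by (cases "x = y") (simp_all add: \<delta>_def)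
  have cc: "c * c * of_nat p = 1"
  proof -
    have "(complex_of_real (sqrt (real p)))\<^sup>2 = of_nat p"
      by (simp flip: of_real_power)
    then show ?thesis using assms(5) by (simp add: c_def field_simps power2_eq_square)
  qed
  consider "\<sigma> = 0" "\<theta> = 0" | "\<sigma> = 0" "\<theta> = 1" | "\<sigma> = 1" "\<theta> = 0" | "\<sigma> = 1" "\<theta> = 1"
    by (cases \<sigma>; cases \<theta>) auto
  then show ?thesis
  proof cases
    case 1
    then have "?R = 0" by (simp add: q_op_def super_sign_def even_op_even_op[of i j k l])
    then have "app ?R w = app 0 w" by (rule arg_cong[where f = "\<lambda>T. app T w"])
    then show ?thesis by (simp only: app_simps)
  next
    case 2
    have "?R = scalar_op c * ((even_op i j * odd_op k l - odd_op k l * even_op i j - (\<delta> j k * odd_op i l - \<delta> i l * odd_op k j)) * J n)"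
      using assms by (simp add: 2 q_op_def super_sign_def algebra_simps scalar_op_central' \<delta>_scalar_op J_even_op flip: c_def)
    also have "\<dots> = 0" by (simp add: even_op_odd_op[of i j k l])
    finally have "app ?R w = app 0 w" by (rule arg_cong[where f = "\<lambda>T. app T w"])
    then show ?thesis by (simp only: app_simps)
  next
    case 3
    have "?R = scalar_op c * ((odd_op i j * even_op k l - even_op k l * odd_op i j - (\<delta> j k * odd_op i l - \<delta> i l * odd_op k j)) * J n)"
      using assms by (simp add: 3 q_op_def super_sign_def algebra_simps scalar_op_central' \<delta>_scalar_op J_even_op flip: c_def)
    also have "\<dots> = 0"
      by (simp add: even_op_odd_op[of k l i j] \<delta>_commute[of k j] \<delta>_commute[of l i])
    finally have "app ?R w = app 0 w" by (rule arg_cong[where f = "\<lambda>T. app T w"])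
    then show ?thesis by (simp only: app_simps)
  next
    case 4
    define E where "E = \<delta> j k * even_op i l + \<delta> i l * even_op k j"
    have E: "odd_op i j * odd_op k l + odd_op k l * odd_op i j = E" by (simp add: E_def odd_op_odd_op[of i j k l])
    \<comment> \<open>Moving the inner \<open>J\<close> past the odd derivation costs a sign, which
      J^2 = -p compensates; the square \<open>c * c\<close> of the prefactor then cancels the
      remaining \<open>p\<close>.\<close>
    have "J n * odd_op i j * J n = - (odd_op i j * J n * J n)" "J n * odd_op k l * J n = - (odd_op k l * J n * J n)"
      using assms by (simp_all add: J_odd_op)
    then have "odd_op i j * (J n * (odd_op k l * J n)) = - (odd_op i j * odd_op k l * (J n * J n))"
        "odd_op k l * (J n * (odd_op i j * J n)) = - (odd_op k l * odd_op i j * (J n * J n))"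
      by (simp_all add: mult.assoc)
    then have "?R = - (scalar_op (c * c) * ((odd_op i j * odd_op k l + odd_op k l * odd_op i j) * (J n * J n))) - E"
      by (simp add: 4 q_op_def super_sign_def algebra_simps scalar_op_mult scalar_op_minus E_def
          scalar_op_central'[of "J n"] scalar_op_central'[of "odd_op i j"] scalar_op_central'[of "odd_op k l"] flip: c_def)
    then have "app ?R w = app (- (scalar_op (c * c) * (E * (J n * J n))) - E) w"
      unfolding E by (rule arg_cong[where f = "\<lambda>T. app T w"])
    also have "\<dots> = - fscale (c * c) (app E (app (J n) (app (J n) w))) - app E w"
      by (simp only: app_simps app_scalar_op)
    also have "app (J n) (app (J n) w) = fscale (- of_nat p) w"
      using assms(6) unfolding states_def by (rule J_J_supp)
    finally have "app ?R w = - fscale (c * c) (app E (fscale (- of_nat p) w)) - app E w" .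
    also have "fscale (c * c) (app E (fscale (- of_nat p) w)) = fscale (c * c * - of_nat p) (app E w)"
      by (simp only: app_fscale fscale_fscale)
    also have "c * c * - of_nat p = - 1" using cc by simp
    finally show ?thesis by (simp only: fscale_minus_one minus_minus diff_self)
  qed
qed

section \<open>Singular vectors\<close>

lemma fscale_minus_left: "fscale (- c) f = - fscale c f"
  by (rule ext) simp

lemma one_plus_of_nat_nonzero: "1 + complex_of_nat m \<noteq> 0"
  by (metis nat.distinct(1) of_nat_Suc of_nat_eq_0_iff)

definition bfun :: "'a \<Rightarrow> 'a \<Rightarrow> complex" where
  "bfun k = (\<lambda>x. of_bool (x = k))"

text \<open>The rule x_i (x^a/a!) = (a_i + 1) x^b/b!, where b is a with i added.\<close>

lemma app_X_bfun: "app (X i) (bfun (a, A)) = fscale (of_nat (count a i + 1)) (bfun (add_mset i a, A))"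
proof
  fix x :: fkey
  obtain b B where x: "x = (b, B)" by (cases x)
  show "app (X i) (bfun (a, A)) x = fscale (of_nat (count a i + 1)) (bfun (add_mset i a, A)) x"
  proof (cases "i \<in># b")
    case True
    then obtain c where "b = add_mset i c" by (blast dest: multi_member_split)
    then show ?thesis by (auto simp: x app_X bfun_def)
  next
    case False
    then show ?thesis by (auto simp: x app_X bfun_def not_in_iff)
  qed
qed

lemma app_D_bfun_add: "app (D i) (bfun (add_mset i a, A)) = bfun (a, A)"
  by (rule ext) (auto simp: app_D bfun_def split_paired_all)

lemma app_D_bfun_0: "i \<notin># a \<Longrightarrow> app (D i) (bfun (a, A)) = 0"
  by (rule ext) (auto simp: app_D bfun_def split_paired_all)

lemma app_Th_bfun_0: "i \<in> A \<Longrightarrow> app (Th i) (bfun (a, A)) = 0"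
  by (rule ext) (auto simp: app_Th bfun_def split_paired_all)

lemma app_Dt_bfun_0: "i \<notin> A \<Longrightarrow> app (Dt i) (bfun (a, A)) = 0"
  by (rule ext) (auto simp: app_Dt bfun_def split_paired_all)

lemma fermi_sign_insert_same: "fermi_sign i (insert i A) = fermi_sign i A"
  by (simp add: fermi_sign_def) (metis nless_le)

lemma app_Th_bfun: "i \<notin> A \<Longrightarrow> app (Th i) (bfun (a, A)) = fscale (fermi_sign i A) (bfun (a, insert i A))"
proof
  fix x :: fkey
  assume i: "i \<notin> A"
  obtain b B where x: "x = (b, B)" by (cases x)
  have "i \<in> B \<and> B - {i} = A \<longleftrightarrow> B = insert i A" using i by auto
  then show "app (Th i) (bfun (a, A)) x = fscale (fermi_sign i A) (bfun (a, insert i A)) x"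
    using i by (auto simp: x app_Th bfun_def fermi_sign_insert_same)
qed

lemma app_Dt_bfun: "i \<notin> A \<Longrightarrow> app (Dt i) (bfun (a, insert i A)) = fscale (fermi_sign i A) (bfun (a, A))"
proof
  fix x :: fkey
  assume i: "i \<notin> A"
  obtain b B where x: "x = (b, B)" by (cases x)
  have "i \<notin> B \<and> insert i B = insert i A \<longleftrightarrow> B = A" using i by auto
  then show "app (Dt i) (bfun (a, insert i A)) x = fscale (fermi_sign i A) (bfun (a, A)) x"
    by (auto simp: x app_Dt bfun_def)
qed

text \<open>The only monomial of degree \<open>p\<close> in x_0 and \<theta>_0 alone whose number of
  odd variables has the parity of n.\<close>

definition top_key :: "nat \<Rightarrow> nat \<Rightarrow> fkey" where
  "top_key n p = (if even n then (replicate_mset p 0, {}) else (replicate_mset (p - 1) 0, {0}))"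

definition top_state :: "nat \<Rightarrow> nat \<Rightarrow> fkey \<Rightarrow> complex" where
  "top_state n p = bfun (top_key n p)"

lemma top_key_fkeys: "1 \<le> p \<Longrightarrow> top_key n p \<in> fkeys n p (even n)"
  by (auto simp: top_key_def fkeys_def)

lemma bfun_supp: "k \<in> S \<Longrightarrow> bfun k \<in> supp S"
  by (auto simp: supp_def bfun_def)

lemma top_state_states: "1 \<le> p \<Longrightarrow> top_state n p \<in> states n p"
  by (simp add: states_def top_state_def bfun_supp top_key_fkeys)

lemma top_state_nonzero: "top_state n p \<noteq> 0"
proof
  assume "top_state n p = 0"
  then have "top_state n p (top_key n p) = 0" by simp
  then show False by (simp add: top_state_def bfun_def)
qed

lemma q_op_00_top_state:
  assumes "1 \<le> p"
  shows "app (q_op n p (0, 0, 0)) (top_state n p) = fscale (of_nat p) (top_state n p)"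
proof
  fix x :: fkey
  obtain a A where x: "x = (a, A)" by (cases x)
  show "app (q_op n p (0, 0, 0)) (top_state n p) x = fscale (of_nat p) (top_state n p) x"
    using assms
    by (auto simp: x q_op_def even_op_diag top_state_def top_key_def bfun_def of_nat_diff split: if_splits)
qed

lemma J_top_state_even: "app (J n) (bfun (replicate_mset (Suc q) 0, {})) = bfun (replicate_mset q 0, {0})"
proof -
  have "app (J_term k) (bfun (replicate_mset (Suc q) 0, {})) = (if k = 0 then bfun (replicate_mset q 0, {0}) else 0)" for k
    by (simp add: J_term_def app_D_bfun_add app_D_bfun_0 app_Dt_bfun_0 app_Th_bfun fermi_sign_def)
  then show ?thesis by (simp add: J_def app_sum_left)
qed

lemma J_top_state_odd: "app (J n) (bfun (replicate_mset q 0, {0})) = fscale (- of_nat (Suc q)) (bfun (replicate_mset (Suc q) 0, {}))"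
proof -
  have *: "app (Th 0) (app (D 0) (bfun (replicate_mset q 0, {0}))) = 0"
  proof (cases q)
    case 0
    then show ?thesis by (simp add: app_D_bfun_0)
  next
    case (Suc r)
    then show ?thesis by (simp add: app_D_bfun_add app_Th_bfun_0)
  qed
  have "app (J_term k) (bfun (replicate_mset q 0, {0})) =
      (if k = 0 then fscale (- of_nat (Suc q)) (bfun (replicate_mset (Suc q) 0, {})) else 0)" for k
  proof (cases "k = 0")
    case True
    have "app (X 0) (app (Dt 0) (bfun (replicate_mset q 0, {0}))) =
        fscale (of_nat (Suc q)) (bfun (replicate_mset (Suc q) 0, {}))"
      using app_Dt_bfun[of 0 "{}" "replicate_mset q 0"] by (simp add: fermi_sign_def app_X_bfun)
    then show ?thesis
      by (simp only: True J_term_def app_simps * if_True simp_thms diff_0 fscale_minus_left)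
  next
    case False
    then show ?thesis by (simp add: J_term_def app_D_bfun_0 app_Dt_bfun_0)
  qed
  then show ?thesis by (simp only: J_def app_sum_left) simp
qed

lemma q_op_01_top_state:
  assumes "1 \<le> p"
  shows "app (q_op n p (0, 0, 1)) (top_state n p) = fscale (of_real (sqrt (real p))) (top_state n p)"
proof -
  obtain q where p: "p = Suc q" using assms by (cases p) auto
  have p_minus: "p - 1 = q" by (simp add: p)
  have p_div: "1 / of_real (sqrt (real p)) * of_nat p = (of_real (sqrt (real p)) :: complex)"
  proof -
    have "complex_of_real (sqrt (real p)) * of_real (sqrt (real p)) = of_nat p"
      by (simp flip: of_real_mult)
    then show ?thesis using assms by (simp add: field_simps)
  qed
  \<comment> \<open>For odd n the top vector carries \<theta>_0, on which \<open>J\<close> produces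
    the factor -p; the sign of the prefactor in \<open>q_op\<close> cancels it.\<close>
  then have p_div': "- 1 / of_real (sqrt (real p)) * - of_nat p = (of_real (sqrt (real p)) :: complex)"
    by simp
  have XDt: "app (X 0) (app (Dt 0) (bfun (replicate_mset q 0, {0}))) =
      fscale (of_nat p) (bfun (replicate_mset p 0, {}))"
    using app_Dt_bfun[of 0 "{}" "replicate_mset q 0"] by (simp add: fermi_sign_def app_X_bfun p)
  have ThD: "app (Th 0) (app (D 0) (bfun (replicate_mset p 0, {}))) = bfun (replicate_mset q 0, {0})"
    by (simp add: p app_D_bfun_add app_Th_bfun fermi_sign_def)
  have ThD0: "app (Th 0) (app (D 0) (bfun (replicate_mset q 0, {0}))) = 0"
    by (cases q) (simp_all add: app_D_bfun_0 app_D_bfun_add app_Th_bfun_0)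
  have XDt0: "app (X 0) (app (Dt 0) (bfun (replicate_mset p 0, {}))) = 0"
    by (simp add: app_Dt_bfun_0)
  show ?thesis
  proof (cases "even n")
    case True
    then have "app (q_op n p (0, 0, 1)) (top_state n p) =
        fscale (1 / of_real (sqrt (real p))) (app (odd_op 0 0) (app (J n) (bfun (replicate_mset (Suc q) 0, {}))))"
      by (simp add: q_op_def top_state_def top_key_def p)
    also have "app (odd_op 0 0) (app (J n) (bfun (replicate_mset (Suc q) 0, {}))) = fscale (of_nat p) (bfun (replicate_mset p 0, {}))"
      unfolding J_top_state_even by (simp only: odd_op_def app_simps XDt ThD0 add_0_right)
    finally show ?thesis by (simp only: fscale_fscale p_div top_state_def top_key_def True if_True)
  next
    case False
    then have "app (q_op n p (0, 0, 1)) (top_state n p) =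
        fscale (- 1 / of_real (sqrt (real p))) (app (odd_op 0 0) (app (J n) (bfun (replicate_mset q 0, {0}))))"
      by (simp add: q_op_def top_state_def top_key_def p)
    also have "app (odd_op 0 0) (app (J n) (bfun (replicate_mset q 0, {0}))) =
        fscale (- of_nat p) (bfun (replicate_mset q 0, {0}))"
      unfolding J_top_state_odd p[symmetric] by (simp only: app_fscale odd_op_def app_simps XDt0 ThD add_0)
    finally show ?thesis
      by (simp only: fscale_fscale p_div' top_state_def top_key_def False if_False p_minus)
  qed
qed

text \<open>The eigenvalue of the even e_00 at a key.\<close>

definition deg0 :: "fkey \<Rightarrow> nat" where
  "deg0 = (\<lambda>(a, A). count a 0 + of_bool (0 \<in> A))"

lemma even_op_0i: "i \<noteq> 0 \<Longrightarrow> app (even_op 0 i) f (a, A) =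
    of_nat (count a 0) * f (add_mset i (a - {#0#}), A)
    + (if 0 \<in> A \<and> i \<notin> A then fermi_sign 0 A * fermi_sign i (A - {0}) * f (a, insert i (A - {0})) else 0)"
  by (simp add: even_op_def app_gens)

lemma odd_op_0i: "i \<noteq> 0 \<Longrightarrow> app (odd_op 0 i) f (a, A) =
    (if i \<notin> A then of_nat (count a 0) * fermi_sign i A * f (a - {#0#}, insert i A) else 0)
    + (if 0 \<in> A then fermi_sign 0 A * f (add_mset i a, A - {0}) else 0)"
  by (simp add: odd_op_def app_gens)

text \<open>\<open>J\<close> is invertible in degree \<open>p\<close>, since its square is a nonzero
  scalar. The derivation itself can thus be recovered from \<open>q_op\<close>; unlike
  \<open>q_op\<close>, it is easy to evaluate at a single key.\<close>

lemma odd_op_of_q_op: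
  assumes "w \<in> states n p" "i \<le> n" "j \<le> n" "1 \<le> p"
  obtains c where "app (odd_op i j) w = fscale c (app (J n) (app (q_op n p (i, j, 1)) w))"
proof -
  define d :: complex where "d = (- 1) ^ n / of_real (sqrt (real p))"
  have d: "d \<noteq> 0" using assms by (simp add: d_def)
  have "app (J n) (app (q_op n p (i, j, 1)) w) = fscale d (app (J n * odd_op i j) (app (J n) w))"
    by (simp add: q_op_def d_def)
  also have "\<dots> = - fscale d (app (odd_op i j) (app (J n) (app (J n) w)))"
    using assms by (simp add: J_odd_op)
  also have "app (J n) (app (J n) w) = fscale (- of_nat p) w"
    using assms(1) unfolding states_def by (rule J_J_supp)
  finally have "app (J n) (app (q_op n p (i, j, 1)) w) = - fscale (d * - of_nat p) (app (odd_op i j) w)"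
    by (simp only: app_fscale fscale_fscale)
  then have "app (J n) (app (q_op n p (i, j, 1)) w) = fscale (d * of_nat p) (app (odd_op i j) w)"
    by (simp add: fun_eq_iff)
  then have "app (odd_op i j) w = fscale (1 / (d * of_nat p)) (app (J n) (app (q_op n p (i, j, 1)) w))"
    using d assms(4) by simp
  then show thesis by (rule that)
qed

text \<open>The equations for the derivations are read at keys with one more x_0 than the
  coefficient in question, so that this coefficient appears with a nonzero factor. For
  \<open>0 \<notin> A\<close> (\<open>z1\<close>, \<open>z2\<close>) it is the only term. What
  survives uses no index except 0, and the parity then decides whether \<theta>_0 occurs.\<close>

lemma singular_vector:
  assumes w: "w \<in> states n p" and p: "1 \<le> p"
    and sing: "\<And>i \<sigma>. i \<in> {1..n} \<Longrightarrow> app (q_op n p (0, i, \<sigma>)) w = 0"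
  shows "w = fscale (w (top_key n p)) (top_state n p)"
proof -
  have even_op: "app (even_op 0 i) w k = 0" if "i \<in> {1..n}" for i k
    using sing[OF that, of 0] by (simp add: q_op_def)
  have odd_op: "app (odd_op 0 i) w k = 0" if i: "i \<in> {1..n}" for i k
  proof -
    obtain c where "app (odd_op 0 i) w = fscale c (app (J n) (app (q_op n p (0, i, 1)) w))"
      using odd_op_of_q_op[OF w _ _ p, of 0 i] i by auto
    then show ?thesis using sing[OF i, of 1] by simp
  qed
  have supp: "set_mset a \<subseteq> {..n}" "A \<subseteq> {..n}" "size a + card A = p" "even (card A) = even n"
    if "w (a, A) \<noteq> 0" for a A
    using w that by (auto simp: states_def supp_def fkeys_def)
  have z1: "w (add_mset i b, A) = 0" if "0 \<notin> A" "i \<noteq> 0" for i b A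
  proof (rule ccontr)
    assume nz: "w (add_mset i b, A) \<noteq> 0"
    with supp(1) that have "i \<in> {1..n}" by fastforce
    from even_op[OF this, of "(add_mset 0 b, A)"] nz that show False
      by (simp add: even_op_0i one_plus_of_nat_nonzero)
  qed
  have z2: "w (b, A) = 0" if "0 \<notin> A" "i \<in> A" for i b A
  proof (rule ccontr)
    assume nz: "w (b, A) \<noteq> 0"
    have i0: "i \<noteq> 0" using that by metis
    with supp(2)[OF nz] that have "i \<in> {1..n}" by fastforce
    from odd_op[OF this, of "(add_mset 0 b, A - {i})"] nz that i0 show False
      by (simp add: odd_op_0i insert_absorb one_plus_of_nat_nonzero)
  qed
  have z3: "w (add_mset i b, A) = 0" if "0 \<in> A" "i \<noteq> 0" for i b A
  proof (rule ccontr)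
    assume nz: "w (add_mset i b, A) \<noteq> 0"
    with supp(1) that have "i \<in> {1..n}" by fastforce
    \<comment> \<open>The second term lacks \<theta>_0 and contains \<theta>_i, so \<open>z2\<close>
      removes it.\<close>
    from even_op[OF this, of "(add_mset 0 b, A)"] nz that z2[of "insert i (A - {0})" i] show False
      by (simp add: even_op_0i one_plus_of_nat_nonzero split: if_splits)
  qed
  have z4: "w (b, A) = 0" if "0 \<in> A" "i \<in> A" "i \<noteq> 0" for i b A
  proof (rule ccontr)
    assume nz: "w (b, A) \<noteq> 0"
    with supp(2)[OF nz] that have "i \<in> {1..n}" by fastforce
    \<comment> \<open>The second term lacks \<theta>_0 and contains x_i, so \<open>z1\<close>
      removes it.\<close>
    from odd_op[OF this, of "(add_mset 0 b, A - {i})"] nz that z1[of "A - {i} - {0}" i] show False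
      by (simp add: odd_op_0i insert_absorb one_plus_of_nat_nonzero)
  qed
  have only: "k = top_key n p" if nz: "w k \<noteq> 0" for k
  proof -
    obtain a A where k: "k = (a, A)" by (cases k)
    have "i = 0" if i: "i \<in># a" for i
    proof (rule ccontr)
      assume "i \<noteq> 0"
      obtain b where "a = add_mset i b" using i by (blast dest: multi_member_split)
      then show False using z1[of A i b] z3[of A i b] \<open>i \<noteq> 0\<close> nz k by (cases "0 \<in> A") auto
    qed
    then have a: "a = replicate_mset (size a) 0"
      by (intro set_mset_subset_singletonD) auto
    have "A = {} \<or> A = {0}" using z2[of A _ a] z4[of A _ a] nz k by (cases "0 \<in> A") auto
    then show ?thesis
      using supp(3,4)[of a A] nz k a by (auto simp: top_key_def)
  qed
  show ?thesis
  proof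
    fix k show "w k = fscale (w (top_key n p)) (top_state n p) k"
      using only[of k] by (cases "k = top_key n p") (auto simp: top_state_def bfun_def)
  qed
qed

section \<open>Irreducibility\<close>

definition fun_subspace :: "('a \<Rightarrow> complex) set \<Rightarrow> bool" where
  "fun_subspace M \<longleftrightarrow> 0 \<in> M \<and> (\<forall>f\<in>M. \<forall>g\<in>M. f + g \<in> M) \<and> (\<forall>c. \<forall>f\<in>M. fscale c f \<in> M)"

lemma fsubD:
  assumes "fun_subspace M"
  shows "0 \<in> M" "f \<in> M \<Longrightarrow> g \<in> M \<Longrightarrow> f + g \<in> M" "f \<in> M \<Longrightarrow> fscale c f \<in> M"
  using assms by (auto simp: fun_subspace_def)

lemma fun_subspace_diff: "fun_subspace M \<Longrightarrow> f \<in> M \<Longrightarrow> g \<in> M \<Longrightarrow> f - g \<in> M"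
  using fsubD(2)[of M f "fscale (-1) g"] fsubD(3)[of M g "-1"] by (simp add: fscale_minus_one)

lemma fun_subspace_sum: "fun_subspace M \<Longrightarrow> (\<And>i. i \<in> I \<Longrightarrow> f i \<in> M) \<Longrightarrow> sum f I \<in> M"
  by (induction I rule: infinite_finite_induct) (simp_all add: fsubD)

lemma fun_subspace_fscale_iff: "fun_subspace M \<Longrightarrow> c \<noteq> 0 \<Longrightarrow> fscale c f \<in> M \<longleftrightarrow> f \<in> M"
  using fsubD(3)[of M "fscale c f" "1 / c"] fsubD(3)[of M f c] by auto

definition stable :: "nat \<Rightarrow> nat \<Rightarrow> (fkey \<Rightarrow> complex) set \<Rightarrow> bool" where
  "stable n p M \<longleftrightarrow> fun_subspace M \<and> M \<subseteq> states n p \<and> (\<forall>a\<in>G_idx n. \<forall>f\<in>M. app (q_op n p a) f \<in> M)"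

text \<open>\<open>J\<close> exchanges one x_k and \<theta>_k of the same index, which leaves the
  eigenvalue of e_00 unchanged.\<close>

lemma deg0_J: "f \<in> supp {k. q \<le> deg0 k} \<Longrightarrow> app (J n) f \<in> supp {k. q \<le> deg0 k}"
proof -
  assume f: "f \<in> supp {k. q \<le> deg0 k}"
  have "app (J_term k) f (a, A) = 0" if "\<not> q \<le> deg0 (a, A)" for k a A
  proof -
    have "k \<in> A \<Longrightarrow> deg0 (add_mset k a, A - {k}) = deg0 (a, A)"
      by (cases "k = 0") (auto simp: deg0_def)
    moreover have "k \<notin> A \<Longrightarrow> k \<in># a \<Longrightarrow> deg0 (a - {#k#}, insert k A) = deg0 (a, A)"
      by (auto simp: deg0_def dest!: multi_member_split)
    ultimately show ?thesis
      using that f by (cases "k \<in># a") (auto simp: J_term_def app_gens supp_def not_in_iff)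
  qed
  then have "app (J_term k) f \<in> supp {k. q \<le> deg0 k}" for k
    by (auto simp: supp_def)
  then show ?thesis by (auto simp: J_def app_sum_left intro!: supp_sum)
qed

text \<open>The derivations e_0i replace a variable of index \<open>i\<close> by one of index 0, and
  the twist by \<open>J\<close> keeps \<open>deg0\<close>.\<close>

lemma deg0_q_op_0i:
  assumes f: "f \<in> supp {k. q \<le> deg0 k}" and i: "i \<noteq> 0"
  shows "app (q_op n p (0, i, \<sigma>)) f \<in> supp {k. Suc q \<le> deg0 k}"
proof -
  have even_op: "app (even_op 0 i) f \<in> supp {k. Suc q \<le> deg0 k}"
  proof -
    have "app (even_op 0 i) f (a, A) = 0" if nle: "\<not> Suc q \<le> deg0 (a, A)" for a A
    proof -
      have "0 \<in># a \<Longrightarrow> \<not> q \<le> deg0 (add_mset i (a - {#0#}), A)"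
        using nle i by (auto simp: deg0_def dest!: multi_member_split)
      moreover have "0 \<in> A \<Longrightarrow> \<not> q \<le> deg0 (a, insert i (A - {0}))"
        using nle i by (auto simp: deg0_def)
      ultimately show ?thesis
        using f by (cases "0 \<in># a") (auto simp: even_op_0i[OF i] supp_def not_in_iff)
    qed
    then show ?thesis by (auto simp: supp_def)
  qed
  have odd_op: "app (odd_op 0 i) g \<in> supp {k. Suc q \<le> deg0 k}" if g: "g \<in> supp {k. q \<le> deg0 k}" for g
  proof -
    have "app (odd_op 0 i) g (a, A) = 0" if nle: "\<not> Suc q \<le> deg0 (a, A)" for a A
    proof -
      have "0 \<in># a \<Longrightarrow> \<not> q \<le> deg0 (a - {#0#}, insert i A)"
        using nle i by (auto simp: deg0_def dest!: multi_member_split)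
      moreover have "0 \<in> A \<Longrightarrow> \<not> q \<le> deg0 (add_mset i a, A - {0})"
        using nle i by (auto simp: deg0_def)
      ultimately show ?thesis
        using g by (cases "0 \<in># a") (auto simp: odd_op_0i[OF i] supp_def not_in_iff)
    qed
    then show ?thesis by (auto simp: supp_def)
  qed
  show ?thesis using even_op odd_op[OF deg0_J[OF f]] by (simp add: q_op_def supp_fscale)
qed

lemma deg0_le: "k \<in> fkeys n p e \<Longrightarrow> deg0 k \<le> p"
proof -
  assume "k \<in> fkeys n p e"
  then obtain a A where k: "k = (a, A)" "A \<subseteq> {..n}" "size a + card A = p"
    by (auto simp: fkeys_def)
  have "count a 0 \<le> size a" by (rule count_le_size)
  moreover have "of_bool (0 \<in> A) \<le> card A"
    using finite_subset[OF k(2)] by (auto simp: Suc_le_eq card_gt_0_iff)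
  ultimately show ?thesis using k by (simp add: deg0_def)
qed

text \<open>As long as some e_0i does not kill the vector, it yields a nonzero vector of the same
  subspace with higher \<open>deg0\<close>; since \<open>deg0\<close> is at most \<open>p\<close>,
  the climb ends at a singular vector. The number \<open>m\<close> is the room left: at
  \<open>m = 0\<close> the support would need \<open>deg0\<close> above \<open>p\<close>,
  contradicting \<open>v \<noteq> 0\<close>.\<close>

lemma stable_top_state:
  assumes M: "stable n p M" and p: "1 \<le> p" and w: "w \<in> M" "w \<noteq> 0"
  shows "top_state n p \<in> M"
proof -
  have "top_state n p \<in> M" if "v \<in> M" "v \<noteq> 0" "v \<in> supp {k. Suc p - m \<le> deg0 k}" "m \<le> Suc p" for v m
    using that
  proof (induction m arbitrary: v)
    case 0
    have "v \<in> supp (fkeys n p (even n))" using M 0 by (auto simp: stable_def states_def)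
    moreover have "{k. Suc p - 0 \<le> deg0 k} \<inter> fkeys n p (even n) = {}"
      using deg0_le[of _ n p "even n"] by fastforce
    ultimately show ?case using 0 supp_disjoint by metis
  next
    case (Suc m)
    show ?case
    proof (cases "\<exists>i \<sigma>. i \<in> {1..n} \<and> app (q_op n p (0, i, \<sigma>)) v \<noteq> 0")
      case True
      then obtain i \<sigma> where i: "i \<in> {1..n}" and nz: "app (q_op n p (0, i, \<sigma>)) v \<noteq> 0" by blast
      have "app (q_op n p (0, i, \<sigma>)) v \<in> M"
        using M Suc.prems i by (auto simp: stable_def G_idx_def)
      moreover have "app (q_op n p (0, i, \<sigma>)) v \<in> supp {k. Suc (Suc p - Suc m) \<le> deg0 k}"
        using Suc.prems i by (intro deg0_q_op_0i) auto
      ultimately show ?thesis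
        using Suc.prems nz by (intro Suc.IH) (auto simp: Suc_diff_le)
    next
      case False
      have v: "v = fscale (v (top_key n p)) (top_state n p)"
        using M Suc.prems p False by (intro singular_vector) (auto simp: stable_def)
      then have "v (top_key n p) \<noteq> 0" using Suc.prems(2) by (metis fscale_zero_left)
      then show ?thesis using v Suc.prems(1) M fun_subspace_fscale_iff unfolding stable_def by metis
    qed
  qed
  \<comment> \<open>With this \<open>m\<close> the support condition reads
    \<open>0 \<le> deg0 k\<close> and is void.\<close>
  from this[OF w, of "Suc p"] show ?thesis by (simp add: supp_def)
qed

lemma q_op_of_e1J:
  assumes "1 \<le> p"
  obtains c where "app (odd_op i j) (app (J n) w) = fscale c (app (q_op n p (i, j, 1)) w)"
proof
  show "app (odd_op i j) (app (J n) w) =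
      fscale (of_real (sqrt (real p)) / (- 1) ^ n) (app (q_op n p (i, j, 1)) w)"
    using assms by (simp add: q_op_def)
qed

text \<open>Here \<open>M\<close> is stable under the derivations themselves, so monomials of both
  parities are reached. A derivation e_i0 applied to a smaller monomial gives the wanted one, up to
  a nonzero factor, plus at most one further monomial, which is again smaller.\<close>

lemma bfun_generation:
  assumes M: "fun_subspace M" and p: "1 \<le> p" and start: "top_state n p \<in> M"
    and even_op: "\<And>i j f. i \<le> n \<Longrightarrow> j \<le> n \<Longrightarrow> f \<in> M \<Longrightarrow> app (even_op i j) f \<in> M"
    and odd_op: "\<And>i j f. i \<le> n \<Longrightarrow> j \<le> n \<Longrightarrow> f \<in> M \<Longrightarrow> app (odd_op i j) f \<in> M"
    and k: "(a, A) \<in> fkeys n p e"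
  shows "bfun (a, A) \<in> M"
proof -
  obtain q where q: "p = Suc q" using p by (cases p) auto
  \<comment> \<open>The odd e_00 exchanges the two highest monomials up to a nonzero factor, so
    either parity of n provides both.\<close>
  have tops: "bfun (replicate_mset (Suc q) 0, {}) \<in> M" "bfun (replicate_mset q 0, {0}) \<in> M"
  proof -
    have A: "app (odd_op 0 0) (bfun (replicate_mset q 0, {0})) = fscale (of_nat (Suc q)) (bfun (replicate_mset (Suc q) 0, {}))"
    proof -
      have "app (Th 0) (app (D 0) (bfun (replicate_mset q 0, {0}))) = 0"
        by (cases q) (simp_all add: app_D_bfun_0 app_D_bfun_add app_Th_bfun_0)
      moreover have "app (X 0) (app (Dt 0) (bfun (replicate_mset q 0, {0}))) = fscale (of_nat (Suc q)) (bfun (replicate_mset (Suc q) 0, {}))"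
        using app_Dt_bfun[of 0 "{}" "replicate_mset q 0"] by (simp add: fermi_sign_def app_X_bfun)
      ultimately show ?thesis by (simp only: odd_op_def app_simps add_0_right)
    qed
    have B: "app (odd_op 0 0) (bfun (replicate_mset (Suc q) 0, {})) = bfun (replicate_mset q 0, {0})"
    proof -
      have "app (Th 0) (app (D 0) (bfun (replicate_mset (Suc q) 0, {}))) = bfun (replicate_mset q 0, {0})"
        by (simp add: app_D_bfun_add app_Th_bfun fermi_sign_def)
      moreover have "app (X 0) (app (Dt 0) (bfun (replicate_mset (Suc q) 0, {}))) = 0"
        by (simp add: app_Dt_bfun_0)
      ultimately show ?thesis by (simp only: odd_op_def app_simps add_0)
    qed
    have "bfun (replicate_mset (Suc q) 0, {}) \<in> M \<or> bfun (replicate_mset q 0, {0}) \<in> M"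
      using start by (simp add: top_state_def top_key_def q split: if_splits)
    moreover have "bfun (replicate_mset (Suc q) 0, {}) \<in> M \<Longrightarrow> bfun (replicate_mset q 0, {0}) \<in> M"
      using odd_op[of 0 0 "bfun (replicate_mset (Suc q) 0, {})"] unfolding B by simp
    moreover have "bfun (replicate_mset q 0, {0}) \<in> M \<Longrightarrow> bfun (replicate_mset (Suc q) 0, {}) \<in> M"
      using odd_op[of 0 0 "bfun (replicate_mset q 0, {0})"] fun_subspace_fscale_iff[OF M]
      unfolding A by (metis le0 of_nat_eq_0_iff nat.distinct(1))
    ultimately show "bfun (replicate_mset (Suc q) 0, {}) \<in> M" "bfun (replicate_mset q 0, {0}) \<in> M"
      by blast+
  qed
  \<comment> \<open>Variables of nonzero index weigh 2. The extra 1 for \<theta>_0 handles the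
    correction terms: they trade an x_i and a \<theta>_0 for a \<theta>_i and an x_0, or conversely
    a \<theta>_i and a \<theta>_0 for an x_i and an x_0, and so drop by exactly 1.\<close>
  define ms :: "fkey \<Rightarrow> nat" where
    "ms = (\<lambda>(a, A). 2 * (size (filter_mset (\<lambda>i. i \<noteq> 0) a) + card (A - {0})) + of_bool (0 \<in> A))"
  have "\<forall>e. (a, A) \<in> fkeys n p e \<longrightarrow> bfun (a, A) \<in> M" for a A
  proof (induction "ms (a, A)" arbitrary: a A rule: less_induct)
    case less
    show ?case
    proof (intro allI impI)
      fix e assume k: "(a, A) \<in> fkeys n p e"
      then have finA: "finite A" using finite_subset by (auto simp: fkeys_def)
      have IH: "bfun (b, B) \<in> M" if "ms (b, B) < ms (a, A)" "(b, B) \<in> fkeys n p e'" for b B e'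
        using less that by blast
      consider (x) i b where "i \<noteq> 0" "a = add_mset i b"
        | (t) i B where "i \<noteq> 0" "i \<notin> B" "A = insert i B" "set_mset a \<subseteq> {0}"
        | (top) "set_mset a \<subseteq> {0}" "A \<subseteq> {0}"
      proof (cases "set_mset a \<subseteq> {0}")
        case False
        then show thesis using x by (metis insert_DiffM singleton_iff subsetI)
      next
        case True
        show thesis
        proof (cases "A \<subseteq> {0}")
          case False
          then show thesis using t True by (metis mk_disjoint_insert singleton_iff subsetI)
        qed (use top True in blast)
      qed
      then show "bfun (a, A) \<in> M"
      proof cases
        case x
        have i: "i \<le> n" using k x by (auto simp: fkeys_def)
        have "bfun (add_mset 0 b, A) \<in> M"
          using k x by (intro IH[of _ _ e]) (auto simp: fkeys_def ms_def)
        then have "app (even_op i 0) (bfun (add_mset 0 b, A)) \<in> M" using i by (intro even_op) auto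
        moreover have "app (Th i) (app (Dt 0) (bfun (add_mset 0 b, A))) \<in> M"
        proof (cases "0 \<in> A")
          case False
          then show ?thesis by (simp add: app_Dt_bfun_0 fsubD[OF M])
        next
          case True
          then obtain B where B: "A = insert 0 B" "0 \<notin> B" by (blast dest: mk_disjoint_insert)
          show ?thesis
          proof (cases "i \<in> B")
            case True
            then show ?thesis using B by (simp add: app_Dt_bfun app_Th_bfun_0 fsubD[OF M])
          next
            case False
            have "bfun (add_mset 0 b, insert i B) \<in> M"
              using k x B False finA by (intro IH[of _ _ e]) (auto simp: fkeys_def ms_def)
            then show ?thesis using B False by (simp add: app_Dt_bfun app_Th_bfun fsubD[OF M])
          qed
        qed
        ultimately have "app (X i) (app (D 0) (bfun (add_mset 0 b, A))) \<in> M"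
          using fun_subspace_diff[OF M] by (fastforce simp: even_op_def)
        then have "fscale (of_nat (count b i + 1)) (bfun (a, A)) \<in> M"
          using x by (simp add: app_D_bfun_add app_X_bfun)
        then show ?thesis using fun_subspace_fscale_iff[OF M] by (metis Suc_eq_plus1 of_nat_eq_0_iff nat.distinct(1))
      next
        case t
        have i: "i \<le> n" using k t by (auto simp: fkeys_def)
        have finB: "finite B" using finA t by simp
        have "insert i B - {0} = insert i (B - {0})" using t by auto
        then have card: "card (insert i B - {0}) = Suc (card (B - {0}))"
          using t finB by simp
        have "bfun (add_mset 0 a, B) \<in> M"
          using k t finB by (intro IH[of _ _ "\<not> e"]) (auto simp: fkeys_def ms_def card)
        then have "app (odd_op i 0) (bfun (add_mset 0 a, B)) \<in> M" using i by (intro odd_op) auto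
        moreover have "app (X i) (app (Dt 0) (bfun (add_mset 0 a, B))) \<in> M"
        proof (cases "0 \<in> B")
          case False
          then show ?thesis by (simp add: app_Dt_bfun_0 fsubD[OF M])
        next
          case True
          then obtain C where C: "B = insert 0 C" "0 \<notin> C" by (blast dest: mk_disjoint_insert)
          have "bfun (add_mset i (add_mset 0 a), C) \<in> M"
            using k t C finB i by (intro IH[of _ _ e]) (auto simp: fkeys_def ms_def)
          then show ?thesis using C by (simp add: app_Dt_bfun app_X_bfun fsubD[OF M])
        qed
        ultimately have "app (Th i) (app (D 0) (bfun (add_mset 0 a, B))) \<in> M"
          using fun_subspace_diff[OF M] by (fastforce simp: odd_op_def)
        then have "fscale (fermi_sign i B) (bfun (a, A)) \<in> M"
          using t by (simp add: app_D_bfun_add app_Th_bfun)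
        then show ?thesis using fun_subspace_fscale_iff[OF M] by simp
      next
        case top
        then have a: "a = replicate_mset (size a) 0" by (intro set_mset_subset_singletonD)
        from top have "A = {} \<or> A = {0}" by auto
        then show ?thesis using a tops k by (auto simp: fkeys_def q)
      qed
    qed
  qed
  then show ?thesis using k by blast
qed

lemma supp_bfun_sum:
  assumes "finite S" "f \<in> supp S"
  shows "f = (\<Sum>k\<in>S. fscale (f k) (bfun k))"
proof
  fix x
  have "(\<Sum>k\<in>S. fscale (f k) (bfun k)) x = (\<Sum>k\<in>S. fscale (f k) (bfun k) x)"
    using assms(1) by (induction S) auto
  also have "\<dots> = (\<Sum>k\<in>S. if k = x then f k else 0)"
    by (rule sum.cong) (auto simp: bfun_def)
  also have "\<dots> = f x" using assms by (auto simp: supp_def)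
  finally show "f x = (\<Sum>k\<in>S. fscale (f k) (bfun k)) x" by simp
qed

text \<open>\<open>M\<close> is not stable under the odd derivations, which change the parity, but M
  + J M is: an odd derivation maps M into J M and J M into M. Hence M + J M contains every monomial,
  and comparing parities brings those of the right parity back into M.\<close>

lemma stable_full:
  assumes M: "stable n p M" and p: "1 \<le> p" and top_state: "top_state n p \<in> M"
  shows "M = states n p"
proof
  show "M \<subseteq> states n p" using M by (simp add: stable_def)
  have MW: "f \<in> M \<Longrightarrow> f \<in> supp (fkeys n p (even n))" for f using M by (auto simp: stable_def states_def)
  have sub: "fun_subspace M" and op: "\<And>i j \<sigma> f. i \<le> n \<Longrightarrow> j \<le> n \<Longrightarrow> f \<in> M \<Longrightarrow> app (q_op n p (i, j, \<sigma>)) f \<in> M"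
    using M by (auto simp: stable_def G_idx_def)
  define M' where "M' = {m + app (J n) m' |m m'. m \<in> M \<and> m' \<in> M}"
  have M'I: "m \<in> M \<Longrightarrow> m' \<in> M \<Longrightarrow> m + app (J n) m' \<in> M'" for m m' by (auto simp: M'_def)
  have M'1: "m \<in> M \<Longrightarrow> m \<in> M'" and M'2: "m \<in> M \<Longrightarrow> app (J n) m \<in> M'" for m
    using M'I[of m 0] M'I[of 0 m] fsubD(1)[OF sub] by simp_all
  have subM': "fun_subspace M'"
    unfolding fun_subspace_def
  proof (intro conjI ballI allI)
    show "0 \<in> M'" using M'1 fsubD(1)[OF sub] by blast
    fix f assume "f \<in> M'"
    then obtain m m' where f: "f = m + app (J n) m'" "m \<in> M" "m' \<in> M" by (auto simp: M'_def)
    show "fscale c f \<in> M'" for c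
      using M'I[of "fscale c m" "fscale c m'"] f fsubD(3)[OF sub] by (simp add: fscale_add)
    fix g assume "g \<in> M'"
    then obtain l l' where g: "g = l + app (J n) l'" "l \<in> M" "l' \<in> M" by (auto simp: M'_def)
    have "f + g = (m + l) + app (J n) (m' + l')" by (simp add: f g add_ac)
    moreover have "(m + l) + app (J n) (m' + l') \<in> M'"
      using f g by (intro M'I fsubD(2)[OF sub])
    ultimately show "f + g \<in> M'" by (simp only:)
  qed
  have even_op: "app (even_op i j) f \<in> M'" if ij: "i \<le> n" "j \<le> n" and f: "f \<in> M'" for i j f
  proof -
    obtain m m' where f: "f = m + app (J n) m'" "m \<in> M" "m' \<in> M" using f by (auto simp: M'_def)
    have "app (even_op i j * J n) m' = app (J n * even_op i j) m'" using ij by (simp only: J_even_op)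
    then have "app (even_op i j) f = app (even_op i j) m + app (J n) (app (even_op i j) m')" by (simp add: f)
    then show ?thesis
      using M'I op[OF ij f(2), of 0] op[OF ij f(3), of 0] by (simp add: q_op_def)
  qed
  have odd_op: "app (odd_op i j) f \<in> M'" if ij: "i \<le> n" "j \<le> n" and f: "f \<in> M'" for i j f
  proof -
    obtain m m' where f: "f = m + app (J n) m'" "m \<in> M" "m' \<in> M" using f by (auto simp: M'_def)
    have "m \<in> states n p" using f(2) MW by (simp add: states_def)
    then obtain c where c: "app (odd_op i j) m = fscale c (app (J n) (app (q_op n p (i, j, 1)) m))"
      using odd_op_of_q_op[OF _ ij p] by blast
    obtain d where d: "app (odd_op i j) (app (J n) m') = fscale d (app (q_op n p (i, j, 1)) m')"
      using q_op_of_e1J[OF p] by blast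
    have "app (odd_op i j) f = fscale d (app (q_op n p (i, j, 1)) m') + app (J n) (fscale c (app (q_op n p (i, j, 1)) m))"
      by (simp add: f c d add.commute)
    also have "\<dots> \<in> M'"
      using f by (intro M'I fsubD(3)[OF sub] op ij)
    finally show ?thesis .
  qed
  have bfun: "bfun k \<in> M" if k: "k \<in> fkeys n p (even n)" for k
  proof -
    obtain a A where kA: "k = (a, A)" by (cases k)
    have "bfun k \<in> M'"
      unfolding kA by (rule bfun_generation[OF subM' p M'1[OF top_state] even_op odd_op k[unfolded kA]])
    then obtain m m' where u: "bfun k = m + app (J n) m'" "m \<in> M" "m' \<in> M" by (auto simp: M'_def)
    have "app (J n) m' \<in> supp (fkeys n p (\<not> even n))"
      using u p MW by (intro J_supp)
    \<comment> \<open>So \<open>app (J n) m'\<close> has both parities and must vanish.\<close>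
    moreover have "app (J n) m' = bfun k - m" using u(1) by simp
    then have "app (J n) m' \<in> supp (fkeys n p (even n))"
      using supp_diff[OF bfun_supp[OF k] MW[OF u(2)]] by simp
    moreover have "fkeys n p (\<not> even n) \<inter> fkeys n p (even n) = {}" by (auto simp: fkeys_def)
    ultimately have "app (J n) m' = 0" by (rule supp_disjoint)
    then show ?thesis using u by simp
  qed
  show "states n p \<subseteq> M"
  proof
    fix w assume "w \<in> states n p"
    then have "w = (\<Sum>k\<in>fkeys n p (even n). fscale (w k) (bfun k))"
      unfolding states_def by (rule supp_bfun_sum[OF finite_fkeys])
    also have "\<dots> \<in> M" using sub bfun by (intro fun_subspace_sum fsubD(3))
    finally show "w \<in> M" .
  qed
qed

section \<open>Tensor and enveloping algebras\<close>

lemma lookup_pscale [simp]: "Poly_Mapping.lookup (pscale c f) k = c * Poly_Mapping.lookup f k"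
  by (cases "Poly_Mapping.lookup f k = 0") (simp_all add: pscale_def Poly_Mapping.map.rep_eq when_def)

lemma keys_pscale: "Poly_Mapping.keys (pscale c f) \<subseteq> Poly_Mapping.keys f"
  by (auto simp: in_keys_iff)

lemma pscale_add: "pscale c (f + g) = pscale c f + pscale c g"
  and pscale_diff: "pscale c (f - g) = pscale c f - pscale c g"
  and pscale_add_left: "pscale (c + d) f = pscale c f + pscale d f"
  and pscale_pscale [simp]: "pscale c (pscale d f) = pscale (c * d) f"
  and pscale_one [simp]: "pscale 1 f = f"
  and pscale_zero [simp]: "pscale c 0 = 0"
  and pscale_zero_left [simp]: "pscale 0 f = 0"
  and pscale_minus_one: "pscale (- 1) f = - f"
  and pscale_single [simp]: "pscale c (Poly_Mapping.single k x) = Poly_Mapping.single k (c * x)"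
  by (rule poly_mapping_eqI; simp add: lookup_add lookup_minus lookup_single when_def algebra_simps)+

lemma pscale_sum: "pscale c (sum f I) = (\<Sum>i\<in>I. pscale c (f i))"
  by (induction I rule: infinite_finite_induct) (simp_all add: pscale_add)

lemma pscale_conv_mult: "pscale c t = Poly_Mapping.single 0 c * t" for t :: "'a :: monoid_add \<Rightarrow>\<^sub>0 complex"
  unfolding pscale_def by (rule mult_map_scale_conv_mult)

lemma pscale_mult_left: "pscale c s * t = pscale c (s * t)" for t :: "'a :: monoid_add \<Rightarrow>\<^sub>0 complex"
  by (simp add: pscale_conv_mult mult.assoc)

lemma poly_mapping_expand: "t = (\<Sum>m\<in>Poly_Mapping.keys t. Poly_Mapping.single m (Poly_Mapping.lookup t m))"
  by (rule poly_mapping_eqI) (simp add: lookup_sum lookup_single when_def in_keys_iff)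

lemma pscale_mult_right: "s * pscale c t = pscale c (s * t)" for t :: tens
proof -
  have "s * Poly_Mapping.single 0 c = Poly_Mapping.single 0 c * s"
  proof -
    have "Poly_Mapping.single m x * Poly_Mapping.single 0 c = Poly_Mapping.single 0 c * Poly_Mapping.single m x"
      for m :: "qidx fmon" and x
      by (simp add: mult_single mult.commute)
    then have "(\<Sum>m\<in>Poly_Mapping.keys s. Poly_Mapping.single m (Poly_Mapping.lookup s m)) * Poly_Mapping.single 0 c
        = Poly_Mapping.single 0 c * (\<Sum>m\<in>Poly_Mapping.keys s. Poly_Mapping.single m (Poly_Mapping.lookup s m))"
      unfolding sum_distrib_left sum_distrib_right by simp
    then show ?thesis by (simp only: poly_mapping_expand[symmetric])
  qed
  then show ?thesis by (simp add: pscale_conv_mult mult.assoc[symmetric])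
qed

text \<open>The singles range over the keys of \<open>t\<close> only, so that a condition on the
  support of \<open>t\<close> is available in the last case.\<close>

lemma poly_mapping_span_induct [case_names zero add single]:
  fixes t :: "'a \<Rightarrow>\<^sub>0 complex"
  assumes "P 0" "\<And>f g. P f \<Longrightarrow> P g \<Longrightarrow> P (f + g)"
    and "\<And>m c. m \<in> Poly_Mapping.keys t \<Longrightarrow> P (Poly_Mapping.single m c)"
  shows "P t"
proof -
  have "P (\<Sum>m\<in>M. Poly_Mapping.single m (Poly_Mapping.lookup t m))" if "M \<subseteq> Poly_Mapping.keys t" for M
    using finite_subset[OF that finite_keys] that
    by (induction M rule: finite_induct) (simp_all add: assms)
  from this[of "Poly_Mapping.keys t"] show ?thesis by (simp flip: poly_mapping_expand)
qed

section \<open>Generators and relations of the enveloping algebras\<close>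

definition letter :: "qidx \<Rightarrow> tens" where
  "letter a = Poly_Mapping.single (Word [a]) 1"

lemma tens_of_superset:
  assumes "finite A" "Poly_Mapping.keys x \<subseteq> A"
  shows "tens_of x = (\<Sum>a\<in>A. pscale (Poly_Mapping.lookup x a) (letter a))"
  unfolding tens_of_def letter_def using assms
  by (intro sum.mono_neutral_cong_left) (auto simp: in_keys_iff)

lemma tens_of_conv: "tens_of x = (\<Sum>a\<in>Poly_Mapping.keys x. pscale (Poly_Mapping.lookup x a) (letter a))"
  by (rule tens_of_superset) auto

lemma tens_of_add: "tens_of (x + y) = tens_of x + tens_of y"
proof -
  have "Poly_Mapping.keys (x + y) \<subseteq> Poly_Mapping.keys x \<union> Poly_Mapping.keys y" by (rule Poly_Mapping.keys_add)
  then show ?thesis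
    by (simp add: tens_of_superset[of "Poly_Mapping.keys x \<union> Poly_Mapping.keys y"]
        lookup_add pscale_add_left sum.distrib)
qed

lemma tens_of_pscale: "tens_of (pscale c x) = pscale c (tens_of x)"
  using tens_of_superset[OF finite_keys keys_pscale, of c x]
  by (simp add: tens_of_conv[of x] pscale_sum)

lemma tens_of_diff: "tens_of (x - y) = tens_of x - tens_of y"
  using tens_of_add[of x "pscale (- 1) y"] tens_of_pscale[of "- 1" y] by (simp add: pscale_minus_one)

lemma tens_of_0 [simp]: "tens_of 0 = 0"
  by (simp add: tens_of_def)

lemma tens_of_sum: "tens_of (sum f I) = (\<Sum>i\<in>I. tens_of (f i))"
  by (induction I rule: infinite_finite_induct) (simp_all add: tens_of_add)

lemma tens_of_single: "tens_of (Poly_Mapping.single a 1) = letter a"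
  by (simp add: tens_of_conv)

lemma tens_of_q_e: "tens_of (q_e i j \<sigma>) = letter (i, j, \<sigma>)"
  by (simp add: q_e_def tens_of_single)

fun bsign :: "qidx \<Rightarrow> qidx \<Rightarrow> complex" where
  "bsign (i, j, \<sigma>) (k, l, \<theta>) = super_sign \<sigma> \<theta>"

definition basis_rel :: "qidx \<Rightarrow> qidx \<Rightarrow> tens" where
  "basis_rel a b = letter a * letter b - pscale (bsign a b) (letter b * letter a) - tens_of (basis_bracket a b)"

lemma tens_of_basis_bracket:
  "tens_of (basis_bracket (i, j, \<sigma>) (k, l, \<theta>)) = (if j = k then letter (i, l, \<sigma> + \<theta>) else 0)
    - pscale (super_sign \<sigma> \<theta>) (if i = l then letter (k, j, \<sigma> + \<theta>) else 0)"
  by (simp add: tens_of_diff tens_of_pscale tens_of_q_e)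

definition tensors :: "qidx set \<Rightarrow> tens set" where
  "tensors S = {t. \<forall>w\<in>Poly_Mapping.keys t. set (letters w) \<subseteq> S}"

lemma tensor_alg_simps [simp]:
  "carrier (tensor_alg S) = tensors S" "mult (tensor_alg S) = (*)" "one (tensor_alg S) = 1"
  "zero (tensor_alg S) = 0" "add (tensor_alg S) = (+)"
  by (simp_all add: tensor_alg_def tensors_def)

lemma tensors_zero [simp]: "0 \<in> tensors S" by (simp add: tensors_def)

lemma letters_zero [simp]: "letters 0 = []"
  by (simp add: zero_fmon_def)

lemma tensors_single: "set (letters m) \<subseteq> S \<Longrightarrow> Poly_Mapping.single m c \<in> tensors S"
  by (simp add: tensors_def)

lemma tensors_scalar [simp]: "Poly_Mapping.single 0 c \<in> tensors S"
  by (rule tensors_single) simp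

lemma tensors_one [simp]: "1 \<in> tensors S"
  using tensors_scalar[of 1 S] by simp

lemma tensors_add: "s \<in> tensors S \<Longrightarrow> t \<in> tensors S \<Longrightarrow> s + t \<in> tensors S"
  using Poly_Mapping.keys_add[of s t] by (auto simp: tensors_def)

lemma tensors_mult: "s \<in> tensors S \<Longrightarrow> t \<in> tensors S \<Longrightarrow> s * t \<in> tensors S"
  using keys_mult[of s t] by (fastforce simp: tensors_def plus_fmon_def)

lemma tensors_pscale: "t \<in> tensors S \<Longrightarrow> pscale c t \<in> tensors S"
  by (simp add: pscale_conv_mult tensors_mult)

lemma tensors_uminus: "t \<in> tensors S \<Longrightarrow> - t \<in> tensors S"
  using tensors_pscale[of t S "- 1"] by (simp add: pscale_minus_one)

lemma tensors_diff: "s \<in> tensors S \<Longrightarrow> t \<in> tensors S \<Longrightarrow> s - t \<in> tensors S"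
  using tensors_add[of s S "- t"] tensors_uminus[of t S] by simp

lemma tensors_sum: "(\<And>i. i \<in> I \<Longrightarrow> f i \<in> tensors S) \<Longrightarrow> sum f I \<in> tensors S"
  by (induction I rule: infinite_finite_induct) (simp_all add: tensors_add)

lemma tensors_letter: "a \<in> S \<Longrightarrow> letter a \<in> tensors S"
  by (simp add: letter_def tensors_single)

lemma tensors_tens_of: "x \<in> lie_span S \<Longrightarrow> tens_of x \<in> tensors S"
  by (auto simp: tens_of_conv lie_span_def intro!: tensors_sum tensors_pscale tensors_letter)

lemma tensors_mono: "S' \<subseteq> S \<Longrightarrow> tensors S' \<subseteq> tensors S"
  by (auto simp: tensors_def)

lemma ring_tensor_alg: "ring (tensor_alg S)"
proof (rule ringI)
  show "abelian_group (tensor_alg S)"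
  proof (rule abelian_groupI)
    fix x assume "x \<in> carrier (tensor_alg S)"
    then show "\<exists>y\<in>carrier (tensor_alg S). y \<oplus>\<^bsub>tensor_alg S\<^esub> x = \<zero>\<^bsub>tensor_alg S\<^esub>"
      by (intro bexI[of _ "- x"]) (simp_all add: tensors_uminus)
  qed (simp_all add: tensors_add add_ac)
  show "monoid (tensor_alg S)"
    by (rule monoidI) (simp_all add: tensors_mult mult.assoc)
qed (simp_all add: algebra_simps)

text \<open>Closure under products of matrix units, in every parity. Both terms of a bracket are
  such products, so \<open>basis_rel\<close> stays inside \<open>tensors S\<close>.\<close>

definition bracket_closed :: "qidx set \<Rightarrow> bool" where
  "bracket_closed S \<longleftrightarrow> (\<forall>i j \<sigma> k l \<theta> \<tau>. (i, j, \<sigma>) \<in> S \<and> (k, l, \<theta>) \<in> S \<and> j = k \<longrightarrow> (i, l, \<tau>) \<in> S)"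

lemma bracket_closedD: "bracket_closed S \<Longrightarrow> (i, j, \<sigma>) \<in> S \<Longrightarrow> (j, l, \<theta>) \<in> S \<Longrightarrow> (i, l, \<tau>) \<in> S"
  unfolding bracket_closed_def by blast

lemma basis_rel_tensors:
  assumes "bracket_closed S" "a \<in> S" "b \<in> S"
  shows "basis_rel a b \<in> tensors S"
proof -
  obtain i j \<sigma> k l \<theta> where ab: "a = (i, j, \<sigma>)" "b = (k, l, \<theta>)" by (cases a; cases b)
  have "j = k \<Longrightarrow> (i, l, \<sigma> + \<theta>) \<in> S" "i = l \<Longrightarrow> (k, j, \<sigma> + \<theta>) \<in> S"
    using bracket_closedD[OF assms(1)] assms(2,3) ab by blast+
  then have "tens_of (basis_bracket a b) \<in> tensors S"
    unfolding ab tens_of_basis_bracket by (intro tensors_diff tensors_pscale) (simp_all add: tensors_letter)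
  then show ?thesis
    using assms unfolding basis_rel_def by (intro tensors_diff tensors_mult tensors_pscale tensors_letter)
qed

text \<open>Both sides are bilinear; homogeneity makes the sign constant on the two supports, where
  it agrees with \<open>bsign\<close>. This reduces the defining relations to those of basis
  vectors.\<close>

lemma gen_expand:
  assumes x: "x \<in> lie_homog S \<sigma>" and y: "y \<in> lie_homog S \<theta>"
  shows "tens_of x * tens_of y - pscale (super_sign \<sigma> \<theta>) (tens_of y * tens_of x) - tens_of (q_bracket x y)
    = (\<Sum>a\<in>Poly_Mapping.keys x. \<Sum>b\<in>Poly_Mapping.keys y.
        pscale (Poly_Mapping.lookup x a * Poly_Mapping.lookup y b) (basis_rel a b))"
proof -
  have sgn: "bsign a b = super_sign \<sigma> \<theta>" if "a \<in> Poly_Mapping.keys x" "b \<in> Poly_Mapping.keys y" for a b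
    using that x y by (cases a; cases b) (auto simp: lie_homog_def)
  let ?c = "\<lambda>a b. Poly_Mapping.lookup x a * Poly_Mapping.lookup y b"
  have 1: "tens_of x * tens_of y = (\<Sum>a\<in>Poly_Mapping.keys x. \<Sum>b\<in>Poly_Mapping.keys y. pscale (?c a b) (letter a * letter b))"
    by (simp add: tens_of_conv sum_product pscale_mult_left pscale_mult_right mult.commute)
  have "tens_of y * tens_of x = (\<Sum>b\<in>Poly_Mapping.keys y. \<Sum>a\<in>Poly_Mapping.keys x. pscale (?c a b) (letter b * letter a))"
    by (simp add: tens_of_conv sum_product pscale_mult_left pscale_mult_right mult.commute)
  then have 2: "pscale (super_sign \<sigma> \<theta>) (tens_of y * tens_of x) =
      (\<Sum>a\<in>Poly_Mapping.keys x. \<Sum>b\<in>Poly_Mapping.keys y. pscale (?c a b) (pscale (bsign a b) (letter b * letter a)))"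
    by (subst (asm) sum.swap) (simp add: pscale_sum sgn mult.commute cong: sum.cong)
  have 3: "tens_of (q_bracket x y) =
      (\<Sum>a\<in>Poly_Mapping.keys x. \<Sum>b\<in>Poly_Mapping.keys y. pscale (?c a b) (tens_of (basis_bracket a b)))"
    by (simp add: q_bracket_def tens_of_sum tens_of_pscale)
  show ?thesis
    unfolding 1 2 3 by (simp add: basis_rel_def pscale_diff sum_subtractf)
qed

definition env_gens :: "qidx set \<Rightarrow> tens set" where
  "env_gens S = {tens_of x * tens_of y - pscale (super_sign \<sigma> \<theta>) (tens_of y * tens_of x)
        - tens_of (q_bracket x y) | x y \<sigma> \<theta>. x \<in> lie_homog S \<sigma> \<and> y \<in> lie_homog S \<theta>}"

lemma env_gens_subset:
  assumes "0 \<in> I" "\<And>s t. s \<in> I \<Longrightarrow> t \<in> I \<Longrightarrow> s + t \<in> I" "\<And>c t. t \<in> I \<Longrightarrow> pscale c t \<in> I"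
    and "\<And>a b. a \<in> S \<Longrightarrow> b \<in> S \<Longrightarrow> basis_rel a b \<in> I"
  shows "env_gens S \<subseteq> I"
proof -
  have sum: "(\<And>i. i \<in> A \<Longrightarrow> f i \<in> I) \<Longrightarrow> sum f A \<in> I" for f :: "qidx \<Rightarrow> tens" and A
    by (induction A rule: infinite_finite_induct) (simp_all add: assms)
  show ?thesis
    unfolding env_gens_def
  proof (clarify, subst gen_expand, assumption, assumption)
    fix x y \<sigma> \<theta> assume "x \<in> lie_homog S \<sigma>" "y \<in> lie_homog S \<theta>"
    then have "Poly_Mapping.keys x \<subseteq> S" "Poly_Mapping.keys y \<subseteq> S" by (auto simp: lie_homog_def)
    then show "(\<Sum>a\<in>Poly_Mapping.keys x. \<Sum>b\<in>Poly_Mapping.keys y.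
        pscale (Poly_Mapping.lookup x a * Poly_Mapping.lookup y b) (basis_rel a b)) \<in> I"
      by (intro sum assms(3,4)) auto
  qed
qed

lemma env_gens_tensors: "bracket_closed S \<Longrightarrow> env_gens S \<subseteq> tensors S"
  by (rule env_gens_subset) (simp_all add: tensors_add tensors_pscale basis_rel_tensors)

lemma env_ideal_alt: "env_ideal S = genideal (tensor_alg S) (env_gens S)"
  by (simp add: env_ideal_def env_gens_def)

lemma ideal_env_ideal: "bracket_closed S \<Longrightarrow> ideal (env_ideal S) (tensor_alg S)"
  unfolding env_ideal_alt by (rule ring.genideal_ideal[OF ring_tensor_alg]) (simp add: env_gens_tensors)

lemma tensor_ideal_iff:
  "ideal I (tensor_alg S) \<longleftrightarrow> I \<subseteq> tensors S \<and> 0 \<in> I \<and> (\<forall>s\<in>I. \<forall>t\<in>I. s + t \<in> I)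
     \<and> (\<forall>s\<in>I. \<forall>t\<in>tensors S. t * s \<in> I \<and> s * t \<in> I)"
proof (safe)
  assume I: "ideal I (tensor_alg S)"
  interpret ideal I "tensor_alg S" by fact
  show "\<And>x. x \<in> I \<Longrightarrow> x \<in> tensors S" using a_subset by auto
  show "0 \<in> I" using additive_subgroup.zero_closed[OF is_additive_subgroup] by simp
  show "\<And>s t. s \<in> I \<Longrightarrow> t \<in> I \<Longrightarrow> s + t \<in> I" using additive_subgroup.a_closed[OF is_additive_subgroup] by simp
  show "\<And>s t. s \<in> I \<Longrightarrow> t \<in> tensors S \<Longrightarrow> t * s \<in> I" using I_l_closed by simp
  show "\<And>s t. s \<in> I \<Longrightarrow> t \<in> tensors S \<Longrightarrow> s * t \<in> I" using I_r_closed by simp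
next
  assume sub: "I \<subseteq> tensors S" and 0: "0 \<in> I" and add: "\<forall>s\<in>I. \<forall>t\<in>I. s + t \<in> I"
    and mult: "\<forall>s\<in>I. \<forall>t\<in>tensors S. t * s \<in> I \<and> s * t \<in> I"
  interpret ring "tensor_alg S" by (rule ring_tensor_alg)
  have inv: "\<ominus>\<^bsub>tensor_alg S\<^esub> x = - x" if "x \<in> tensors S" for x
    using that by (intro minus_equality) (simp_all add: tensors_uminus)
  show "ideal I (tensor_alg S)"
  proof (rule idealI[OF ring_tensor_alg])
    show "subgroup I (add_monoid (tensor_alg S))"
    proof (rule subgroup.intro)
      fix x assume x: "x \<in> I"
      have "pscale (- 1) 1 * x \<in> I" using mult x tensors_pscale[OF tensors_one] by blast
      then have "- x \<in> I" by (simp add: pscale_mult_left pscale_minus_one)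
      then show "inv\<^bsub>add_monoid (tensor_alg S)\<^esub> x \<in> I"
        using inv[of x] sub x by (auto simp: a_inv_def)
    qed (use sub 0 add in auto)
  qed (use mult in auto)
qed

text \<open>An ideal of the tensor algebra absorbs the scalars \<open>single 0 c\<close>, hence is a
  complex subspace, and bilinearity reduces the generators to \<open>basis_rel\<close>.\<close>

lemma env_ideal_subset:
  assumes "ideal I (tensor_alg S)" "\<And>a b. a \<in> S \<Longrightarrow> b \<in> S \<Longrightarrow> basis_rel a b \<in> I"
  shows "env_ideal S \<subseteq> I"
proof -
  have "pscale c t \<in> I" if "t \<in> I" for c t
    using assms(1) that unfolding tensor_ideal_iff pscale_conv_mult by (meson tensors_scalar)
  then have "env_gens S \<subseteq> I"
    using assms by (intro env_gens_subset) (auto simp: tensor_ideal_iff)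
  then show ?thesis
    unfolding env_ideal_alt by (rule ring.genideal_minimal[OF ring_tensor_alg assms(1)])
qed

lemma basis_rel_env_ideal:
  assumes "bracket_closed S" "a \<in> S" "b \<in> S"
  shows "basis_rel a b \<in> env_ideal S"
proof -
  obtain i j \<sigma> k l \<theta> where ab: "a = (i, j, \<sigma>)" "b = (k, l, \<theta>)" by (cases a; cases b)
  let ?x = "Poly_Mapping.single a 1 :: qelt" and ?y = "Poly_Mapping.single b 1 :: qelt"
  have "?x \<in> lie_homog S \<sigma>" "?y \<in> lie_homog S \<theta>"
    using assms ab by (auto simp: lie_homog_def)
  moreover have "basis_rel a b = tens_of ?x * tens_of ?y - pscale (super_sign \<sigma> \<theta>) (tens_of ?y * tens_of ?x)
      - tens_of (q_bracket ?x ?y)"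
    by (simp add: gen_expand[OF calculation])
  ultimately have "basis_rel a b \<in> env_gens S" unfolding env_gens_def by blast
  moreover have "env_gens S \<subseteq> env_ideal S"
    unfolding env_ideal_alt using env_gens_tensors[OF assms(1)]
    by (intro ring.genideal_self[OF ring_tensor_alg]) simp
  ultimately show ?thesis by blast
qed

lemma env_ideal_mono:
  assumes "bracket_closed S" "bracket_closed S'" "S' \<subseteq> S"
  shows "env_ideal S' \<subseteq> env_ideal S"
proof -
  have "ideal (env_ideal S \<inter> tensors S') (tensor_alg S')"
    using ideal_env_ideal[OF assms(1)] tensors_mono[OF assms(3)]
    unfolding tensor_ideal_iff by (auto simp: tensors_add tensors_mult)
  then have "env_ideal S' \<subseteq> env_ideal S \<inter> tensors S'"
    using assms by (intro env_ideal_subset) (blast intro: basis_rel_env_ideal basis_rel_tensors)+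
  then show ?thesis by blast
qed

lemma G_idx_closed: "bracket_closed (G_idx n)"
  by (auto simp: bracket_closed_def G_idx_def)

lemma H_idx_iff: "(i, j, \<sigma>) \<in> H_idx n \<longleftrightarrow> i \<le> n \<and> j \<le> n \<and> (i = 0 \<or> j \<noteq> 0)"
  by (auto simp: H_idx_def q1_idx_def qn_idx_def P_idx_def)

lemma H_idx_closed: "bracket_closed (H_idx n)"
  by (auto simp: bracket_closed_def H_idx_iff)

lemma H_subset_G: "H_idx n \<subseteq> G_idx n"
  by (auto simp: H_idx_iff G_idx_def)

text \<open>The universal property of the free algebra: central scalars and arbitrary images of the
  letters extend to a homomorphism \<open>ev\<close>. It serves twice, for the action of U(H) on v_0
  by numbers and for the operators on superpolynomials.\<close>

locale word_rep =
  fixes s :: "complex \<Rightarrow> 'r :: ring_1" and r :: "qidx \<Rightarrow> 'r"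
  assumes s_add: "s (c + d) = s c + s d" and s_mult: "s (c * d) = s c * s d"
    and s_one: "s 1 = 1" and central: "s c * x = x * s c"
begin

definition ev :: "tens \<Rightarrow> 'r" where
  "ev t = (\<Sum>m\<in>Poly_Mapping.keys t. s (Poly_Mapping.lookup t m) * prod_list (map r (letters m)))"

lemma s_zero: "s 0 = 0"
  using s_add[of 0 0] by simp

lemma ev_superset:
  assumes "finite A" "Poly_Mapping.keys t \<subseteq> A"
  shows "ev t = (\<Sum>m\<in>A. s (Poly_Mapping.lookup t m) * prod_list (map r (letters m)))"
  unfolding ev_def using assms by (intro sum.mono_neutral_left) (auto simp: in_keys_iff s_zero)

lemma ev_add: "ev (x + y) = ev x + ev y"
proof -
  have "Poly_Mapping.keys (x + y) \<subseteq> Poly_Mapping.keys x \<union> Poly_Mapping.keys y" by (rule Poly_Mapping.keys_add)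
  then show ?thesis
    by (simp add: ev_superset[of "Poly_Mapping.keys x \<union> Poly_Mapping.keys y"]
        lookup_add s_add distrib_right sum.distrib s_zero)
qed

lemma ev_pscale: "ev (pscale c x) = s c * ev x"
  using ev_superset[OF finite_keys keys_pscale, of c x]
  by (simp add: ev_def[of x] sum_distrib_left s_mult mult.assoc)

lemma ev_zero [simp]: "ev 0 = 0"
  by (simp add: ev_def s_zero)

lemma ev_diff: "ev (x - y) = ev x - ev y"
  using ev_add[of "x - y" y] by simp

lemma ev_single: "ev (Poly_Mapping.single m c) = s c * prod_list (map r (letters m))"
  by (simp add: ev_def s_zero)

lemma ev_letter [simp]: "ev (letter a) = r a"
  by (simp add: letter_def ev_single s_one)

lemma ev_one [simp]: "ev 1 = 1"
  using ev_single[of 0 1] by (simp add: s_one)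

lemma ev_mult: "ev (x * y) = ev x * ev y"
proof (induction x rule: poly_mapping_span_induct)
  case (single m c)
  show ?case
  proof (induction y rule: poly_mapping_span_induct)
    case (single m' c')
    have "s c * (s c' * (u * v)) = s c * (u * (s c' * v))" for u v
      by (metis central mult.assoc)
    then show ?case by (simp add: mult_single ev_single plus_fmon_def s_mult mult.assoc)
  qed (simp_all add: ev_add distrib_left)
qed (simp_all add: ev_add distrib_right)

lemma ev_basis_rel: "ev (basis_rel (i, j, \<sigma>) (k, l, \<theta>)) =
    r (i, j, \<sigma>) * r (k, l, \<theta>) - s (super_sign \<sigma> \<theta>) * (r (k, l, \<theta>) * r (i, j, \<sigma>))
    - ((if j = k then r (i, l, \<sigma> + \<theta>) else 0) - s (super_sign \<sigma> \<theta>) * (if i = l then r (k, j, \<sigma> + \<theta>) else 0))"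
  by (simp add: basis_rel_def tens_of_basis_bracket ev_diff ev_pscale ev_mult del: basis_bracket.simps)

end

section \<open>Quotient modules\<close>

lemma subspace_classI:
  fixes V :: "(complex, 'v, 'e) module_scheme"
  assumes "vectorspace class_ring V" "N \<subseteq> carrier V" "\<zero>\<^bsub>V\<^esub> \<in> N"
    and "\<And>u v. u \<in> N \<Longrightarrow> v \<in> N \<Longrightarrow> u \<oplus>\<^bsub>V\<^esub> v \<in> N"
    and "\<And>c v. v \<in> N \<Longrightarrow> c \<odot>\<^bsub>V\<^esub> v \<in> N"
  shows "subspace class_ring N V"
proof (rule VectorSpace.subspace.intro)
  have "Module.module class_ring V" using assms(1) by (simp add: vectorspace_def)
  then show "submodule class_ring N V"
    using assms by (intro submodule.intro) auto
qed (fact assms(1))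

lemma subspace_classD:
  fixes V :: "(complex, 'v, 'e) module_scheme"
  assumes "subspace class_ring N V"
  shows "N \<subseteq> carrier V" "\<zero>\<^bsub>V\<^esub> \<in> N"
    and "u \<in> N \<Longrightarrow> v \<in> N \<Longrightarrow> u \<oplus>\<^bsub>V\<^esub> v \<in> N"
    and "v \<in> N \<Longrightarrow> c \<odot>\<^bsub>V\<^esub> v \<in> N"
proof -
  interpret submodule class_ring N V
    using assms by (simp add: VectorSpace.subspace_def)
  show "N \<subseteq> carrier V" "\<zero>\<^bsub>V\<^esub> \<in> N"
    and "u \<in> N \<Longrightarrow> v \<in> N \<Longrightarrow> u \<oplus>\<^bsub>V\<^esub> v \<in> N"
    and "v \<in> N \<Longrightarrow> c \<odot>\<^bsub>V\<^esub> v \<in> N"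
    using subset zero_closed m_closed smult_closed[of c v] by auto
qed

text \<open>Only the vector space structure is fixed; whether an operator descends is asked
  separately in \<open>q_act\<close>. The locale is used for the tensor relations in the free space
  and again for M_p in the induced module.\<close>

locale quot_space =
  fixes V :: "'v qmodule" and N
  assumes vsV: "vectorspace class_ring V" and subN: "subspace class_ring N V"
begin

sublocale vs: vectorspace class_ring V by (fact vsV)

lemma N_carrier: "u \<in> N \<Longrightarrow> u \<in> carrier V"
  and N_zero: "\<zero>\<^bsub>V\<^esub> \<in> N"
  and N_add: "u \<in> N \<Longrightarrow> v \<in> N \<Longrightarrow> u \<oplus>\<^bsub>V\<^esub> v \<in> N"
  and N_smult: "v \<in> N \<Longrightarrow> c \<odot>\<^bsub>V\<^esub> v \<in> N"
  using subspace_classD[OF subN] by auto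

lemma smult_minus_one: "v \<in> carrier V \<Longrightarrow> (- 1) \<odot>\<^bsub>V\<^esub> v = \<ominus>\<^bsub>V\<^esub> v"
  using vs.smult_l_minus[of 1 v] vs.smult_one[of v] by (simp add: class_ring_simps)

sublocale ab: abelian_subgroup N V
proof (rule abelian_subgroupI3)
  show "abelian_group V" by (rule vs.M.abelian_group_axioms)
  show "additive_subgroup N V"
  proof (rule additive_subgroup.intro, rule subgroup.intro)
    fix x assume x: "x \<in> N"
    then have "\<ominus>\<^bsub>V\<^esub> x \<in> N" using N_smult[OF x, of "- 1"] smult_minus_one[OF N_carrier[OF x]] by simp
    then show "inv\<^bsub>add_monoid V\<^esub> x \<in> N" by (simp add: a_inv_def)
  qed (auto simp: N_carrier N_zero N_add)
qed

definition q :: "'v \<Rightarrow> 'v set" where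
  "q v = N +>\<^bsub>V\<^esub> v"

abbreviation Q :: "'v set qmodule" where
  "Q \<equiv> quot_module V N"

lemma carrier_Q: "carrier Q = q ` carrier V"
  by (auto simp: quot_module_def q_def A_RCOSETS_def' a_r_coset_def')

lemma q_carrier: "v \<in> carrier V \<Longrightarrow> q v \<in> carrier Q"
  by (simp add: carrier_Q)

lemma mem_q: "x \<in> q v \<longleftrightarrow> (\<exists>n\<in>N. x = n \<oplus>\<^bsub>V\<^esub> v)"
  by (auto simp: q_def a_r_coset_def')

lemma q_eq_iff: "u \<in> carrier V \<Longrightarrow> v \<in> carrier V \<Longrightarrow> q u = q v \<longleftrightarrow> u \<ominus>\<^bsub>V\<^esub> v \<in> N"
  unfolding q_def a_minus_def
  by (metis ab.a_rcos_module ab.a_repr_independence' ab.a_rcos_self)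

lemma q_add: "u \<in> carrier V \<Longrightarrow> v \<in> carrier V \<Longrightarrow> q u \<oplus>\<^bsub>Q\<^esub> q v = q (u \<oplus>\<^bsub>V\<^esub> v)"
  by (simp add: q_def quot_module_def ab.a_rcos_sum)

lemma zero_Q: "\<zero>\<^bsub>Q\<^esub> = q \<zero>\<^bsub>V\<^esub>"
  by (simp add: q_def quot_module_def ab.a_rcos_const)

lemma q_eq_zero_iff: "v \<in> carrier V \<Longrightarrow> q v = \<zero>\<^bsub>Q\<^esub> \<longleftrightarrow> v \<in> N"
proof -
  assume v: "v \<in> carrier V"
  have "\<zero>\<^bsub>Q\<^esub> = N" by (simp add: quot_module_def)
  then show ?thesis
    unfolding q_def using ab.a_rcos_const ab.a_rcos_self[OF v] by auto
qed

lemma coset_map_q: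
  assumes f: "\<And>u v. u \<in> carrier V \<Longrightarrow> v \<in> carrier V \<Longrightarrow> f (u \<oplus>\<^bsub>V\<^esub> v) = f u \<oplus>\<^bsub>V\<^esub> f v"
    "\<And>v. v \<in> carrier V \<Longrightarrow> f v \<in> carrier V" "\<And>v. v \<in> N \<Longrightarrow> f v \<in> N" and v: "v \<in> carrier V"
  shows "coset_map V N f (q v) = q (f v)"
proof (rule equalityI; rule subsetI)
  fix x assume "x \<in> coset_map V N f (q v)"
  then obtain n m where nm: "n \<in> N" "m \<in> N" "x = n \<oplus>\<^bsub>V\<^esub> f (m \<oplus>\<^bsub>V\<^esub> v)"
    by (auto simp: coset_map_def set_add_def' mem_q)
  then have "x = (n \<oplus>\<^bsub>V\<^esub> f m) \<oplus>\<^bsub>V\<^esub> f v"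
    using f v N_carrier by (simp add: vs.M.a_assoc)
  then show "x \<in> q (f v)" using nm f N_add by (auto simp: mem_q)
next
  fix x assume "x \<in> q (f v)"
  then obtain n where n: "n \<in> N" "x = n \<oplus>\<^bsub>V\<^esub> f v" by (auto simp: mem_q)
  moreover have "v \<in> q v" using v N_zero by (force simp: mem_q)
  ultimately show "x \<in> coset_map V N f (q v)"
    by (auto simp: coset_map_def set_add_def')
qed

lemma q_smult: "v \<in> carrier V \<Longrightarrow> c \<odot>\<^bsub>Q\<^esub> q v = q (c \<odot>\<^bsub>V\<^esub> v)"
  unfolding quot_module_def
  by (simp, rule coset_map_q) (auto simp: vs.smult_r_distr N_smult)

lemma q_act:
  assumes "\<And>u v. u \<in> carrier V \<Longrightarrow> v \<in> carrier V \<Longrightarrow> act V x (u \<oplus>\<^bsub>V\<^esub> v) = act V x u \<oplus>\<^bsub>V\<^esub> act V x v"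
    "\<And>v. v \<in> carrier V \<Longrightarrow> act V x v \<in> carrier V" "\<And>v. v \<in> N \<Longrightarrow> act V x v \<in> N" "v \<in> carrier V"
  shows "act Q x (q v) = q (act V x v)"
  using coset_map_q[of "act V x" v] assms by (simp add: quot_module_def)

lemma vectorspace_Q: "vectorspace class_ring Q"
proof (rule vs_criteria)
  show "field (class_ring :: complex ring)" by (rule class_field)
  have ex: "\<exists>u\<in>carrier V. X = q u" if "X \<in> carrier Q" for X using that by (auto simp: carrier_Q)
  show "\<zero>\<^bsub>Q\<^esub> \<in> carrier Q" by (simp add: zero_Q q_carrier)
  show "\<forall>v w. v \<in> carrier Q \<and> w \<in> carrier Q \<longrightarrow> v \<oplus>\<^bsub>Q\<^esub> w \<in> carrier Q"
    by (auto dest!: ex simp: q_add q_carrier)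
  show "\<forall>v\<in>carrier Q. \<exists>neg_v\<in>carrier Q. v \<oplus>\<^bsub>Q\<^esub> neg_v = \<zero>\<^bsub>Q\<^esub>"
  proof
    fix X assume "X \<in> carrier Q"
    then obtain u where u: "u \<in> carrier V" "X = q u" using ex by blast
    then show "\<exists>neg_v\<in>carrier Q. X \<oplus>\<^bsub>Q\<^esub> neg_v = \<zero>\<^bsub>Q\<^esub>"
      by (intro bexI[of _ "q (\<ominus>\<^bsub>V\<^esub> u)"]) (simp_all add: q_add zero_Q q_carrier vs.M.r_neg)
  qed
  show "\<forall>c v. c \<in> carrier class_ring \<and> v \<in> carrier Q \<longrightarrow> c \<odot>\<^bsub>Q\<^esub> v \<in> carrier Q"
    by (auto dest!: ex simp: q_smult q_carrier)
  show "\<forall>v w. v \<in> carrier Q \<and> w \<in> carrier Q \<longrightarrow> v \<oplus>\<^bsub>Q\<^esub> w = w \<oplus>\<^bsub>Q\<^esub> v"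
    by (auto dest!: ex simp: q_add vs.M.a_comm)
  show "\<forall>v w x. v \<in> carrier Q \<and> w \<in> carrier Q \<and> x \<in> carrier Q \<longrightarrow> (v \<oplus>\<^bsub>Q\<^esub> w) \<oplus>\<^bsub>Q\<^esub> x = v \<oplus>\<^bsub>Q\<^esub> (w \<oplus>\<^bsub>Q\<^esub> x)"
    by (auto dest!: ex simp: q_add vs.M.a_assoc)
  show "\<forall>v\<in>carrier Q. v \<oplus>\<^bsub>Q\<^esub> \<zero>\<^bsub>Q\<^esub> = v"
    by (auto dest!: ex simp: q_add zero_Q)
  show "\<forall>a b v. a \<in> carrier class_ring \<and> b \<in> carrier class_ring \<and> v \<in> carrier Q \<longrightarrow>
      (a \<otimes>\<^bsub>class_ring\<^esub> b) \<odot>\<^bsub>Q\<^esub> v = a \<odot>\<^bsub>Q\<^esub> (b \<odot>\<^bsub>Q\<^esub> v)"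
    using vs.smult_assoc1 by (auto dest!: ex simp: q_smult)
  show "\<forall>v\<in>carrier Q. \<one>\<^bsub>class_ring\<^esub> \<odot>\<^bsub>Q\<^esub> v = v"
    using vs.smult_one by (auto dest!: ex simp: q_smult)
  show "\<forall>a b v. a \<in> carrier class_ring \<and> b \<in> carrier class_ring \<and> v \<in> carrier Q \<longrightarrow>
      (a \<oplus>\<^bsub>class_ring\<^esub> b) \<odot>\<^bsub>Q\<^esub> v = a \<odot>\<^bsub>Q\<^esub> v \<oplus>\<^bsub>Q\<^esub> b \<odot>\<^bsub>Q\<^esub> v"
    using vs.smult_l_distr by (auto dest!: ex simp: q_smult q_add)
  show "\<forall>a v w. a \<in> carrier class_ring \<and> v \<in> carrier Q \<and> w \<in> carrier Q \<longrightarrow>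
      a \<odot>\<^bsub>Q\<^esub> (v \<oplus>\<^bsub>Q\<^esub> w) = a \<odot>\<^bsub>Q\<^esub> v \<oplus>\<^bsub>Q\<^esub> a \<odot>\<^bsub>Q\<^esub> w"
    using vs.smult_r_distr by (auto dest!: ex simp: q_smult q_add)
qed

end

section \<open>The tensor relations\<close>

definition env_class :: "qidx set \<Rightarrow> tens \<Rightarrow> tens set" where
  "env_class S t = env_ideal S +>\<^bsub>tensor_alg S\<^esub> t"

lemma mem_env_class: "x \<in> env_class S t \<longleftrightarrow> x - t \<in> env_ideal S"
proof
  assume "x - t \<in> env_ideal S"
  then show "x \<in> env_class S t" by (force simp: env_class_def a_r_coset_def')
qed (auto simp: env_class_def a_r_coset_def')

lemma carrier_env: "carrier (env S) = env_class S ` tensors S"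
  by (auto simp: env_def FactRing_def A_RCOSETS_def' env_class_def a_r_coset_def')

lemma env_of_env_class: "env_of S x = env_class S (tens_of x)"
  by (simp add: env_of_def env_class_def)

context
  fixes S assumes closed: "bracket_closed S"
begin

interpretation I: ideal "env_ideal S" "tensor_alg S"
  using closed by (rule ideal_env_ideal)

lemma env_class_add: "s \<in> tensors S \<Longrightarrow> t \<in> tensors S \<Longrightarrow> env_class S s \<oplus>\<^bsub>env S\<^esub> env_class S t = env_class S (s + t)"
  using I.a_rcos_sum[of s t] by (simp add: env_class_def env_def FactRing_def)

lemma env_class_mult: "s \<in> tensors S \<Longrightarrow> t \<in> tensors S \<Longrightarrow> env_class S s \<otimes>\<^bsub>env S\<^esub> env_class S t = env_class S (s * t)"
  using I.rcoset_mult_add[of s t] by (simp add: env_class_def env_def FactRing_def)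

lemma env_ideal_closed: "0 \<in> env_ideal S" "s \<in> env_ideal S \<Longrightarrow> t \<in> env_ideal S \<Longrightarrow> s + t \<in> env_ideal S"
  "t \<in> env_ideal S \<Longrightarrow> t \<in> tensors S" "t \<in> env_ideal S \<Longrightarrow> u \<in> tensors S \<Longrightarrow> u * t \<in> env_ideal S"
  "t \<in> env_ideal S \<Longrightarrow> u \<in> tensors S \<Longrightarrow> t * u \<in> env_ideal S"
  using I.ideal_axioms unfolding tensor_ideal_iff by auto

lemma env_ideal_uminus: "t \<in> env_ideal S \<Longrightarrow> - t \<in> env_ideal S"
  using env_ideal_closed(4)[of t "- 1"] tensors_uminus[OF tensors_one] by simp

lemma env_class_self: "t \<in> env_class S t"
  by (simp add: mem_env_class env_ideal_closed)

lemma env_class_eq: "s - t \<in> env_ideal S \<Longrightarrow> env_class S s = env_class S t"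
proof -
  assume "s - t \<in> env_ideal S"
  then have "x - s \<in> env_ideal S \<longleftrightarrow> x - t \<in> env_ideal S" for x
    using env_ideal_closed(2)[of "x - s" "s - t"] env_ideal_closed(2)[of "x - t" "- (s - t)"]
      env_ideal_uminus[of "s - t"] by auto
  then show ?thesis by (auto simp: mem_env_class)
qed

lemma env_class_eqD: "env_class S s = env_class S t \<Longrightarrow> s - t \<in> env_ideal S"
  using env_class_self[of s] by (simp add: mem_env_class)

end

lemma env_map_env_class:
  assumes "bracket_closed S" "bracket_closed S'" "S' \<subseteq> S"
  shows "env_map S (env_class S' t) = env_class S t"
proof (rule equalityI; rule subsetI)
  fix x assume "x \<in> env_map S (env_class S' t)"
  then obtain i y where "i \<in> env_ideal S" "y - t \<in> env_ideal S'" "x = i + y"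
    by (auto simp: env_map_def set_add_def' mem_env_class)
  then show "x \<in> env_class S t"
    using env_ideal_mono[OF assms] env_ideal_closed(2)[OF assms(1), of i "y - t"]
    by (auto simp: mem_env_class algebra_simps)
next
  fix x assume "x \<in> env_class S t"
  then have "x - t \<in> env_ideal S" by (simp add: mem_env_class)
  then have "\<exists>a\<in>env_ideal S. \<exists>b\<in>env_class S' t. x = a + b"
    using env_class_self[OF assms(2), of t] by (metis diff_add_cancel)
  then show "x \<in> env_map S (env_class S' t)"
    unfolding env_map_def set_add_def' by auto
qed

section \<open>The two representations: numbers on v_0, operators on superpolynomials\<close>

definition chi :: "nat \<Rightarrow> qidx \<Rightarrow> complex" where
  "chi p = (\<lambda>(i, j, \<sigma>). if i = 0 \<and> j = 0 then if \<sigma> = 0 then of_nat p else of_real (sqrt (real p)) else 0)"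

lemma act_Cv0_single: "act (Cv0 p) (Poly_Mapping.single a 1) c = chi p a * c"
proof -
  obtain i j \<sigma> where a: "a = (i, j, \<sigma>)" by (cases a)
  show ?thesis
    by (cases \<sigma>) (simp_all add: a Cv0_def chi_def lookup_single when_def)
qed

interpretation crep: word_rep "\<lambda>c. c" "chi p" for p
  by unfold_locales (rule refl, rule refl, rule refl, rule mult.commute)

interpretation srep: word_rep scalar_op "q_op n p" for n p
  by unfold_locales (rule scalar_op_add, rule scalar_op_mult, rule scalar_op_1, rule scalar_op_central)

text \<open>Within q(1) the essential relation is that the square of the odd e_00 is the even e_00,
  that is, (\<surd>p)^2 = p. Outside q(1) no bracket yields e_00: this would take e_0j and e_j0 with
  \<open>j \<noteq> 0\<close>, and e_j0 is not in H.\<close>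

lemma chi_basis_rel:
  assumes "a \<in> H_idx n" "b \<in> H_idx n"
  shows "crep.ev p (basis_rel a b) = 0"
proof -
  obtain i j \<sigma> k l \<theta> where ab: "a = (i, j, \<sigma>)" "b = (k, l, \<theta>)" by (cases a; cases b)
  have chi0: "chi p (x, y, \<tau>) = 0" if "x \<noteq> 0 \<or> y \<noteq> 0" for x y \<tau>
    using that by (auto simp: chi_def)
  show ?thesis
  proof (cases "i = 0 \<and> j = 0 \<and> k = 0 \<and> l = 0")
    case True
    have "of_real (sqrt (real p)) * of_real (sqrt (real p)) = (of_nat p :: complex)"
      by (simp flip: of_real_mult)
    then show ?thesis
      unfolding ab crep.ev_basis_rel using True
      by (cases \<sigma>; cases \<theta>) (simp_all add: chi_def super_sign_def)
  next
    case False
    have "chi p (i, j, \<sigma>) = 0 \<or> chi p (k, l, \<theta>) = 0" using False chi0 by blast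
    moreover have "j = k \<Longrightarrow> chi p (i, l, \<tau>) = 0" "i = l \<Longrightarrow> chi p (k, j, \<tau>) = 0" for \<tau>
      using False assms chi0 unfolding ab H_idx_iff by metis+
    ultimately show ?thesis unfolding ab crep.ev_basis_rel by auto
  qed
qed

lemma chi_env_ideal: "t \<in> env_ideal (H_idx n) \<Longrightarrow> crep.ev p t = 0"
proof -
  have "ideal {t \<in> tensors (H_idx n). crep.ev p t = 0} (tensor_alg (H_idx n))"
    unfolding tensor_ideal_iff by (simp add: tensors_add tensors_mult crep.ev_add crep.ev_mult subset_iff)
  then have "env_ideal (H_idx n) \<subseteq> {t \<in> tensors (H_idx n). crep.ev p t = 0}"
    by (rule env_ideal_subset) (simp add: chi_basis_rel basis_rel_tensors[OF H_idx_closed])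
  then show "t \<in> env_ideal (H_idx n) \<Longrightarrow> crep.ev p t = 0" by auto
qed

lemma finsum_Cv0: "finsum (Cv0 p) f A = sum f A"
proof -
  interpret abelian_monoid "Cv0 p"
    by (rule abelian_monoidI) (simp_all add: Cv0_def add_ac)
  show ?thesis
    by (induction A rule: infinite_finite_induct) (simp_all add: Cv0_def[THEN arg_cong[where f = "add"]]
      Cv0_def[THEN arg_cong[where f = "zero"]] Cv0_def[THEN arg_cong[where f = "carrier"]])
qed

lemma tens_act_Cv0: "tens_act (Cv0 p) t w = crep.ev p t * w"
proof -
  have "foldr (\<lambda>a. act (Cv0 p) (Poly_Mapping.single a 1)) ls w = prod_list (map (chi p) ls) * w" for ls
    by (induction ls) (simp_all add: act_Cv0_single)
  then show ?thesis
    unfolding tens_act_def finsum_Cv0 crep.ev_def sum_distrib_right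
    by (intro sum.cong) (auto simp: Cv0_def)
qed

lemma env_act_Cv0: "env_act (Cv0 p) (env_class (H_idx n) t) w = crep.ev p t * w"
proof -
  have "crep.ev p x = crep.ev p t" if "x \<in> env_class (H_idx n) t" for x
    using chi_env_ideal[of "x - t" n p] that by (simp add: mem_env_class crep.ev_diff)
  then have "(\<lambda>t. tens_act (Cv0 p) t w) ` env_class (H_idx n) t = (\<lambda>_. crep.ev p t * w) ` env_class (H_idx n) t"
    by (intro image_cong) (simp_all add: tens_act_Cv0)
  also have "\<dots> = {crep.ev p t * w}"
    using env_class_self[OF H_idx_closed, of t] by (rule image_constant)
  finally have "(\<lambda>t. tens_act (Cv0 p) t w) ` env_class (H_idx n) t = {crep.ev p t * w}" .
  then show ?thesis by (simp add: env_act_def)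
qed

lemma srep_states:
  assumes "t \<in> tensors (G_idx n)" "1 \<le> p" "w \<in> states n p"
  shows "app (srep.ev n p t) w \<in> states n p"
proof -
  have "app (prod_list (map (q_op n p) ls)) w \<in> states n p" if "set ls \<subseteq> G_idx n" for ls
    using that assms(2,3) by (induction ls) (auto simp: q_op_states)
  then show ?thesis
    using assms(1) unfolding srep.ev_def app_sum_left states_def tensors_def
    by (intro supp_sum) (auto simp: supp_fscale)
qed

text \<open>The tensors that annihilate \<open>states\<close> form a two-sided ideal because
  \<open>states\<close> is invariant under the operators. The restriction to \<open>states\<close>
  is essential, since \<open>q_op_bracket\<close> relies on J^2 = -p.\<close>

lemma srep_env_ideal:
  assumes p: "1 \<le> p" and t: "t \<in> env_ideal (G_idx n)" and w: "w \<in> states n p"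
  shows "app (srep.ev n p t) w = 0"
proof -
  let ?I = "{t \<in> tensors (G_idx n). \<forall>w\<in>states n p. app (srep.ev n p t) w = 0}"
  have "ideal ?I (tensor_alg (G_idx n))"
    unfolding tensor_ideal_iff
    by (auto simp: tensors_add tensors_mult srep.ev_add srep.ev_mult intro: srep_states[OF _ p])
  moreover have "basis_rel a b \<in> ?I" if ab: "a \<in> G_idx n" "b \<in> G_idx n" for a b
  proof -
    obtain i j \<sigma> k l \<theta> where e: "a = (i, j, \<sigma>)" "b = (k, l, \<theta>)" by (cases a; cases b)
    have \<delta>: "(if x = y then u else 0) = \<delta> x y * u" for x y and u :: "fkey endo"
      by (simp add: \<delta>_def)
    have "app (srep.ev n p (basis_rel a b)) w = 0" if "w \<in> states n p" for w
      unfolding e srep.ev_basis_rel \<delta> using ab e that p by (intro q_op_bracket) (auto simp: G_idx_def)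
    then show ?thesis using ab by (simp add: basis_rel_tensors G_idx_closed)
  qed
  ultimately have "env_ideal (G_idx n) \<subseteq> ?I" by (rule env_ideal_subset)
  then show ?thesis using t w by blast
qed

lemma sum_keys_pscale:
  assumes "\<And>k. h k 0 = 0" "\<And>k x. h k (c * x) = g (h k x)" "\<And>x y. g (x + y) = g x + g y" "g 0 = 0"
  shows "(\<Sum>k\<in>Poly_Mapping.keys (pscale c f). h k (Poly_Mapping.lookup (pscale c f) k))
    = g (\<Sum>k\<in>Poly_Mapping.keys f. h k (Poly_Mapping.lookup f k))"
proof -
  have g_sum: "g (sum F A) = (\<Sum>k\<in>A. g (F k))" for F A
    by (induction A rule: infinite_finite_induct) (simp_all add: assms)
  have "(\<Sum>k\<in>Poly_Mapping.keys (pscale c f). h k (Poly_Mapping.lookup (pscale c f) k))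
      = (\<Sum>k\<in>Poly_Mapping.keys f. h k (Poly_Mapping.lookup (pscale c f) k))"
    using keys_pscale by (intro sum.mono_neutral_left) (auto simp: in_keys_iff assms(1))
  then show ?thesis by (simp add: assms(2) g_sum)
qed

section \<open>The free space and the tensor relations\<close>

locale vp =
  fixes n p :: nat
  assumes p1: "1 \<le> p"
begin

abbreviation "G \<equiv> G_idx n"
abbreviation "H \<equiv> H_idx n"
abbreviation "F \<equiv> free_tensor G (Cv0 p)"
abbreviation "classG \<equiv> env_class G"
abbreviation "pt u w \<equiv> Poly_Mapping.single (u, w) (1 :: complex)"

lemma carrier_F: "carrier F = {f. Poly_Mapping.keys f \<subseteq> carrier (env G) \<times> UNIV}"
  by (simp add: free_tensor_def Cv0_def)

lemma F_simps [simp]: "zero F = 0" "add F = (+)" "Module.smult F = pscale"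
  by (simp_all add: free_tensor_def)

lemma F_add: "f \<in> carrier F \<Longrightarrow> g \<in> carrier F \<Longrightarrow> f + g \<in> carrier F"
  using Poly_Mapping.keys_add[of f g] by (auto simp: carrier_F)

lemma F_pscale: "f \<in> carrier F \<Longrightarrow> pscale c f \<in> carrier F"
  using keys_pscale[of c f] by (auto simp: carrier_F)

lemma F_diff: "f \<in> carrier F \<Longrightarrow> g \<in> carrier F \<Longrightarrow> f - g \<in> carrier F"
  using F_add[of f "pscale (- 1) g"] F_pscale[of g "- 1"] by (simp add: pscale_minus_one)

lemma F_single: "t \<in> tensors G \<Longrightarrow> Poly_Mapping.single (classG t, w) c \<in> carrier F"
  by (auto simp: carrier_F carrier_env)

lemma F_zero: "0 \<in> carrier F"
  by (simp add: carrier_F)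

lemma vectorspace_F: "vectorspace class_ring F"
proof (rule vs_criteria, goal_cases)
  case 1 show ?case by (rule class_field)
  case 2 show ?case by (simp add: F_zero)
  case 3 show ?case by (simp add: F_add)
  case 4 show ?case
  proof
    fix v assume "v \<in> carrier F"
    then have "- v \<in> carrier F" using F_pscale[of v "- 1"] by (simp add: pscale_minus_one)
    then show "\<exists>neg_v\<in>carrier F. v \<oplus>\<^bsub>F\<^esub> neg_v = \<zero>\<^bsub>F\<^esub>" by (rule bexI[rotated]) simp
  qed
  case 5 show ?case by (simp add: F_pscale)
  case 6 show ?case by (simp add: add.commute)
  case 7 show ?case by (simp add: add.assoc)
  case 8 show ?case by simp
  case 9 show ?case by simp
  case 10 show ?case by simp
  case 11 show ?case by (simp add: pscale_add_left)
  case 12 show ?case by (simp add: pscale_add)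
qed

definition R :: "(tens set \<times> complex \<Rightarrow>\<^sub>0 complex) set" where
  "R = LinearCombinations.module.span class_ring F (tensor_relations G H (Cv0 p))"

lemma Cv0_simps [simp]: "carrier (Cv0 p) = UNIV" "add (Cv0 p) = (+)" "Module.smult (Cv0 p) = (*)"
  by (simp_all add: Cv0_def)

text \<open>The cosets are replaced by representatives in the tensor algebra, and the action of U(H)
  on the line by the number \<open>crep.ev p h\<close>.\<close>

lemma tensor_relations_alt: "tensor_relations G H (Cv0 p) =
     {pt (classG (s + t)) w - pt (classG s) w - pt (classG t) w | s t w. s \<in> tensors G \<and> t \<in> tensors G}
   \<union> {pt (classG t) (w + w') - pt (classG t) w - pt (classG t) w' | t w w'. t \<in> tensors G}
   \<union> {pt (classG t) (c * w) - pscale c (pt (classG t) w) | c t w. t \<in> tensors G}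
   \<union> {pt (classG (t * h)) w - pt (classG t) (crep.ev p h * w) | t h w. t \<in> tensors G \<and> h \<in> tensors H}"
proof -
  have h: "h \<in> tensors H \<Longrightarrow> h \<in> tensors G" for h using tensors_mono[OF H_subset_G] by blast
  note cls = env_class_add[OF G_idx_closed] env_class_mult[OF G_idx_closed] env_map_env_class[OF G_idx_closed H_idx_closed H_subset_G]
  have 1: "{pt (u \<oplus>\<^bsub>env G\<^esub> u') w - pt u w - pt u' w | u u' w.
        u \<in> carrier (env G) \<and> u' \<in> carrier (env G) \<and> w \<in> carrier (Cv0 p)}
      = {pt (classG (s + t)) w - pt (classG s) w - pt (classG t) w | s t w. s \<in> tensors G \<and> t \<in> tensors G}"
    (is "?L = ?R")
  proof (rule equalityI; rule subsetI)
    fix x assume "x \<in> ?L"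
    then obtain s t w where "s \<in> tensors G" "t \<in> tensors G"
      "x = pt (classG s \<oplus>\<^bsub>env G\<^esub> classG t) w - pt (classG s) w - pt (classG t) w"
      unfolding carrier_env by blast
    then show "x \<in> ?R" by (auto simp: cls)
  next
    fix x assume "x \<in> ?R"
    then obtain s t w where st: "s \<in> tensors G" "t \<in> tensors G"
      "x = pt (classG (s + t)) w - pt (classG s) w - pt (classG t) w" by blast
    then have "x = pt (classG s \<oplus>\<^bsub>env G\<^esub> classG t) w - pt (classG s) w - pt (classG t) w"
      by (simp add: cls)
    then show "x \<in> ?L" using st unfolding carrier_env by auto
  qed
  have 2: "{pt u (w \<oplus>\<^bsub>Cv0 p\<^esub> w') - pt u w - pt u w' | u w w'.
        u \<in> carrier (env G) \<and> w \<in> carrier (Cv0 p) \<and> w' \<in> carrier (Cv0 p)}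
      = {pt (classG t) (w + w') - pt (classG t) w - pt (classG t) w' | t w w'. t \<in> tensors G}"
    unfolding carrier_env by fastforce
  have 3: "{pt u (c \<odot>\<^bsub>Cv0 p\<^esub> w) - pscale c (pt u w) | c u w. u \<in> carrier (env G) \<and> w \<in> carrier (Cv0 p)}
      = {pt (classG t) (c * w) - pscale c (pt (classG t) w) | c t w. t \<in> tensors G}"
    unfolding carrier_env by fastforce
  have 4: "{pt (u \<otimes>\<^bsub>env G\<^esub> env_map G y) w - pt u (env_act (Cv0 p) y w) | u y w.
        u \<in> carrier (env G) \<and> y \<in> carrier (env H) \<and> w \<in> carrier (Cv0 p)}
      = {pt (classG (t * h)) w - pt (classG t) (crep.ev p h * w) | t h w. t \<in> tensors G \<and> h \<in> tensors H}"
    (is "?L = ?R")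
  proof (rule equalityI; rule subsetI)
    fix x assume "x \<in> ?L"
    then obtain t h w where "t \<in> tensors G" "h \<in> tensors H"
      "x = pt (classG t \<otimes>\<^bsub>env G\<^esub> env_map G (env_class H h)) w - pt (classG t) (env_act (Cv0 p) (env_class H h) w)"
      unfolding carrier_env by blast
    then show "x \<in> ?R" using h by (auto simp: cls env_act_Cv0)
  next
    fix x assume "x \<in> ?R"
    then obtain t h w where th: "t \<in> tensors G" "h \<in> tensors H"
      "x = pt (classG (t * h)) w - pt (classG t) (crep.ev p h * w)" by blast
    then have "x = pt (classG t \<otimes>\<^bsub>env G\<^esub> env_map G (env_class H h)) w - pt (classG t) (env_act (Cv0 p) (env_class H h) w)"
      using h by (simp add: cls env_act_Cv0)
    then show "x \<in> ?L" using th unfolding carrier_env by auto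
  qed
  show ?thesis unfolding tensor_relations_def 1 2 3 4 ..
qed

lemma relations_carrier: "tensor_relations G H (Cv0 p) \<subseteq> carrier F"
  unfolding tensor_relations_alt using tensors_mono[OF H_subset_G]
  by (auto intro!: F_diff F_single F_pscale tensors_add tensors_mult)

lemma subspace_R: "subspace class_ring R F"
proof -
  interpret vectorspace class_ring F by (rule vectorspace_F)
  show ?thesis unfolding R_def
    by (intro VectorSpace.subspace.intro vectorspace_F span_is_submodule relations_carrier)
qed

lemma R_minimal:
  assumes "subspace class_ring N F" "tensor_relations G H (Cv0 p) \<subseteq> N"
  shows "R \<subseteq> N"
proof -
  interpret vectorspace class_ring F by (rule vectorspace_F)
  show ?thesis unfolding R_def
    using assms by (intro span_is_subset) (simp_all add: VectorSpace.subspace_def)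
qed

lemma relations_R: "tensor_relations G H (Cv0 p) \<subseteq> R"
proof -
  interpret vectorspace class_ring F by (rule vectorspace_F)
  show ?thesis unfolding R_def using relations_carrier span_mem by blast
qed

sublocale B: quot_space F R
  by (rule quot_space.intro[OF vectorspace_F subspace_R])

lemma Vbar_alt: "Vbar n p = B.Q"
  unfolding Vbar_def induced_def R_def ..

end

section \<open>The induced module\<close>

lemma kill_bfun_zeros:
  assumes "j \<noteq> 0" "A \<subseteq> {0}"
  shows "app (even_op i j) (bfun (replicate_mset r 0, A)) = 0" "app (odd_op i j) (bfun (replicate_mset r 0, A)) = 0"
proof -
  have "app (D j) (bfun (replicate_mset r 0, A)) = 0" "app (Dt j) (bfun (replicate_mset r 0, A)) = 0"
    using assms by (auto intro!: app_D_bfun_0 app_Dt_bfun_0 split: if_splits)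
  then show "app (even_op i j) (bfun (replicate_mset r 0, A)) = 0" "app (odd_op i j) (bfun (replicate_mset r 0, A)) = 0"
    by (simp_all only: even_op_def odd_op_def app_simps app_zero add_0)
qed

text \<open>The top vector obeys the relations of v_0. For \<open>j \<noteq> 0\<close> the operator
  differentiates by a variable of index \<open>j\<close>, which occurs neither in the top vector nor
  in its image under \<open>J\<close>; the only other indices in H are those of e_00.\<close>

lemma q_op_H_top_state:
  assumes "a \<in> H_idx n" "1 \<le> p"
  shows "app (q_op n p a) (top_state n p) = fscale (chi p a) (top_state n p)"
proof -
  obtain i j \<sigma> where a: "a = (i, j, \<sigma>)" by (cases a)
  show ?thesis
  proof (cases "j = 0")
    case True
    then have "i = 0" using assms a by (simp add: H_idx_iff)
    then show ?thesis
      using True a q_op_00_top_state[OF assms(2), of n] q_op_01_top_state[OF assms(2), of n] by (cases \<sigma>) (simp_all add: chi_def)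
  next
    case False
    obtain q where q: "p = Suc q" using assms(2) by (cases p) auto
    have "app (even_op i j) (top_state n p) = 0"
      using False by (simp add: top_state_def top_key_def kill_bfun_zeros)
    moreover have "app (odd_op i j) (app (J n) (top_state n p)) = 0"
    proof (cases "even n")
      case True
      then have "app (J n) (top_state n p) = bfun (replicate_mset q 0, {0})"
        using J_top_state_even[of n q] by (simp add: top_state_def top_key_def q)
      then show ?thesis using False by (simp add: kill_bfun_zeros)
    next
      case odd: False
      then have "app (J n) (top_state n p) = fscale (- of_nat (Suc q)) (bfun (replicate_mset (Suc q) 0, {}))"
        using J_top_state_odd[of n q] by (simp add: top_state_def top_key_def q)
      then show ?thesis using kill_bfun_zeros(2)[OF False, of "{}" i "Suc q"] by (simp only: app_fscale fscale_zero_right empty_subsetI)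
    qed
    ultimately show ?thesis using False by (simp add: a q_op_def chi_def)
  qed
qed

lemma srep_H_top_state:
  assumes "h \<in> tensors (H_idx n)" "1 \<le> p"
  shows "app (srep.ev n p h) (top_state n p) = fscale (crep.ev p h) (top_state n p)"
proof -
  have wrd: "app (prod_list (map (q_op n p) ls)) (top_state n p) = fscale (prod_list (map (chi p) ls)) (top_state n p)"
    if "set ls \<subseteq> H_idx n" for ls
    using that assms(2) by (induction ls) (simp_all add: q_op_H_top_state mult.commute)
  have "app (srep.ev n p h) (top_state n p) = (\<Sum>m\<in>Poly_Mapping.keys h.
      fscale (Poly_Mapping.lookup h m * prod_list (map (chi p) (letters m))) (top_state n p))"
    unfolding srep.ev_def app_sum_left
    using assms(1) by (intro sum.cong) (auto simp: wrd tensors_def)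
  also have "\<dots> = fscale (crep.ev p h) (top_state n p)"
    unfolding crep.ev_def
    by (rule additive.sum[of "\<lambda>c. fscale c (top_state n p)", symmetric]) (simp add: additive_def fscale_add_left)
  finally show ?thesis .
qed

section \<open>Vectors of the induced module as tensors applied to v_0\<close>

context vp
begin

abbreviation orbit :: "tens \<Rightarrow> fkey \<Rightarrow> complex" where
  "orbit t \<equiv> app (srep.ev n p t) (top_state n p)"

lemma F_minus: "f \<in> carrier F \<Longrightarrow> g \<in> carrier F \<Longrightarrow> f \<ominus>\<^bsub>F\<^esub> g = f - g"
proof -
  assume "g \<in> carrier F"
  then have "\<ominus>\<^bsub>F\<^esub> g = - g"
    using B.smult_minus_one[of g] by (simp only: F_simps pscale_minus_one)
  then show ?thesis by (simp add: a_minus_def)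
qed

lemma R_add: "f \<in> R \<Longrightarrow> g \<in> R \<Longrightarrow> f + g \<in> R"
  using B.N_add[of f g] by simp

lemma R_pscale: "f \<in> R \<Longrightarrow> pscale c f \<in> R"
  using B.N_smult[of f c] by simp

lemma R_0: "0 \<in> R"
  using B.N_zero by simp

lemma q_eqI: "f \<in> carrier F \<Longrightarrow> g \<in> carrier F \<Longrightarrow> f - g \<in> R \<Longrightarrow> B.q f = B.q g"
  by (simp add: B.q_eq_iff F_minus)

lemma rel1: "s \<in> tensors G \<Longrightarrow> t \<in> tensors G \<Longrightarrow> pt (classG (s + t)) w - pt (classG s) w - pt (classG t) w \<in> R"
  by (rule subsetD[OF relations_R], unfold tensor_relations_alt, rule UnI1, rule UnI1, rule UnI1) blast

lemma rel2: "t \<in> tensors G \<Longrightarrow> pt (classG t) (w + w') - pt (classG t) w - pt (classG t) w' \<in> R"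
  by (rule subsetD[OF relations_R], unfold tensor_relations_alt, rule UnI1, rule UnI1, rule UnI2) blast

lemma rel3: "t \<in> tensors G \<Longrightarrow> pt (classG t) (c * w) - pscale c (pt (classG t) w) \<in> R"
  by (rule subsetD[OF relations_R], unfold tensor_relations_alt, rule UnI1, rule UnI2) blast

lemma rel4: "t \<in> tensors G \<Longrightarrow> h \<in> tensors H \<Longrightarrow> pt (classG (t * h)) w - pt (classG t) (crep.ev p h * w) \<in> R"
  by (rule subsetD[OF relations_R], unfold tensor_relations_alt, rule UnI2) blast

definition vbar_of :: "tens \<Rightarrow> vbar" where
  "vbar_of t = B.q (pt (classG t) 1)"

lemma H_tensors: "h \<in> tensors H \<Longrightarrow> h \<in> tensors G"
  using tensors_mono[OF H_subset_G] by blast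

lemma vbar_of_carrier: "t \<in> tensors G \<Longrightarrow> vbar_of t \<in> carrier (Vbar n p)"
  by (simp add: vbar_of_def Vbar_alt B.q_carrier F_single)

lemma vbar_of_add:
  assumes "s \<in> tensors G" "t \<in> tensors G"
  shows "vbar_of (s + t) = vbar_of s \<oplus>\<^bsub>Vbar n p\<^esub> vbar_of t"
proof -
  have "vbar_of s \<oplus>\<^bsub>Vbar n p\<^esub> vbar_of t = B.q (pt (classG s) 1 + pt (classG t) 1)"
    using B.q_add[OF F_single F_single, OF assms] by (simp add: vbar_of_def Vbar_alt)
  also have "\<dots> = vbar_of (s + t)"
    unfolding vbar_of_def using rel1[OF assms, of 1, THEN R_pscale, of "- 1"] assms
    by (intro q_eqI F_add F_single tensors_add) (simp_all add: pscale_minus_one algebra_simps)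
  finally show ?thesis ..
qed

lemma vbar_of_mult_H:
  assumes t: "t \<in> tensors G" and h: "h \<in> tensors H"
  shows "vbar_of (t * h) = crep.ev p h \<odot>\<^bsub>Vbar n p\<^esub> vbar_of t"
proof -
  have "crep.ev p h \<odot>\<^bsub>Vbar n p\<^esub> vbar_of t = B.q (pscale (crep.ev p h) (pt (classG t) 1))"
    using B.q_smult[OF F_single, OF t] unfolding vbar_of_def Vbar_alt by (simp only: F_simps)
  also have "\<dots> = B.q (pt (classG (t * h)) 1)"
  proof (rule q_eqI[symmetric])
    have "(pt (classG (t * h)) 1 - pt (classG t) (crep.ev p h * 1)) + (pt (classG t) (crep.ev p h * 1) - pscale (crep.ev p h) (pt (classG t) 1)) \<in> R"
      by (intro R_add rel4 rel3 t h)
    then show "pt (classG (t * h)) 1 - pscale (crep.ev p h) (pt (classG t) 1) \<in> R"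
      by (simp only: diff_add_cancel add_diff_eq)
  qed (use t h in \<open>simp_all add: F_single F_pscale tensors_mult H_tensors del: pscale_single\<close>)
  finally show ?thesis by (simp add: vbar_of_def)
qed

text \<open>The scalar \<open>single 0 c\<close> belongs to the tensors over H and acts on v_0 as
  \<open>c\<close>, so the balancing relation carries it across.\<close>

lemma vbar_of_pscale: "t \<in> tensors G \<Longrightarrow> vbar_of (pscale c t) = c \<odot>\<^bsub>Vbar n p\<^esub> vbar_of t"
proof -
  assume t: "t \<in> tensors G"
  have "t * Poly_Mapping.single 0 c = pscale c t"
    using pscale_mult_right[of t c 1] by (simp add: pscale_conv_mult[of c "1 :: tens"])
  then show ?thesis
    using vbar_of_mult_H[OF t tensors_scalar, of c] by (simp add: crep.ev_single)
qed

lemma vbar_of_env_ideal: "t \<in> env_ideal G \<Longrightarrow> vbar_of t = \<zero>\<^bsub>Vbar n p\<^esub>"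
proof -
  assume "t \<in> env_ideal G"
  then have "classG t = classG 0" by (intro env_class_eq[OF G_idx_closed]) simp
  moreover have "pt (classG 0) 1 \<in> R"
    using rel1[of 0 0 1, THEN R_pscale, of "- 1"] by (simp add: pscale_minus_one)
  ultimately show ?thesis
    unfolding vbar_of_def Vbar_alt using F_single[of 0] by (simp add: B.q_eq_zero_iff)
qed

lemma vbar_of_surj:
  assumes "Z \<in> carrier (Vbar n p)"
  obtains t where "t \<in> tensors G" "Z = vbar_of t"
proof -
  obtain f where f: "f \<in> carrier F" "Z = B.q f" using assms by (auto simp: Vbar_alt B.carrier_Q)
  have "f \<in> carrier F \<and> (\<exists>t\<in>tensors G. B.q f = vbar_of t)"
  proof (induction f rule: poly_mapping_span_induct)
    case zero
    have "B.q 0 = vbar_of 0" using vbar_of_env_ideal[of 0] env_ideal_closed(1)[OF G_idx_closed]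
      by (simp add: Vbar_alt B.zero_Q)
    then show ?case using F_zero by (auto intro: bexI[of _ 0])
  next
    case (add f g)
    then obtain s t where st: "s \<in> tensors G" "t \<in> tensors G" "B.q f = vbar_of s" "B.q g = vbar_of t" by blast
    then have "B.q (f + g) = vbar_of (s + t)"
      using B.q_add[of f g] add by (simp add: vbar_of_add Vbar_alt)
    then show ?case using add st by (auto simp: F_add tensors_add intro!: bexI[of _ "s + t"])
  next
    case (single m c)
    then obtain t w where m: "m = (classG t, w)" "t \<in> tensors G" using f by (auto simp: carrier_F carrier_env)
    have "B.q (Poly_Mapping.single m c) = B.q (pscale (c * w) (pt (classG t) 1))"
    proof (rule q_eqI)
      have "pscale c (pt (classG t) (w * 1) - pscale w (pt (classG t) 1)) \<in> R"
        by (intro R_pscale rel3 m)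
      then show "Poly_Mapping.single m c - pscale (c * w) (pt (classG t) 1) \<in> R"
        by (simp add: m pscale_diff)
    qed (auto simp: m F_single)
    also have "\<dots> = (c * w) \<odot>\<^bsub>Vbar n p\<^esub> vbar_of t"
      using B.q_smult[OF F_single, OF m(2)] unfolding vbar_of_def Vbar_alt by (simp only: F_simps)
    also have "\<dots> = vbar_of (pscale (c * w) t)" by (simp add: vbar_of_pscale m)
    finally show ?case using m by (auto simp: F_single tensors_pscale)
  qed
  then show thesis using f that by auto
qed

lemma act_F: "act F x f = (\<Sum>k\<in>Poly_Mapping.keys f.
    Poly_Mapping.single (env_of G x \<otimes>\<^bsub>env G\<^esub> fst k, snd k) (Poly_Mapping.lookup f k))"
  by (simp add: free_tensor_def case_prod_beta)

lemma act_F_add: "act F x (f + g) = act F x f + act F x g"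
  unfolding act_F by (rule setsum_keys_plus_distrib) (simp_all add: single_add)

lemma act_F_pscale: "act F x (pscale c f) = pscale c (act F x f)"
  unfolding act_F by (rule sum_keys_pscale) (simp_all add: pscale_add)

lemma act_F_diff: "act F x (f - g) = act F x f - act F x g"
  using act_F_add[of x f "pscale (- 1) g"] act_F_pscale[of x "- 1" g] by (simp add: pscale_minus_one)

lemma act_F_single:
  "x \<in> lie_span G \<Longrightarrow> t \<in> tensors G \<Longrightarrow> act F x (Poly_Mapping.single (classG t, w) c) = Poly_Mapping.single (classG (tens_of x * t), w) c"
  by (simp add: act_F env_of_env_class env_class_mult[OF G_idx_closed] tensors_tens_of)

lemma act_F_carrier:
  assumes x: "x \<in> lie_span G" and f: "f \<in> carrier F"
  shows "act F x f \<in> carrier F"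
proof (induction f rule: poly_mapping_span_induct)
  case zero then show ?case by (simp add: act_F F_zero)
next
  case (add f g) then show ?case by (simp add: act_F_add F_add)
next
  case (single m c)
  then obtain t w where "m = (classG t, w)" "t \<in> tensors G" using f by (auto simp: carrier_F carrier_env)
  then show ?case using x by (simp add: act_F_single F_single tensors_mult tensors_tens_of)
qed

text \<open>Left multiplication commutes with the right multiplication by U(H), so it sends each of
  the four families of relations into itself.\<close>

lemma act_F_R:
  assumes x: "x \<in> lie_span G" and f: "f \<in> R"
  shows "act F x f \<in> R"
proof -
  let ?N = "{f \<in> carrier F. act F x f \<in> R}"
  have "subspace class_ring ?N F"
    by (rule subspace_classI[OF vectorspace_F])
      (auto simp: F_zero F_add F_pscale act_F_add act_F_pscale R_add R_pscale act_F[of x 0] R_0)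
  moreover have "tensor_relations G H (Cv0 p) \<subseteq> ?N"
  proof
    fix r assume r: "r \<in> tensor_relations G H (Cv0 p)"
    have xt: "t \<in> tensors G \<Longrightarrow> tens_of x * t \<in> tensors G" for t using x by (simp add: tensors_mult tensors_tens_of)
    have "act F x r \<in> R"
      using r unfolding tensor_relations_alt
      by (elim UnE CollectE exE conjE)
        (simp_all add: act_F_diff act_F_pscale act_F_single x tensors_add tensors_mult H_tensors distrib_left
          rel1 rel2 rel3 rel4 xt mult.assoc[symmetric] del: pscale_single)
    then show "r \<in> ?N" using r relations_carrier by blast
  qed
  ultimately have "R \<subseteq> ?N" by (rule R_minimal)
  then show ?thesis using f by blast
qed

lemma vbar_of_act:
  assumes "x \<in> lie_span G" "t \<in> tensors G"
  shows "act (Vbar n p) x (vbar_of t) = vbar_of (tens_of x * t)"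
  unfolding vbar_of_def Vbar_alt
  using B.q_act[of x "pt (classG t) 1"] act_F_carrier act_F_R assms
  by (simp add: act_F_add act_F_single F_single)

text \<open>The image of a pure tensor (u, w): the operator of \<open>u\<close> applied to the top
  vector, times \<open>w\<close>. A representative of the coset \<open>u\<close> has to be chosen;
  \<open>PhiG_env_class\<close> shows that the choice does not matter.\<close>

definition PhiG :: "tens set \<times> complex \<Rightarrow> fkey \<Rightarrow> complex" where
  "PhiG k = fscale (snd k) (orbit (SOME t. t \<in> tensors G \<and> classG t = fst k))"

definition Phi :: "(tens set \<times> complex \<Rightarrow>\<^sub>0 complex) \<Rightarrow> fkey \<Rightarrow> complex" where
  "Phi f = (\<Sum>k\<in>Poly_Mapping.keys f. fscale (Poly_Mapping.lookup f k) (PhiG k))"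

lemma PhiG_env_class:
  assumes t: "t \<in> tensors G"
  shows "PhiG (classG t, w) = fscale w (orbit t)"
proof -
  define s where "s = (SOME s. s \<in> tensors G \<and> classG s = classG t)"
  have s: "s \<in> tensors G \<and> classG s = classG t" unfolding s_def by (rule someI[of _ t]) (use t in simp)
  then have "s - t \<in> env_ideal G" by (intro env_class_eqD[OF G_idx_closed]) simp
  then have "orbit (s - t) = 0"
    using p1 by (intro srep_env_ideal top_state_states)
  then have "orbit s = orbit t"
    by (simp only: srep.ev_diff app_simps right_minus_eq)
  then show ?thesis by (simp add: PhiG_def flip: s_def)
qed

lemma Phi_add: "Phi (f + g) = Phi f + Phi g"
  unfolding Phi_def by (rule setsum_keys_plus_distrib, rule fscale_zero_left, rule fscale_add_left)

lemma Phi_pscale: "Phi (pscale c f) = fscale c (Phi f)"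
  unfolding Phi_def by (rule sum_keys_pscale, rule fscale_zero_left, rule fscale_fscale[symmetric], rule fscale_add, rule fscale_zero_right)

lemma Phi_diff: "Phi (f - g) = Phi f - Phi g"
  using Phi_add[of "f - g" g] by simp

lemma Phi_single: "t \<in> tensors G \<Longrightarrow> Phi (Poly_Mapping.single (classG t, w) c) = fscale (c * w) (orbit t)"
  by (simp add: Phi_def PhiG_env_class)

text \<open>Three families vanish by linearity, the balancing relations because H acts on the top
  vector by the same numbers as on v_0.\<close>

lemma Phi_R: "f \<in> R \<Longrightarrow> Phi f = 0"
proof -
  let ?N = "{f \<in> carrier F. Phi f = 0}"
  have "subspace class_ring ?N F"
    by (rule subspace_classI[OF vectorspace_F])
      (auto simp: F_zero F_add F_pscale Phi_add Phi_pscale Phi_def[of 0])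
  moreover have "tensor_relations G H (Cv0 p) \<subseteq> ?N"
  proof
    fix r assume r: "r \<in> tensor_relations G H (Cv0 p)"
    have "Phi r = 0"
      using r unfolding tensor_relations_alt
      by (elim UnE CollectE exE conjE)
        (simp_all add: Phi_diff Phi_pscale Phi_single tensors_add tensors_mult H_tensors srep.ev_add srep.ev_mult
          srep_H_top_state[OF _ p1] fscale_add fscale_add_left mult.commute del: pscale_single)
    then show "r \<in> ?N" using r relations_carrier by blast
  qed
  ultimately have "R \<subseteq> ?N" by (rule R_minimal)
  then show "f \<in> R \<Longrightarrow> Phi f = 0" by blast
qed

lemma vbar_of_zero_imp: "t \<in> tensors G \<Longrightarrow> vbar_of t = \<zero>\<^bsub>Vbar n p\<^esub> \<Longrightarrow> orbit t = 0"
  using B.q_eq_zero_iff[OF F_single, of t 1 1] Phi_R[of "pt (classG t) 1"] Phi_single[of t 1 1]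
  by (simp add: vbar_of_def Vbar_alt)

end

section \<open>The maximal submodule\<close>

context vp
begin

definition pull :: "vbar set \<Rightarrow> tens set" where
  "pull N = {t \<in> tensors G. vbar_of t \<in> N}"

text \<open>Modulo the defining relations, \<open>shift_prod m\<close> kills the eigenvectors of \<open>e\<^sub>0\<^sub>0\<close> with eigenvalues
  \<open>p - 1, \<dots>, p - m\<close> and multiplies those with eigenvalue \<open>p\<close> by \<open>m!\<close>.\<close>

primrec shift_prod :: "nat \<Rightarrow> tens" where
  "shift_prod 0 = 1"
| "shift_prod (Suc m) = (letter (0, 0, 0) - pscale (of_nat p - of_nat (Suc m)) 1) * shift_prod m"

lemma idx00: "(0, 0, \<sigma>) \<in> G"
  by (simp add: G_idx_def)

text \<open>At the eigenvalue \<open>p\<close> of e_00 the successive factors take the values 1, 2,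
  ..., m.\<close>

lemma ev_shift_prod_top_state: "orbit (shift_prod m) = fscale (fact m) (top_state n p)"
proof (induction m)
  case (Suc m)
  have "orbit (shift_prod (Suc m)) =
      fscale (fact m) (app (q_op n p (0, 0, 0)) (top_state n p)) - fscale ((of_nat p - of_nat (Suc m)) * fact m) (top_state n p)"
    by (simp only: shift_prod.simps srep.ev_mult srep.ev_diff srep.ev_pscale srep.ev_letter srep.ev_one app_simps app_scalar_op
        Suc app_fscale fscale_fscale fscale_diff mult_1_right mult.commute[of "fact m"])
  also have "\<dots> = fscale (fact m * of_nat p - (of_nat p - of_nat (Suc m)) * fact m) (top_state n p)"
    unfolding q_op_00_top_state[OF p1] by (rule ext) (simp add: algebra_simps)
  also have "fact m * of_nat p - (of_nat p - of_nat (Suc m)) * fact m = (fact (Suc m) :: complex)"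
    by (simp add: algebra_simps)
  finally show ?case .
qed simp

end

text \<open>The properties used of the preimage of a submodule: a left ideal that contains the
  relations of U(G) and those of v_0. As it is only a left ideal, \<open>K_basis_rel\<close>
  includes a right factor. The preimages of an arbitrary submodule and of the zero submodule are
  both instances.\<close>

locale good_sub = vp +
  fixes K :: "tens set"
  assumes K_tensors: "K \<subseteq> tensors G" and K_0: "0 \<in> K"
    and K_add: "s \<in> K \<Longrightarrow> t \<in> K \<Longrightarrow> s + t \<in> K"
    and K_pscale: "t \<in> K \<Longrightarrow> pscale c t \<in> K"
    and K_letter: "a \<in> G \<Longrightarrow> t \<in> K \<Longrightarrow> letter a * t \<in> K"
    and K_basis_rel: "a \<in> G \<Longrightarrow> b \<in> G \<Longrightarrow> t \<in> tensors G \<Longrightarrow> basis_rel a b * t \<in> K"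
    and K_chi: "a \<in> H \<Longrightarrow> letter a - pscale (chi p a) 1 \<in> K"
begin

lemma K_diff: "s \<in> K \<Longrightarrow> t \<in> K \<Longrightarrow> s - t \<in> K"
  using K_add[of s "pscale (- 1) t"] K_pscale[of t "- 1"] by (simp add: pscale_minus_one)

lemma single_Cons: "Poly_Mapping.single (Word (a # ls)) c = letter a * Poly_Mapping.single (Word ls) c"
  by (simp add: letter_def mult_single plus_fmon_def)

lemma single_Nil: "Poly_Mapping.single (Word []) c = pscale c (1 :: tens)"
  by (simp flip: zero_fmon_def single_one)

lemma K_mult:
  assumes s: "s \<in> tensors G" and t: "t \<in> K"
  shows "s * t \<in> K"
proof (induction s rule: poly_mapping_span_induct)
  case (single m c)
  have "Poly_Mapping.single (Word ls) c * t \<in> K" if "set ls \<subseteq> G" for ls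
    using that
  proof (induction ls)
    case Nil
    then show ?case using t by (simp add: single_Nil pscale_mult_left K_pscale)
  next
    case (Cons a ls)
    then show ?case by (simp add: single_Cons mult.assoc K_letter)
  qed
  from this[of "letters m"] show ?case using single s by (simp add: tensors_def)
qed (simp_all add: K_0 K_add distrib_right)

text \<open>Minus the weight under the adjoint action of e_00: letters e_i0 with
  \<open>i \<noteq> 0\<close> lower the eigenvalue by one, letters e_0i raise it.\<close>

definition grade :: "qidx \<Rightarrow> int" where
  "grade = (\<lambda>(i, j, \<sigma>). of_bool (j = 0) - of_bool (i = 0))"

text \<open>\<open>Y k\<close> consists, modulo \<open>K\<close>, of the combinations of products of \<open>k\<close> letters \<open>e\<^sub>i\<^sub>0\<close> with \<open>i \<ge> 1\<close>.  Integer
  indices make \<open>Y_letter\<close> uniform; for \<open>k < 0\<close> only \<open>K\<close> remains.\<close>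

inductive Y :: "int \<Rightarrow> tens \<Rightarrow> bool" where
  Y_base: "t \<in> K \<Longrightarrow> Y k t"
| Y_one: "Y 0 1"
| Y_step: "i \<in> {1..n} \<Longrightarrow> Y k t \<Longrightarrow> Y (k + 1) (letter (i, 0, \<tau>) * t)"
| Y_add: "Y k s \<Longrightarrow> Y k t \<Longrightarrow> Y k (s + t)"
| Y_pscale: "Y k t \<Longrightarrow> Y k (pscale c t)"

lemma Y_tensors: "Y k t \<Longrightarrow> t \<in> tensors G"
  by (induction rule: Y.induct)
    (use K_tensors in \<open>auto intro!: tensors_mult tensors_letter tensors_add tensors_pscale simp: G_idx_def\<close>)

lemma Y_zero: "Y k 0"
  by (rule Y_base) (rule K_0)

lemma Y_diff: "Y k s \<Longrightarrow> Y k t \<Longrightarrow> Y k (s - t)"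
  using Y_add[of k s "pscale (- 1) t"] Y_pscale[of k t "- 1"] by (simp add: pscale_minus_one)

lemma letter_swap: "letter a * (letter f * t) = basis_rel a f * t + pscale (bsign a f) (letter f * (letter a * t)) + tens_of (basis_bracket a f) * t"
  by (simp add: basis_rel_def left_diff_distrib pscale_mult_left mult.assoc)

text \<open>Straightening, as in the spanning half of the Poincare-Birkhoff-Witt theorem: the letter
  is moved to the right by \<open>letter_swap\<close> until it meets v_0, where \<open>K_chi\<close>
  evaluates it if it lies in H.\<close>

lemma Y_letter: "Y k t \<Longrightarrow> a \<in> G \<Longrightarrow> Y (k + grade a) (letter a * t)"
proof (induction arbitrary: a rule: Y.induct)
  case (Y_base t k)
  then show ?case by (intro Y.Y_base K_letter)
next
  case Y_one
  obtain i j \<sigma> where a: "a = (i, j, \<sigma>)" by (cases a)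
  show ?case
  proof (cases "a \<in> H")
    case True
    have split: "letter a * 1 = (letter a - pscale (chi p a) 1) + pscale (chi p a) 1" by simp
    show ?thesis
    proof (cases "i = 0 \<and> j = 0")
      case True
      then have "grade a = 0" by (simp add: a grade_def)
      moreover have "Y 0 (letter a * 1)"
        unfolding split by (intro Y_add Y.Y_base K_chi \<open>a \<in> H\<close> Y_pscale Y.Y_one)
      ultimately show ?thesis by simp
    next
      case False
      then have "chi p a = 0" by (auto simp: a chi_def)
      then show ?thesis using K_chi[OF \<open>a \<in> H\<close>] by (intro Y.Y_base) simp
    qed
  next
    case False
    then have "j = 0" "i \<in> {1..n}" using Y_one by (auto simp: a H_idx_iff G_idx_def)
    then show ?thesis using Y_step[OF _ Y.Y_one, of i \<sigma>] by (simp add: a grade_def)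
  qed
next
  case (Y_step i k t \<tau>)
  obtain x y \<sigma> where a: "a = (x, y, \<sigma>)" by (cases a)
  have i: "i \<noteq> 0" "i \<le> n" using Y_step by auto
  have xy: "x \<le> n" "y \<le> n" using Y_step a by (auto simp: G_idx_def)
  let ?f = "(i, 0, \<tau>)"
  have "basis_rel a ?f * t \<in> K" using Y_step i Y_tensors by (intro K_basis_rel) (auto simp: G_idx_def)
  then have "Y (k + grade a + 1) (basis_rel a ?f * t)" by (rule Y.Y_base)
  moreover have "Y (k + grade a + 1) (letter ?f * (letter a * t))"
    using Y_step by (intro Y.Y_step) auto
  \<comment> \<open>Each bracket term is a single letter of grade \<open>grade a + 1\<close> in
    front of the shorter product \<open>t\<close>, so the induction hypothesis applies to
    it.\<close>
  moreover have "Y (k + grade a + 1) (tens_of (basis_bracket a ?f) * t)"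
  proof -
    have "Y (k + grade a + 1) ((if y = i then letter (x, 0, \<rho>) else 0) * t)" for \<rho>
    proof (cases "y = i")
      case True
      have "Y (k + grade (x, 0, \<rho>)) (letter (x, 0, \<rho>) * t)"
        using xy by (intro Y_step.IH) (simp add: G_idx_def)
      then show ?thesis using True i by (cases "x = 0") (simp_all add: a grade_def add.assoc)
    qed (simp add: Y_zero)
    moreover have "Y (k + grade a + 1) ((if x = 0 then letter (i, y, \<rho>) else 0) * t)" for \<rho>
    proof (cases "x = 0")
      case True
      have "Y (k + grade (i, y, \<rho>)) (letter (i, y, \<rho>) * t)"
        using xy i by (intro Y_step.IH) (simp add: G_idx_def)
      then show ?thesis using True i by (cases "y = 0") (simp_all add: a grade_def add.assoc)
    qed (simp add: Y_zero)
    ultimately show ?thesis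
      unfolding a tens_of_basis_bracket left_diff_distrib pscale_mult_left
      by (intro Y_diff Y_pscale)
  qed
  ultimately have "Y (k + grade a + 1) (letter a * (letter ?f * t))"
    unfolding letter_swap[of a ?f t] by (intro Y_add Y_pscale)
  then show ?case by (simp add: add_ac)
next
  case (Y_add k s t)
  then show ?case by (simp add: distrib_left Y.Y_add)
next
  case (Y_pscale k t c)
  then show ?case by (simp add: pscale_mult_right Y.Y_pscale)
qed

lemma Y_neg: "Y k t \<Longrightarrow> k < 0 \<Longrightarrow> t \<in> K"
  by (induction rule: Y.induct) (auto intro!: K_letter K_add K_pscale simp: G_idx_def)

text \<open>e_00 has eigenvalue \<open>p\<close> on v_0, and each of the \<open>k\<close> letters
  e_i0 lowers it by one.\<close>

lemma Y_Cartan: "Y k t \<Longrightarrow> letter (0, 0, 0) * t - pscale (of_nat p - of_int k) t \<in> K"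
proof (induction rule: Y.induct)
  case (Y_base t k)
  then show ?case by (intro K_diff K_letter K_pscale idx00)
next
  case Y_one
  have "(0, 0, 0) \<in> H" by (simp add: H_idx_iff)
  from K_chi[OF this] show ?case by (simp add: chi_def)
next
  case (Y_step i k t \<tau>)
  let ?f = "(i, 0, \<tau>) :: qidx" and ?h = "(0, 0, 0) :: qidx"
  have i: "i \<noteq> 0" "?f \<in> G" using Y_step by (auto simp: G_idx_def)
  have "tens_of (basis_bracket ?h ?f) = - letter ?f"
    unfolding tens_of_basis_bracket using i by (simp add: super_sign_def)
  then have "letter ?h * (letter ?f * t) = basis_rel ?h ?f * t + letter ?f * (letter ?h * t) - letter ?f * t"
    using letter_swap[of ?h ?f t] by (simp add: super_sign_def)
  then have "letter ?h * (letter ?f * t) - pscale (of_nat p - of_int (k + 1)) (letter ?f * t) =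
      basis_rel ?h ?f * t + letter ?f * (letter ?h * t - pscale (of_nat p - of_int k) t)"
    by (simp add: right_diff_distrib pscale_mult_right, intro poly_mapping_eqI)
      (simp add: lookup_add lookup_minus algebra_simps)
  also have "\<dots> \<in> K"
    using Y_step i Y_tensors by (intro K_add K_basis_rel K_letter idx00) auto
  finally show ?case .
next
  case (Y_add k s t)
  have "letter (0, 0, 0) * (s + t) - pscale (of_nat p - of_int k) (s + t) =
      (letter (0, 0, 0) * s - pscale (of_nat p - of_int k) s) + (letter (0, 0, 0) * t - pscale (of_nat p - of_int k) t)"
    by (simp add: distrib_left pscale_add)
  then show ?case using Y_add K_add by simp
next
  case (Y_pscale k t c)
  have "letter (0, 0, 0) * pscale c t - pscale (of_nat p - of_int k) (pscale c t) =
      pscale c (letter (0, 0, 0) * t - pscale (of_nat p - of_int k) t)"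
    by (simp add: pscale_mult_right pscale_diff mult.commute)
  then show ?case using Y_pscale K_pscale by simp
qed

lemma Y_top: "Y k t \<Longrightarrow> k = 0 \<Longrightarrow> \<exists>c. t - pscale c 1 \<in> K"
proof (induction rule: Y.induct)
  case (Y_base t k)
  then show ?case by (intro exI[of _ 0]) simp
next
  case Y_one
  then show ?case by (intro exI[of _ 1]) (simp add: K_0)
next
  case (Y_step i k t \<tau>)
  \<comment> \<open>Here \<open>k\<close> is -1, so \<open>t\<close> already lies in
    \<open>K\<close>.\<close>
  then have "letter (i, 0, \<tau>) * t \<in> K" by (intro K_letter Y_neg[of k]) (auto simp: G_idx_def)
  then show ?case by (intro exI[of _ 0]) simp
next
  case (Y_add k s t)
  then obtain c d where cd: "s - pscale c 1 \<in> K" "t - pscale d 1 \<in> K" by blast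
  have "s + t - pscale (c + d) 1 = (s - pscale c 1) + (t - pscale d 1)"
    by (simp add: pscale_add_left)
  then show ?case using K_add[OF cd] by metis
next
  case (Y_pscale k t c)
  then obtain d where d: "t - pscale d 1 \<in> K" by blast
  have "pscale c t - pscale (c * d) 1 = pscale c (t - pscale d 1)"
    by (simp add: pscale_diff)
  then show ?case using K_pscale[OF d] by metis
qed

lemma h_tensors: "letter (0, 0, 0) - pscale c 1 \<in> tensors G"
  by (intro tensors_diff tensors_letter tensors_pscale tensors_one idx00)

lemma shift_prod_tensors: "shift_prod m \<in> tensors G"
  by (induction m) (simp_all only: shift_prod.simps tensors_one tensors_mult h_tensors)

text \<open>On the eigenvalue p - k the factor with shift p - (j + 1) acts as j + 1 - k.\<close>

lemma shift_prod_Y: "Y k t \<Longrightarrow> shift_prod m * t - pscale (\<Prod>j<m. of_nat (Suc j) - of_int k) t \<in> K"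
proof (induction m)
  case 0
  then show ?case by (simp add: K_0)
next
  case (Suc m)
  define x where "x = (\<Prod>j<m. of_nat (Suc j) - of_int k :: complex)"
  define h where "h = letter (0, 0, 0)"
  define c where "c = (of_nat p - of_nat (Suc m) :: complex)"
  have IH: "shift_prod m * t - pscale x t \<in> K" using Suc by (simp add: x_def)
  have "(h - pscale c 1) * (shift_prod m * t - pscale x t) + pscale x (h * t - pscale (of_nat p - of_int k) t) \<in> K"
    using Y_Cartan[OF Suc.prems] h_tensors[of c] IH by (intro K_add K_mult K_pscale) (simp_all add: h_def)
  moreover have "(h - pscale c 1) * (shift_prod m * t - pscale x t) + pscale x (h * t - pscale (of_nat p - of_int k) t)
      = shift_prod (Suc m) * t - pscale (x * (of_nat (Suc m) - of_int k)) t"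
    by (simp add: h_def[symmetric] c_def[symmetric] left_diff_distrib right_diff_distrib pscale_mult_left pscale_mult_right
        pscale_diff mult.assoc del: of_nat_Suc, intro poly_mapping_eqI)
      (simp add: lookup_add lookup_minus algebra_simps c_def)
  ultimately show ?case by (simp add: x_def del: shift_prod.simps of_nat_Suc)
qed

text \<open>Negative \<open>k\<close> leaves only \<open>K\<close>; for \<open>k = 0\<close> the
  vector is a multiple of v_0 and the factors multiply to \<open>fact m\<close>; for positive
  \<open>k\<close> one factor is zero as soon as \<open>m\<close> reaches \<open>k\<close>.\<close>

lemma Y_reduce: "Y k t \<Longrightarrow> \<exists>M c. \<forall>m\<ge>M. shift_prod m * t - pscale (fact m * c) 1 \<in> K"
proof -
  assume t: "Y k t"
  consider "k < 0" | "k = 0" | "k > 0" by linarith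
  then show ?thesis
  proof cases
    case 1
    then have "shift_prod m * t \<in> K" for m using t by (intro K_mult shift_prod_tensors Y_neg)
    then show ?thesis by (intro exI[of _ 0]) simp
  next
    case 2
    then obtain c where c: "t - pscale c 1 \<in> K" using Y_top t by blast
    have "shift_prod m * t - pscale (fact m * c) 1 \<in> K" for m
    proof -
      have "(\<Prod>j<m. of_nat (Suc j) - of_int k) = (fact m :: complex)"
        unfolding 2 by (induction m) (simp_all add: mult.commute)
      then have "(shift_prod m * t - pscale (fact m) t) + pscale (fact m) (t - pscale c 1) \<in> K"
        using shift_prod_Y[OF t, of m] K_pscale[OF c] by (intro K_add) simp_all
      then show ?thesis by (simp add: pscale_diff)
    qed
    then show ?thesis by blast
  next
    case 3
    have "shift_prod m * t \<in> K" if "m \<ge> nat k" for m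
    proof -
      have "of_nat (Suc (nat k - 1)) - of_int k = (0 :: complex)"
      proof -
        have "Suc (nat k - 1) = nat k" using 3 by simp
        then show ?thesis using 3 by (simp only: of_nat_nat less_imp_le diff_self)
      qed
      then have pr: "(\<Prod>j<m. of_nat (Suc j) - of_int k) = (0 :: complex)"
        \<comment> \<open>The vanishing factor is the one with index
          \<open>j = k - 1\<close>.\<close>
        using 3 that by (intro prod_zero bexI[of _ "nat k - 1"]) auto
      show ?thesis using shift_prod_Y[OF t, of m] unfolding pr by simp
    qed
    then show ?thesis by (intro exI[of _ "nat k"] exI[of _ 0]) simp
  qed
qed

text \<open>The thresholds differ between the eigencomponents of \<open>t\<close>. Stating the claim
  for all large \<open>m\<close>, with \<open>c\<close> independent of \<open>m\<close>, lets the
  components be added at a common \<open>m\<close>.\<close>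

lemma tensors_reduce:
  assumes t: "t \<in> tensors G"
  shows "\<exists>M c. \<forall>m\<ge>M. shift_prod m * t - pscale (fact m * c) 1 \<in> K"
proof (induction t rule: poly_mapping_span_induct)
  case zero
  then show ?case by (intro exI[of _ 0]) (simp add: K_0)
next
  case (add f g)
  obtain M c M' c' where fg: "\<forall>m\<ge>M. shift_prod m * f - pscale (fact m * c) 1 \<in> K"
    "\<forall>m\<ge>M'. shift_prod m * g - pscale (fact m * c') 1 \<in> K"
    using add by blast
  have "shift_prod m * (f + g) - pscale (fact m * (c + c')) 1 \<in> K" if "m \<ge> max M M'" for m
  proof -
    have "shift_prod m * (f + g) - pscale (fact m * (c + c')) 1 =
        (shift_prod m * f - pscale (fact m * c) 1) + (shift_prod m * g - pscale (fact m * c') 1)"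
      by (simp add: distrib_left pscale_add_left)
    then show ?thesis using fg that K_add by simp
  qed
  then show ?case by blast
next
  case (single m c)
  have "\<exists>k. Y k (Poly_Mapping.single (Word ls) c)" if "set ls \<subseteq> G" for ls
    using that
  proof (induction ls)
    case Nil
    then show ?case using Y_pscale[OF Y_one, of c] by (auto simp: single_Nil)
  next
    case (Cons a ls)
    then obtain k where "Y k (Poly_Mapping.single (Word ls) c)" by auto
    then show ?case unfolding single_Cons using Cons.prems by (auto intro: Y_letter)
  qed
  from this[of "letters m"] obtain k where "Y k (Poly_Mapping.single m c)"
    using single t by (auto simp: tensors_def)
  then show ?case by (rule Y_reduce)
qed

end

section \<open>Submodules of the induced module and \<open>Mp\<close>\<close>

context vp
begin

lemma vs_Vbar: "vectorspace class_ring (Vbar n p)"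
  unfolding Vbar_alt by (rule B.vectorspace_Q)

lemma letter_lie_span: "a \<in> G \<Longrightarrow> Poly_Mapping.single a 1 \<in> lie_span G"
  by (simp add: lie_span_def)

lemma good_pull:
  assumes N: "is_submodule G (Vbar n p) N"
  shows "good_sub n p (pull N)"
proof -
  have sub: "subspace class_ring N (Vbar n p)" and act: "\<And>x v. x \<in> lie_span G \<Longrightarrow> v \<in> N \<Longrightarrow> act (Vbar n p) x v \<in> N"
    using N by (auto simp: is_submodule_def)
  note subD = subspace_classD[OF sub]
  have I: "t \<in> pull N" if "t \<in> env_ideal G" for t
    using that env_ideal_closed(3)[OF G_idx_closed] by (simp add: pull_def vbar_of_env_ideal subD)
  show ?thesis
  proof (unfold_locales)
    show "pull N \<subseteq> tensors G" by (auto simp: pull_def)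
    show "0 \<in> pull N" using I env_ideal_closed(1)[OF G_idx_closed] by blast
    fix s t assume "s \<in> pull N" "t \<in> pull N"
    then show "s + t \<in> pull N" by (simp add: pull_def tensors_add vbar_of_add subD)
  next
    fix t c assume "t \<in> pull N"
    then show "pscale c t \<in> pull N" by (simp add: pull_def tensors_pscale vbar_of_pscale subD)
  next
    fix a t assume "a \<in> G" "t \<in> pull N"
    then show "letter a * t \<in> pull N"
      using act[OF letter_lie_span, of a "vbar_of t"] vbar_of_act[OF letter_lie_span, of a t]
      by (simp add: pull_def tensors_mult tensors_letter tens_of_single)
  next
    fix a b t assume "a \<in> G" "b \<in> G" "t \<in> tensors G"
    then show "basis_rel a b * t \<in> pull N"
      by (intro I env_ideal_closed(5)[OF G_idx_closed] basis_rel_env_ideal G_idx_closed)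
  next
    fix a assume a: "a \<in> H"
    then have aG: "a \<in> G" using H_subset_G by blast
    have "vbar_of (letter a) = chi p a \<odot>\<^bsub>Vbar n p\<^esub> vbar_of 1"
      using vbar_of_mult_H[OF tensors_one tensors_letter[OF a]] by simp
    also have "\<dots> = vbar_of (pscale (chi p a) 1)" by (simp add: vbar_of_pscale)
    finally have eq: "vbar_of (letter a) = vbar_of (pscale (chi p a) 1)" .
    have "letter a - pscale (chi p a) 1 = letter a + pscale (- 1) (pscale (chi p a) 1)"
      by (simp add: pscale_minus_one[symmetric] flip: pscale_pscale)
    then have "vbar_of (letter a - pscale (chi p a) 1) = vbar_of (pscale (chi p a) 1 + pscale (- 1) (pscale (chi p a) 1))"
      using aG eq by (simp only: vbar_of_add tensors_letter tensors_pscale tensors_one)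
    also have "pscale (chi p a) 1 + pscale (- 1) (pscale (chi p a) 1) = (0 :: tens)"
      unfolding pscale_minus_one by simp
    finally show "letter a - pscale (chi p a) 1 \<in> pull N"
      using I[of 0] env_ideal_closed(1)[OF G_idx_closed] aG by (simp add: pull_def tensors_diff tensors_letter tensors_pscale)
  qed
qed

lemma zero_submodule: "is_submodule G (Vbar n p) {\<zero>\<^bsub>Vbar n p\<^esub>}"
proof -
  interpret V: vectorspace class_ring "Vbar n p" by (rule vs_Vbar)
  have 0: "vbar_of 0 = \<zero>\<^bsub>Vbar n p\<^esub>" using vbar_of_env_ideal env_ideal_closed(1)[OF G_idx_closed] by blast
  have "c \<odot>\<^bsub>Vbar n p\<^esub> \<zero>\<^bsub>Vbar n p\<^esub> = \<zero>\<^bsub>Vbar n p\<^esub>" for c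
    using vbar_of_pscale[of 0 c] by (simp add: 0)
  moreover have "x \<in> lie_span G \<Longrightarrow> act (Vbar n p) x \<zero>\<^bsub>Vbar n p\<^esub> = \<zero>\<^bsub>Vbar n p\<^esub>" for x
    using vbar_of_act[of x 0] by (simp add: 0)
  ultimately show ?thesis
    unfolding is_submodule_def by (auto intro!: subspace_classI vs_Vbar)
qed

lemma vbar_of_eq_imp:
  assumes "s \<in> tensors G" "t \<in> tensors G" "vbar_of s = vbar_of t"
  shows "orbit s = orbit t"
proof -
  have "vbar_of (s + pscale (- 1) t) = vbar_of (t + pscale (- 1) t)"
    using assms by (simp only: vbar_of_add tensors_pscale)
  also have "t + pscale (- 1) t = 0" by (simp add: pscale_minus_one)
  also have "vbar_of 0 = \<zero>\<^bsub>Vbar n p\<^esub>" using vbar_of_env_ideal env_ideal_closed(1)[OF G_idx_closed] by blast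
  finally have "orbit (s + pscale (- 1) t) = 0"
    using assms by (intro vbar_of_zero_imp tensors_add tensors_pscale)
  then show ?thesis by (simp add: pscale_minus_one srep.ev_diff)
qed

lemma orbit_stable:
  assumes "w \<in> states n p"
  shows "stable n p {app (srep.ev n p s) w |s. s \<in> tensors G}"
  unfolding stable_def fun_subspace_def
proof (intro conjI ballI allI subsetI)
  show "0 \<in> {app (srep.ev n p s) w |s. s \<in> tensors G}" by (auto intro!: exI[of _ 0])
next
  fix f assume f: "f \<in> {app (srep.ev n p s) w |s. s \<in> tensors G}"
  then obtain s where s: "s \<in> tensors G" "f = app (srep.ev n p s) w" by blast
  show "f \<in> states n p" using s srep_states[OF _ p1 assms] by simp
  show "fscale c f \<in> {app (srep.ev n p s) w |s. s \<in> tensors G}" for c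
    using s tensors_pscale by (auto intro!: exI[of _ "pscale c s"] simp: srep.ev_pscale)
  show "app (q_op n p a) f \<in> {app (srep.ev n p s) w |s. s \<in> tensors G}" if "a \<in> G" for a
    using s that by (auto intro!: exI[of _ "letter a * s"] simp: srep.ev_mult tensors_mult tensors_letter)
  fix g assume "g \<in> {app (srep.ev n p s) w |s. s \<in> tensors G}"
  then obtain t where t: "t \<in> tensors G" "g = app (srep.ev n p t) w" by blast
  show "f + g \<in> {app (srep.ev n p s) w |s. s \<in> tensors G}"
    using s t by (auto intro!: exI[of _ "s + t"] simp: srep.ev_add tensors_add)
qed

text \<open>Irreducibility of the image gives an \<open>s\<close> such that \<open>s * t\<close> has
  the top vector as its image, but this determines (s t) v_0 only up to the kernel of the
  projection, which may lie outside \<open>N\<close>. The product \<open>shift_prod m\<close>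
  removes the lower eigencomponents and leaves a nonzero multiple of v_0 inside
  \<open>N\<close>.\<close>

lemma submodule_top:
  assumes N: "is_submodule G (Vbar n p) N" and t: "t \<in> tensors G" "vbar_of t \<in> N"
    and nz: "orbit t \<noteq> 0"
  shows "vbar_of 1 \<in> N"
proof -
  interpret N: good_sub n p "pull N" by (rule good_pull[OF N])
  interpret Z: good_sub n p "pull {\<zero>\<^bsub>Vbar n p\<^esub>}" by (rule good_pull[OF zero_submodule])
  define w where "w = orbit t"
  have w: "w \<in> states n p" unfolding w_def by (rule srep_states[OF t(1) p1 top_state_states[OF p1]])
  have "w \<in> {app (srep.ev n p s) w |s. s \<in> tensors G}"
    by (rule CollectI, rule exI[of _ 1]) (simp only: srep.ev_one app_simps tensors_one simp_thms)
  then have "top_state n p \<in> {app (srep.ev n p s) w |s. s \<in> tensors G}"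
    using stable_top_state[OF orbit_stable[OF w] p1] nz by (simp add: w_def)
  then obtain s where s: "s \<in> tensors G" "app (srep.ev n p s) w = top_state n p" by force
  define r where "r = s * t"
  have r: "r \<in> tensors G" "orbit r = top_state n p"
    using s t by (simp_all add: r_def tensors_mult srep.ev_mult w_def)
  have rN: "r \<in> pull N" unfolding r_def using t by (intro N.K_mult s) (simp add: pull_def)
  \<comment> \<open>The reduction is made modulo the zero submodule instead of \<open>N\<close>: the
    images of both sides can then be compared, which forces \<open>c = 1\<close>.\<close>
  obtain m c where mc: "shift_prod m * r - pscale (fact m * c) 1 \<in> pull {\<zero>\<^bsub>Vbar n p\<^esub>}"
    using Z.tensors_reduce[OF r(1)] by blast
  then have "orbit (shift_prod m * r - pscale (fact m * c) 1) = 0"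
    by (intro vbar_of_zero_imp) (auto simp: pull_def)
  then have "fscale (fact m) (top_state n p) - fscale (fact m * c) (top_state n p) = 0"
    by (simp only: srep.ev_diff srep.ev_mult srep.ev_pscale srep.ev_one app_simps app_scalar_op r ev_shift_prod_top_state mult_1_right)
  then have "(fscale (fact m) (top_state n p) - fscale (fact m * c) (top_state n p)) (top_key n p) = 0 (top_key n p)"
    by (rule arg_cong)
  then have c: "c = 1" by (simp add: top_state_def bfun_def)
  have "shift_prod m * r - pscale (fact m * c) 1 \<in> pull N"
    using mc subspace_classD(2)[of N "Vbar n p"] N by (auto simp: pull_def is_submodule_def)
  moreover have "shift_prod m * r \<in> pull N" by (intro N.K_mult N.shift_prod_tensors rN)
  ultimately have "pscale (fact m) 1 \<in> pull N"
    using N.K_diff[of "shift_prod m * r" "shift_prod m * r - pscale (fact m * c) 1"] by (simp add: c)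
  then have "pscale (1 / fact m) (pscale (fact m) 1) \<in> pull N" by (rule N.K_pscale)
  moreover have "pscale (1 / fact m) (pscale (fact m) 1) = (1 :: tens)" by simp
  ultimately show ?thesis by (simp only: pull_def mem_Collect_eq)
qed

definition top_kernel :: "vbar set" where
  "top_kernel = {vbar_of t |t. t \<in> tensors G \<and> orbit t = 0}"

lemma vbar_of_top_kernel: "t \<in> tensors G \<Longrightarrow> vbar_of t \<in> top_kernel \<longleftrightarrow> orbit t = 0"
proof
  assume "t \<in> tensors G" "vbar_of t \<in> top_kernel"
  then obtain s where "s \<in> tensors G" "vbar_of t = vbar_of s" "orbit s = 0"
    unfolding top_kernel_def by blast
  then show "orbit t = 0" using vbar_of_eq_imp[of t s] \<open>t \<in> tensors G\<close> by simp
next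
  assume "t \<in> tensors G" "orbit t = 0"
  then show "vbar_of t \<in> top_kernel" unfolding top_kernel_def by blast
qed

lemma top_kernel_submodule: "is_submodule G (Vbar n p) top_kernel"
  unfolding is_submodule_def
proof (intro conjI ballI)
  show "subspace class_ring top_kernel (Vbar n p)"
  proof (rule subspace_classI[OF vs_Vbar])
    show "top_kernel \<subseteq> carrier (Vbar n p)" by (auto simp: top_kernel_def vbar_of_carrier)
    have "vbar_of 0 \<in> top_kernel" by (simp add: vbar_of_top_kernel)
    then show "\<zero>\<^bsub>Vbar n p\<^esub> \<in> top_kernel" using vbar_of_env_ideal env_ideal_closed(1)[OF G_idx_closed] by metis
  next
    fix u v assume "u \<in> top_kernel" "v \<in> top_kernel"
    then obtain s t where "s \<in> tensors G" "t \<in> tensors G" "u = vbar_of s" "v = vbar_of t"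
        "orbit s = 0" "orbit t = 0" by (auto simp: top_kernel_def)
    then show "u \<oplus>\<^bsub>Vbar n p\<^esub> v \<in> top_kernel"
      by (simp add: vbar_of_add[symmetric] vbar_of_top_kernel tensors_add srep.ev_add)
  next
    fix c v assume "v \<in> top_kernel"
    then obtain t where "t \<in> tensors G" "v = vbar_of t" "orbit t = 0" by (auto simp: top_kernel_def)
    then show "c \<odot>\<^bsub>Vbar n p\<^esub> v \<in> top_kernel"
      by (simp add: vbar_of_pscale[symmetric] vbar_of_top_kernel tensors_pscale srep.ev_pscale)
  qed
next
  fix x v assume x: "x \<in> lie_span G" and "v \<in> top_kernel"
  then obtain t where "t \<in> tensors G" "v = vbar_of t" "orbit t = 0" by (auto simp: top_kernel_def)
  then show "act (Vbar n p) x v \<in> top_kernel"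
    using x by (simp add: vbar_of_act vbar_of_top_kernel tensors_mult tensors_tens_of srep.ev_mult)
qed

lemma Mp_eq: "Mp n p = top_kernel"
  unfolding Mp_def
proof (rule Greatest_equality)
  have "vbar_of 1 \<notin> top_kernel" using top_state_nonzero[of n p] by (simp add: vbar_of_top_kernel)
  moreover have "vbar_of 1 \<in> carrier (Vbar n p)" by (rule vbar_of_carrier[OF tensors_one])
  ultimately have "top_kernel \<noteq> carrier (Vbar n p)" by metis
  then show "is_submodule G (Vbar n p) top_kernel \<and> top_kernel \<noteq> carrier (Vbar n p)"
    using top_kernel_submodule by (rule conjI[rotated])
next
  fix N assume N: "is_submodule G (Vbar n p) N \<and> N \<noteq> carrier (Vbar n p)"
  then have sub: "N \<subseteq> carrier (Vbar n p)" using subspace_classD(1) by (auto simp: is_submodule_def)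
  interpret good_sub n p "pull N" using N by (intro good_pull) simp
  show "N \<subseteq> top_kernel"
  proof
    fix Z assume Z: "Z \<in> N"
    then have "Z \<in> carrier (Vbar n p)" using sub by (rule rev_subsetD)
    then obtain t where t: "t \<in> tensors G" "Z = vbar_of t" by (rule vbar_of_surj)
    have "orbit t = 0"
    proof (rule ccontr)
      assume "orbit t \<noteq> 0"
      then have "vbar_of 1 \<in> N" using t Z by (intro submodule_top[OF conjunct1[OF N], of t]) simp_all
      then have 1: "1 \<in> pull N" by (simp add: pull_def)
      have "carrier (Vbar n p) \<subseteq> N"
      proof
        fix X assume "X \<in> carrier (Vbar n p)"
        then obtain s where s: "s \<in> tensors G" "X = vbar_of s" by (rule vbar_of_surj)
        have "s * 1 \<in> pull N" by (rule K_mult[OF s(1) 1])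
        then show "X \<in> N" using s by (simp add: pull_def)
      qed
      then show False using sub conjunct2[OF N] by (metis equalityI)
    qed
    then show "Z \<in> top_kernel" using t by (simp add: vbar_of_top_kernel)
  qed
qed

end

section \<open>The character\<close>

text \<open>The indicator functions \<open>bfun k\<close> form a basis of \<open>supp S\<close>, and
  their images under the linear bijection a basis of \<open>V\<close>. The source is a plain set of
  functions without a module record, so the basis is carried over by explicit linear
  combinations.\<close>

lemma dim_supp_iso:
  fixes V :: "(complex, 'v, 'e) module_scheme" and \<Psi> :: "('k \<Rightarrow> complex) \<Rightarrow> 'v"
  assumes vs: "vectorspace class_ring V" and S: "finite S"
    and inj: "inj_on \<Psi> (supp S)" and surj: "\<Psi> ` supp S = carrier V"
    and add: "\<And>f g. f \<in> supp S \<Longrightarrow> g \<in> supp S \<Longrightarrow> \<Psi> (f + g) = \<Psi> f \<oplus>\<^bsub>V\<^esub> \<Psi> g"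
    and scale: "\<And>c f. f \<in> supp S \<Longrightarrow> \<Psi> (fscale c f) = c \<odot>\<^bsub>V\<^esub> \<Psi> f"
  shows "vectorspace.fin_dim class_ring V \<and> vectorspace.dim class_ring V = card S"
proof -
  interpret V: vectorspace class_ring V by (rule vs)
  have car: "f \<in> supp S \<Longrightarrow> \<Psi> f \<in> carrier V" for f using surj by blast
  have zero: "\<Psi> 0 = \<zero>\<^bsub>V\<^esub>"
  proof -
    have "\<Psi> 0 = 0 \<odot>\<^bsub>V\<^esub> \<Psi> 0" using scale[of 0 0] by simp
    then show ?thesis using V.smult_l_null[OF car[of 0]] by simp
  qed
  define b where "b k = \<Psi> (bfun k)" for k
  have inj_b: "inj_on b S"
  proof (rule inj_onI)
    fix k l assume kl: "k \<in> S" "l \<in> S" "b k = b l"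
    then have "bfun k = bfun l" using inj by (simp add: b_def inj_on_eq_iff bfun_supp)
    then have "bfun k k = bfun l k" by (rule fun_cong)
    then show "k = l" by (simp add: bfun_def split: if_splits)
  qed
  have sum: "(\<Oplus>\<^bsub>V\<^esub>k\<in>A. c k \<odot>\<^bsub>V\<^esub> b k) = \<Psi> (\<Sum>k\<in>A. fscale (c k) (bfun k))" if "A \<subseteq> S" for A c
    using finite_subset[OF that S] that
  proof (induction A rule: finite_induct)
    case empty
    then show ?case by (simp only: V.M.finsum_empty sum.empty zero)
  next
    case (insert k A)
    have "bfun l \<in> supp S" if "l \<in> insert k A" for l using insert.prems that by (intro bfun_supp) blast
    then have mem: "fscale (c l) (bfun l) \<in> supp S" if "l \<in> insert k A" for l using that by (intro supp_fscale)
    have c: "c l \<odot>\<^bsub>V\<^esub> b l = \<Psi> (fscale (c l) (bfun l))" if "l \<in> insert k A" for l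
      using insert.prems that unfolding b_def by (intro scale[symmetric] bfun_supp) blast
    have "(\<Oplus>\<^bsub>V\<^esub>k\<in>insert k A. c k \<odot>\<^bsub>V\<^esub> b k) = c k \<odot>\<^bsub>V\<^esub> b k \<oplus>\<^bsub>V\<^esub> (\<Oplus>\<^bsub>V\<^esub>k\<in>A. c k \<odot>\<^bsub>V\<^esub> b k)"
      using insert.hyps c car mem by (intro V.M.finsum_insert) auto
    also have "\<dots> = \<Psi> (fscale (c k) (bfun k)) \<oplus>\<^bsub>V\<^esub> \<Psi> (\<Sum>k\<in>A. fscale (c k) (bfun k))"
      using insert.prems by (simp only: insert.IH c[OF insertI1] insert_subset)
    also have "\<dots> = \<Psi> (fscale (c k) (bfun k) + (\<Sum>k\<in>A. fscale (c k) (bfun k)))"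
      using mem by (intro add[symmetric] supp_sum) auto
    finally show ?case by (simp only: sum.insert[OF insert.hyps])
  qed
  have b_car: "b ` S \<subseteq> carrier V" using car by (auto simp: b_def bfun_supp)
  have lin: "V.lincomb a (b ` S) = \<Psi> (\<Sum>k\<in>S. fscale (a (b k)) (bfun k))" for a
  proof -
    have "V.lincomb a (b ` S) = (\<Oplus>\<^bsub>V\<^esub>k\<in>S. a (b k) \<odot>\<^bsub>V\<^esub> b k)"
      unfolding V.lincomb_def using b_car inj_b by (intro V.M.finsum_reindex) auto
    then show ?thesis by (simp only: sum[OF subset_refl])
  qed
  have coeff: "(\<Sum>k\<in>S. fscale (c k) (bfun k)) l = c l" if "l \<in> S" for c l
  proof -
    have "(\<Sum>k\<in>S. fscale (c k) (bfun k)) l = (\<Sum>k\<in>S. fscale (c k) (bfun k) l)"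
      using S by (induction S) auto
    also have "\<dots> = (\<Sum>k\<in>S. if k = l then c k else 0)"
      by (rule sum.cong) (auto simp: bfun_def)
    finally show ?thesis using S that by simp
  qed
  have "V.basis (b ` S)"
    unfolding V.basis_def
  proof (intro conjI b_car)
    show "V.lin_indpt (b ` S)"
    proof (rule V.finite_lin_indpt2)
      fix a :: "'v \<Rightarrow> complex" assume "V.lincomb a (b ` S) = \<zero>\<^bsub>V\<^esub>"
      then have "\<Psi> (\<Sum>k\<in>S. fscale (a (b k)) (bfun k)) = \<Psi> 0" using lin zero by simp
      moreover have "(\<Sum>k\<in>S. fscale (a (b k)) (bfun k)) \<in> supp S"
        by (intro supp_sum supp_fscale bfun_supp)
      ultimately have 0: "(\<Sum>k\<in>S. fscale (a (b k)) (bfun k)) = 0" using inj by (simp add: inj_on_eq_iff)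
      have "a (b k) = 0" if "k \<in> S" for k
        using coeff[OF that, of "\<lambda>k. a (b k)"] unfolding 0 by simp
      then show "\<forall>v\<in>b ` S. a v = \<zero>\<^bsub>class_ring\<^esub>" by simp
    qed (use S b_car in auto)
    show "V.span (b ` S) = carrier V"
    proof
      show "V.span (b ` S) \<subseteq> carrier V" by (rule V.span_is_subset2[OF b_car])
      show "carrier V \<subseteq> V.span (b ` S)"
      proof
        fix v assume "v \<in> carrier V"
        then obtain f where f: "f \<in> supp S" "v = \<Psi> f" using surj by blast
        \<comment> \<open>\<open>lincomb\<close> takes its coefficients as a function of the
          vectors, hence the inverse of the injective \<open>b\<close>.\<close>
        define a where "a v = f (the_inv_into S b v)" for v
        have "V.lincomb a (b ` S) = \<Psi> (\<Sum>k\<in>S. fscale (f k) (bfun k))"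
          unfolding lin by (intro arg_cong[where f = \<Psi>] sum.cong) (simp_all add: a_def the_inv_into_f_f[OF inj_b])
        also have "\<dots> = v" using supp_bfun_sum[OF S f(1)] f(2) by simp
        finally have "v = V.lincomb a (b ` S)" ..
        then show "v \<in> V.span (b ` S)" using S unfolding V.span_def by auto
      qed
    qed
  qed
  then show ?thesis
    using V.dim_basis[of "b ` S"] S inj_b card_image
    unfolding V.fin_dim_def V.basis_def by auto
qed

definition key_weight :: "fkey \<Rightarrow> weight" where
  "key_weight = (\<lambda>(a, A). (\<Sum>i\<in>#a. Poly_Mapping.single i 1) + (\<Sum>i\<in>A. Poly_Mapping.single i 1))"

lemma lookup_key_weight: "finite A \<Longrightarrow> Poly_Mapping.lookup (key_weight (a, A)) i = of_nat (count a i) + of_bool (i \<in> A)"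
proof -
  assume A: "finite A"
  have "Poly_Mapping.lookup (\<Sum>i\<in>#a. Poly_Mapping.single i 1 :: weight) i = of_nat (count a i)"
    by (induction a) (auto simp: lookup_add lookup_single when_def)
  then show ?thesis
    using A by (simp add: key_weight_def lookup_add lookup_sum lookup_single when_def)
qed

lemma formal_exp_add: "formal_exp (\<mu> + \<nu>) = formal_exp \<mu> * formal_exp \<nu>"
  by (simp add: formal_exp_def mult_single)

lemma formal_exp_key_weight: "finite A \<Longrightarrow> formal_exp (key_weight (a, A)) = (\<Prod>i\<in>#a. x_var i) * (\<Prod>i\<in>A. x_var i)"
proof -
  assume A: "finite A"
  have 0: "formal_exp 0 = 1" by (simp add: formal_exp_def)
  have "formal_exp (\<Sum>i\<in>#a. Poly_Mapping.single i 1) = (\<Prod>i\<in>#a. x_var i)"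
    by (induction a) (simp_all add: 0 formal_exp_add x_var_def)
  moreover have "formal_exp (\<Sum>i\<in>A. Poly_Mapping.single i 1) = (\<Prod>i\<in>A. x_var i)"
    using A by (induction A) (simp_all add: 0 formal_exp_add x_var_def)
  ultimately show ?thesis by (simp add: key_weight_def formal_exp_add)
qed

text \<open>The keys are grouped by the number \<open>q\<close> of odd variables: the multiset part
  then gives the complete symmetric function of degree p - q, the set part the elementary one of
  degree \<open>q\<close>.\<close>

lemma sum_fkeys_formal_exp:
  "(\<Sum>k\<in>fkeys n p (even n). formal_exp (key_weight k)) =
    (\<Sum>q | q \<le> n \<and> q mod 2 = n mod 2. complete_sym n (int p - int q) * elem_sym n q)"
proof -
  let ?Q = "{q. q \<le> n \<and> q mod 2 = n mod 2}"
  have "(\<Sum>k\<in>fkeys n p (even n). formal_exp (key_weight k)) =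
      (\<Sum>q\<in>?Q. \<Sum>k | k \<in> fkeys n p (even n) \<and> card (snd k) = q. formal_exp (key_weight k))"
  proof (rule sum.group[symmetric])
    show "(\<lambda>k. card (snd k)) ` fkeys n p (even n) \<subseteq> ?Q"
    proof
      fix q assume "q \<in> (\<lambda>k. card (snd k)) ` fkeys n p (even n)"
      then obtain A where A: "q = card A" "A \<subseteq> {..n}" "even (card A) = even n" by (auto simp: fkeys_def)
      have "card A \<le> Suc n" using card_mono[OF _ A(2)] by simp
      \<comment> \<open>The parity excludes the full set of n + 1 odd variables, which gives the
        bound \<open>q \<le> n\<close>.\<close>
      moreover have "card A \<noteq> Suc n" using A(3) by auto
      ultimately have "q \<le> n" using A(1) by simp
      moreover have "q mod 2 = n mod 2" using A(1,3) by presburger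
      ultimately show "q \<in> ?Q" by simp
    qed
  qed (auto simp: finite_fkeys)
  also have "\<dots> = (\<Sum>q\<in>?Q. complete_sym n (int p - int q) * elem_sym n q)"
  proof (rule sum.cong[OF refl])
    fix q assume "q \<in> ?Q"
    then have "q mod 2 = n mod 2" by simp
    then have q: "even q = even n" by presburger
    show "(\<Sum>k | k \<in> fkeys n p (even n) \<and> card (snd k) = q. formal_exp (key_weight k)) =
        complete_sym n (int p - int q) * elem_sym n q"
    proof (cases "q \<le> p")
      \<comment> \<open>A key of degree \<open>p\<close> cannot contain more than \<open>p\<close>
        odd variables, in agreement with the convention that \<open>complete_sym\<close> is 0 in
        negative degree.\<close>
      case False
      then have "{k. k \<in> fkeys n p (even n) \<and> card (snd k) = q} = {}" by (auto simp: fkeys_def)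
      then show ?thesis using False by (simp only: sum.empty) (simp add: complete_sym_def)
    next
      case True
      let ?M = "{a. set_mset a \<subseteq> {..n} \<and> size a = p - q}" and ?A = "{A. A \<subseteq> {..n} \<and> card A = q}"
      have "{k. k \<in> fkeys n p (even n) \<and> card (snd k) = q} = ?M \<times> ?A"
        using True q by (auto simp: fkeys_def)
      then have "(\<Sum>k | k \<in> fkeys n p (even n) \<and> card (snd k) = q. formal_exp (key_weight k)) =
          (\<Sum>a\<in>?M. \<Sum>A\<in>?A. formal_exp (key_weight (a, A)))"
        by (simp only: sum.cartesian_product) (simp add: case_prod_unfold)
      also have "\<dots> = (\<Sum>a\<in>?M. \<Sum>A\<in>?A. (\<Prod>i\<in>#a. x_var i) * (\<Prod>i\<in>A. x_var i))"
        by (intro sum.cong refl formal_exp_key_weight) (auto intro: finite_subset)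
      also have "\<dots> = complete_sym n (int p - int q) * elem_sym n q"
        using True by (simp add: complete_sym_def elem_sym_def sum_product nat_diff_distrib')
      finally show ?thesis .
    qed
  qed
  finally show ?thesis .
qed

section \<open>The isomorphism between the superpolynomials and \<open>Vp\<close>\<close>

context vp
begin

interpretation M: quot_space "Vbar n p" top_kernel
  by (rule quot_space.intro[OF vs_Vbar]) (use top_kernel_submodule in \<open>simp add: is_submodule_def\<close>)

lemma Vp_alt: "Vp n p = quot_module (Vbar n p) top_kernel"
  by (simp only: Vp_def Mp_eq)

lemma vs_Vp: "vectorspace class_ring (Vp n p)"
  unfolding Vp_alt by (rule M.vectorspace_Q)

definition vp_of :: "tens \<Rightarrow> vbar set" where
  "vp_of t = M.q (vbar_of t)"

lemma carrier_Vp: "carrier (Vp n p) = vp_of ` tensors G"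
proof -
  have "carrier (Vbar n p) = vbar_of ` tensors G" using vbar_of_carrier vbar_of_surj by blast
  then show ?thesis unfolding Vp_alt M.carrier_Q by (simp add: vp_of_def image_image)
qed

lemma vp_of_add: "s \<in> tensors G \<Longrightarrow> t \<in> tensors G \<Longrightarrow> vp_of (s + t) = vp_of s \<oplus>\<^bsub>Vp n p\<^esub> vp_of t"
  unfolding Vp_alt vp_of_def using M.q_add[OF vbar_of_carrier vbar_of_carrier, of s t] by (simp add: vbar_of_add)

lemma vp_of_pscale: "t \<in> tensors G \<Longrightarrow> vp_of (pscale c t) = c \<odot>\<^bsub>Vp n p\<^esub> vp_of t"
  unfolding Vp_alt vp_of_def using M.q_smult[OF vbar_of_carrier, of t c] by (simp add: vbar_of_pscale)

lemma vp_of_zero_iff: "t \<in> tensors G \<Longrightarrow> vp_of t = \<zero>\<^bsub>Vp n p\<^esub> \<longleftrightarrow> orbit t = 0"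
  unfolding Vp_alt vp_of_def using M.q_eq_zero_iff[OF vbar_of_carrier, of t] by (simp add: vbar_of_top_kernel)

lemma vp_of_act:
  assumes x: "x \<in> lie_span G" and t: "t \<in> tensors G"
  shows "act (Vp n p) x (vp_of t) = vp_of (tens_of x * t)"
proof -
  have 1: "act (Vbar n p) x (u \<oplus>\<^bsub>Vbar n p\<^esub> v) = act (Vbar n p) x u \<oplus>\<^bsub>Vbar n p\<^esub> act (Vbar n p) x v"
    if uv: "u \<in> carrier (Vbar n p)" "v \<in> carrier (Vbar n p)" for u v
  proof -
    obtain s where s: "s \<in> tensors G" "u = vbar_of s" using uv(1) by (rule vbar_of_surj)
    obtain t where t: "t \<in> tensors G" "v = vbar_of t" using uv(2) by (rule vbar_of_surj)
    show ?thesis using s t x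
      by (simp add: vbar_of_add[symmetric] vbar_of_act tensors_add tensors_mult tensors_tens_of distrib_left)
  qed
  have 2: "act (Vbar n p) x v \<in> carrier (Vbar n p)" if v: "v \<in> carrier (Vbar n p)" for v
  proof -
    obtain t where t: "t \<in> tensors G" "v = vbar_of t" using v by (rule vbar_of_surj)
    then show ?thesis using x by (simp add: vbar_of_act vbar_of_carrier tensors_mult tensors_tens_of)
  qed
  have 3: "act (Vbar n p) x v \<in> top_kernel" if "v \<in> top_kernel" for v
    using top_kernel_submodule x that by (simp add: is_submodule_def)
  show ?thesis
    unfolding Vp_alt vp_of_def using M.q_act[OF 1 2 3 vbar_of_carrier[OF t]] vbar_of_act[OF x t] by simp
qed

text \<open>The quotient is by the kernel of the projection, so it identifies tensors exactly when
  their images agree. Both the definition of \<open>Psi\<close> by choice and its injectivity rest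
  on this.\<close>

lemma vp_of_eq_iff:
  assumes s: "s \<in> tensors G" and t: "t \<in> tensors G"
  shows "vp_of s = vp_of t \<longleftrightarrow> orbit s = orbit t"
proof -
  have 0: "vp_of 0 = \<zero>\<^bsub>Vp n p\<^esub>" by (simp add: vp_of_zero_iff)
  have sum: "vp_of (s' + pscale (- 1) t') = vp_of s' \<oplus>\<^bsub>Vp n p\<^esub> (- 1) \<odot>\<^bsub>Vp n p\<^esub> vp_of t'" if "s' \<in> tensors G" "t' \<in> tensors G" for s' t'
    using that by (simp add: vp_of_add tensors_pscale flip: vp_of_pscale)
  have diff: "s + pscale (- 1) t = s - t" by (simp add: pscale_minus_one)
  show ?thesis
  proof
    assume "vp_of s = vp_of t"
    then have "vp_of (s + pscale (- 1) t) = vp_of (t + pscale (- 1) t)" using sum s t by simp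
    also have "t + pscale (- 1) t = 0" by (simp add: pscale_minus_one)
    finally have "orbit (s - t) = 0"
      using s t vp_of_zero_iff[of "s - t"] 0 by (simp add: diff tensors_diff)
    then show "orbit s = orbit t" by (simp add: srep.ev_diff)
  next
    assume "orbit s = orbit t"
    then have z: "vp_of (s - t) = \<zero>\<^bsub>Vp n p\<^esub>" using s t by (simp add: vp_of_zero_iff tensors_diff srep.ev_diff)
    have "vp_of s = vp_of ((s - t) + t)" by simp
    also have "\<dots> = vp_of (s - t) \<oplus>\<^bsub>Vp n p\<^esub> vp_of t" using s t by (intro vp_of_add tensors_diff)
    also have "\<dots> = vp_of 0 \<oplus>\<^bsub>Vp n p\<^esub> vp_of t" by (simp only: z 0)
    also have "\<dots> = vp_of (0 + t)" using t by (intro vp_of_add[symmetric]) simp_all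
    finally show "vp_of s = vp_of t" by simp
  qed
qed

lemma states_reached:
  assumes "w \<in> states n p"
  obtains t where "t \<in> tensors G" "orbit t = w"
proof -
  have "top_state n p \<in> {orbit s |s. s \<in> tensors G}"
    by (rule CollectI, rule exI[of _ 1]) (simp only: srep.ev_one app_simps tensors_one simp_thms)
  then have "{orbit s |s. s \<in> tensors G} = states n p"
    by (rule stable_full[OF orbit_stable[OF top_state_states[OF p1]] p1])
  then have "w \<in> {orbit s |s. s \<in> tensors G}" using assms by (simp only:)
  then obtain t where "t \<in> tensors G" "w = orbit t" by blast
  then show thesis using that by (metis (lifting))
qed

text \<open>The inverse of the induced map from \<open>Vp n p\<close> to \<open>states n p\<close>.
  Some preimage exists by \<open>states_reached\<close>, that is, by irreducibility.\<close>

definition Psi :: "(fkey \<Rightarrow> complex) \<Rightarrow> vbar set" where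
  "Psi w = vp_of (SOME t. t \<in> tensors G \<and> orbit t = w)"

lemma Psi_ev: "t \<in> tensors G \<Longrightarrow> Psi (orbit t) = vp_of t"
proof -
  assume t: "t \<in> tensors G"
  define s where "s = (SOME s. s \<in> tensors G \<and> orbit s = orbit t)"
  have "s \<in> tensors G \<and> orbit s = orbit t"
    unfolding s_def by (rule someI[of _ t]) (use t in simp)
  then show ?thesis unfolding Psi_def s_def[symmetric] using t by (simp add: vp_of_eq_iff)
qed

lemma Psi_bij: "bij_betw Psi (states n p) (carrier (Vp n p))"
  unfolding bij_betw_def
proof
  show "inj_on Psi (states n p)"
  proof (rule inj_onI)
    fix v w assume vw: "v \<in> states n p" "w \<in> states n p" "Psi v = Psi w"
    obtain s where s: "s \<in> tensors G" "orbit s = v" using vw(1) by (rule states_reached)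
    obtain t where t: "t \<in> tensors G" "orbit t = w" using vw(2) by (rule states_reached)
    show "v = w" using vw(3) s t Psi_ev[of s] Psi_ev[of t] vp_of_eq_iff[of s t] by simp
  qed
  show "Psi ` states n p = carrier (Vp n p)"
  proof (rule equalityI; rule subsetI)
    fix x assume "x \<in> Psi ` states n p"
    then obtain w where w: "w \<in> states n p" "x = Psi w" by blast
    obtain t where "t \<in> tensors G" "orbit t = w" using w(1) by (rule states_reached)
    then show "x \<in> carrier (Vp n p)" using w Psi_ev[of t] by (auto simp: carrier_Vp)
  next
    fix x assume "x \<in> carrier (Vp n p)"
    then obtain t where t: "t \<in> tensors G" "x = vp_of t" by (auto simp: carrier_Vp)
    show "x \<in> Psi ` states n p"
      by (rule image_eqI[OF _ srep_states[OF t(1) p1 top_state_states[OF p1]]]) (simp add: t Psi_ev)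
  qed
qed

lemma Psi_add: "v \<in> states n p \<Longrightarrow> w \<in> states n p \<Longrightarrow> Psi (v + w) = Psi v \<oplus>\<^bsub>Vp n p\<^esub> Psi w"
proof -
  assume vw: "v \<in> states n p" "w \<in> states n p"
  obtain s where s: "s \<in> tensors G" "orbit s = v" using vw(1) by (rule states_reached)
  obtain t where t: "t \<in> tensors G" "orbit t = w" using vw(2) by (rule states_reached)
  show ?thesis using s t Psi_ev[of "s + t"] Psi_ev[of s] Psi_ev[of t]
    by (simp add: srep.ev_add vp_of_add tensors_add)
qed

lemma Psi_fscale: "w \<in> states n p \<Longrightarrow> Psi (fscale c w) = c \<odot>\<^bsub>Vp n p\<^esub> Psi w"
proof -
  assume "w \<in> states n p"
  then obtain t where t: "t \<in> tensors G" "orbit t = w" by (rule states_reached)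
  show ?thesis using t Psi_ev[of "pscale c t"] Psi_ev[of t]
    by (simp add: srep.ev_pscale vp_of_pscale tensors_pscale)
qed

lemma Psi_act:
  assumes "w \<in> states n p" "i \<le> n"
  shows "act (Vp n p) (q_e i i 0) (Psi w) = Psi (app (even_op i i) w)"
proof -
  obtain t where t: "t \<in> tensors G" "orbit t = w" using assms(1) by (rule states_reached)
  have i: "(i, i, 0) \<in> G" using assms(2) by (simp add: G_idx_def)
  have "act (Vp n p) (q_e i i 0) (Psi w) = vp_of (letter (i, i, 0) * t)"
    using t i Psi_ev[of t] vp_of_act[of "q_e i i 0" t] by (simp add: tens_of_q_e lie_span_def q_e_def tens_of_single)
  also have "\<dots> = Psi (orbit (letter (i, i, 0) * t))"
    using t i by (intro Psi_ev[symmetric] tensors_mult tensors_letter)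
  also have "orbit (letter (i, i, 0) * t) = app (even_op i i) w"
  proof -
    have "q_op n p (i, i, 0) = even_op i i" by (simp add: q_op_def)
    then show ?thesis using t by (simp add: srep.ev_mult)
  qed
  finally show ?thesis .
qed

section \<open>Weight spaces and the character\<close>

definition weight_keys :: "weight \<Rightarrow> fkey set" where
  "weight_keys \<mu> = {k \<in> fkeys n p (even n). key_weight k = \<mu>}"

lemma key_weight_keys: "k \<in> fkeys n p e \<Longrightarrow> Poly_Mapping.keys (key_weight k) \<subseteq> {..n}"
proof
  fix i assume k: "k \<in> fkeys n p e" and i: "i \<in> Poly_Mapping.keys (key_weight k)"
  obtain a A where kA: "k = (a, A)" "set_mset a \<subseteq> {..n}" "A \<subseteq> {..n}" using k by (auto simp: fkeys_def)
  then have "finite A" by (blast intro: finite_subset)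
  then have "count a i \<noteq> 0 \<or> i \<in> A"
    using i lookup_key_weight[of A a i] by (auto simp: in_keys_iff kA)
  then show "i \<in> {..n}" using kA by (auto simp: not_in_iff[symmetric])
qed

text \<open>The even e_ii act diagonally on keys, so a superpolynomial is a weight vector exactly if
  every key in its support has that weight. Injectivity of \<open>Psi\<close> transfers the
  eigenvalue equations to \<open>Vp\<close>.\<close>

lemma weight_space_Psi:
  assumes \<mu>: "Poly_Mapping.keys \<mu> \<subseteq> {..n}"
  shows "weight_space n (Vp n p) \<mu> = Psi ` supp (weight_keys \<mu>)"
proof -
  have eig: "(\<forall>i\<le>n. app (even_op i i) w = fscale (Poly_Mapping.lookup \<mu> i) w) \<longleftrightarrow> w \<in> supp (weight_keys \<mu>)"
    if w: "w \<in> states n p" for w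
  proof
    assume E: "\<forall>i\<le>n. app (even_op i i) w = fscale (Poly_Mapping.lookup \<mu> i) w"
    have "k \<in> weight_keys \<mu>" if nz: "w k \<noteq> 0" for k
    proof -
      have k: "k \<in> fkeys n p (even n)" using nz w unfolding states_def supp_def by blast
      then obtain a A where kA: "k = (a, A)" "A \<subseteq> {..n}" by (auto simp: fkeys_def)
      have fin: "finite A" using kA by (blast intro: finite_subset)
      have "key_weight k = \<mu>"
      proof (rule poly_mapping_eqI)
        fix i
        show "Poly_Mapping.lookup (key_weight k) i = Poly_Mapping.lookup \<mu> i"
        proof (cases "i \<le> n")
          case True
          then have "app (even_op i i) w k = fscale (Poly_Mapping.lookup \<mu> i) w k" using E by simp
          then show ?thesis using nz by (simp add: kA even_op_diag lookup_key_weight[OF fin])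
        next
          case False
          \<comment> \<open>The operators determine only the coordinates up to n; beyond them both
            weights vanish.\<close>
          then have "i \<notin> Poly_Mapping.keys (key_weight k)" "i \<notin> Poly_Mapping.keys \<mu>"
            using key_weight_keys[OF k] \<mu> by auto
          then show ?thesis by (simp add: in_keys_iff)
        qed
      qed
      then show ?thesis using k by (simp add: weight_keys_def)
    qed
    then show "w \<in> supp (weight_keys \<mu>)" by (auto simp: supp_def)
  next
    assume F: "w \<in> supp (weight_keys \<mu>)"
    show "\<forall>i\<le>n. app (even_op i i) w = fscale (Poly_Mapping.lookup \<mu> i) w"
    proof (intro allI impI ext)
      fix i and k :: fkey
      obtain a A where kA: "k = (a, A)" by (cases k)
      show "app (even_op i i) w k = fscale (Poly_Mapping.lookup \<mu> i) w k"
      proof (cases "k \<in> weight_keys \<mu>")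
        case True
        then have "finite A" "key_weight (a, A) = \<mu>" by (auto simp: weight_keys_def kA fkeys_def intro: finite_subset)
        then show ?thesis using lookup_key_weight[of A a i] by (simp add: kA even_op_diag)
      next
        case False
        then have "w (a, A) = 0" using F by (simp add: supp_def kA)
        then show ?thesis by (simp add: kA even_op_diag)
      qed
    qed
  qed
  have sub: "supp (weight_keys \<mu>) \<subseteq> states n p" by (auto simp: supp_def states_def weight_keys_def)
  have act_iff: "(\<forall>i\<le>n. act (Vp n p) (q_e i i 0) (Psi w) = Poly_Mapping.lookup \<mu> i \<odot>\<^bsub>Vp n p\<^esub> Psi w)
      \<longleftrightarrow> w \<in> supp (weight_keys \<mu>)" if w: "w \<in> states n p" for w
  proof -
    have "act (Vp n p) (q_e i i 0) (Psi w) = Poly_Mapping.lookup \<mu> i \<odot>\<^bsub>Vp n p\<^esub> Psi w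
        \<longleftrightarrow> app (even_op i i) w = fscale (Poly_Mapping.lookup \<mu> i) w" if i: "i \<le> n" for i
    proof -
      have "app (even_op i i) w \<in> states n p" using w i p1 unfolding states_def by (intro even_op_supp)
      moreover have "fscale (Poly_Mapping.lookup \<mu> i) w \<in> states n p" using w unfolding states_def by (rule supp_fscale)
      ultimately show ?thesis
        using Psi_bij unfolding Psi_act[OF w i] Psi_fscale[OF w, symmetric] bij_betw_def
        by (metis inj_onD)
    qed
    then show ?thesis using eig[OF w] by auto
  qed
  have car: "carrier (Vp n p) = Psi ` states n p" using Psi_bij by (simp add: bij_betw_def)
  show ?thesis
    unfolding weight_space_def car using act_iff sub by blast
qed

lemma weight_space_dim:
  assumes \<mu>: "Poly_Mapping.keys \<mu> \<subseteq> {..n}"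
  shows "vectorspace.dim class_ring ((Vp n p)\<lparr>carrier := weight_space n (Vp n p) \<mu>\<rparr>) = card (weight_keys \<mu>)"
proof -
  interpret V: vectorspace class_ring "Vp n p" by (rule vs_Vp)
  have sub: "supp (weight_keys \<mu>) \<subseteq> states n p" by (auto simp: supp_def states_def weight_keys_def)
  have zero: "Psi 0 = \<zero>\<^bsub>Vp n p\<^esub>" using Psi_ev[of 0] vp_of_zero_iff[of 0] by simp
  have "subspace class_ring (weight_space n (Vp n p) \<mu>) (Vp n p)"
  proof (rule subspace_classI[OF vs_Vp])
    show "weight_space n (Vp n p) \<mu> \<subseteq> carrier (Vp n p)" by (auto simp: weight_space_def)
    show "\<zero>\<^bsub>Vp n p\<^esub> \<in> weight_space n (Vp n p) \<mu>"
      unfolding weight_space_Psi[OF \<mu>] by (rule image_eqI[where f = Psi and x = 0]) (simp_all add: zero)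
  next
    fix u v assume "u \<in> weight_space n (Vp n p) \<mu>" "v \<in> weight_space n (Vp n p) \<mu>"
    then obtain f g where fg: "f \<in> supp (weight_keys \<mu>)" "g \<in> supp (weight_keys \<mu>)" "u = Psi f" "v = Psi g"
      unfolding weight_space_Psi[OF \<mu>] by blast
    have "Psi (f + g) = u \<oplus>\<^bsub>Vp n p\<^esub> v" using fg sub by (auto intro!: Psi_add)
    then show "u \<oplus>\<^bsub>Vp n p\<^esub> v \<in> weight_space n (Vp n p) \<mu>"
      unfolding weight_space_Psi[OF \<mu>] using fg supp_add by (metis image_eqI)
  next
    fix c v assume "v \<in> weight_space n (Vp n p) \<mu>"
    then obtain f where f: "f \<in> supp (weight_keys \<mu>)" "v = Psi f" unfolding weight_space_Psi[OF \<mu>] by blast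
    have "Psi (fscale c f) = c \<odot>\<^bsub>Vp n p\<^esub> v" using f sub by (auto intro!: Psi_fscale)
    then show "c \<odot>\<^bsub>Vp n p\<^esub> v \<in> weight_space n (Vp n p) \<mu>"
      unfolding weight_space_Psi[OF \<mu>] using f supp_fscale by (metis image_eqI)
  qed
  then have vs: "vectorspace class_ring ((Vp n p)\<lparr>carrier := weight_space n (Vp n p) \<mu>\<rparr>)"
    by (rule V.subspace_is_vs)
  have "finite (weight_keys \<mu>)" using finite_fkeys by (simp add: weight_keys_def)
  moreover have "inj_on Psi (supp (weight_keys \<mu>))" using Psi_bij sub by (auto simp: bij_betw_def intro: inj_on_subset)
  ultimately show ?thesis
    using dim_supp_iso[OF vs, of "weight_keys \<mu>" Psi] sub by (auto simp: weight_space_Psi[OF \<mu>] Psi_add Psi_fscale subset_iff)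
qed

lemma Vp_fin_dim: "vectorspace.fin_dim class_ring (Vp n p)"
  using dim_supp_iso[OF vs_Vp finite_fkeys[of n p "even n"], of Psi] Psi_bij Psi_add Psi_fscale
  by (simp add: states_def bij_betw_def)

lemma weight_space_nonzero:
  assumes \<mu>: "Poly_Mapping.keys \<mu> \<subseteq> {..n}"
  shows "weight_space n (Vp n p) \<mu> \<noteq> {\<zero>\<^bsub>Vp n p\<^esub>} \<longleftrightarrow> weight_keys \<mu> \<noteq> {}"
proof -
  have sub: "supp (weight_keys \<mu>) \<subseteq> states n p" by (auto simp: supp_def states_def weight_keys_def)
  have zero: "Psi 0 = \<zero>\<^bsub>Vp n p\<^esub>" using Psi_ev[of 0] vp_of_zero_iff[of 0] by simp
  show ?thesis
  proof
    assume "weight_keys \<mu> \<noteq> {}"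
    then obtain k where k: "k \<in> weight_keys \<mu>" by blast
    have "bfun k \<noteq> 0"
    proof
      assume "bfun k = 0"
      then have "bfun k k = 0 k" by (rule fun_cong)
      then show False by (simp add: bfun_def)
    qed
    then have "Psi (bfun k) \<noteq> Psi 0"
      using Psi_bij bfun_supp[OF k] sub supp_0[of "fkeys n p (even n)"] unfolding bij_betw_def states_def[symmetric]
      by (metis inj_onD subsetD)
    then show "weight_space n (Vp n p) \<mu> \<noteq> {\<zero>\<^bsub>Vp n p\<^esub>}"
      unfolding weight_space_Psi[OF \<mu>] zero[symmetric] using bfun_supp[OF k] by blast
  next
    assume nz: "weight_space n (Vp n p) \<mu> \<noteq> {\<zero>\<^bsub>Vp n p\<^esub>}"
    show "weight_keys \<mu> \<noteq> {}"
    proof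
      assume "weight_keys \<mu> = {}"
      then have "supp (weight_keys \<mu>) = {0}" by (auto simp: supp_def fun_eq_iff)
      then show False using nz unfolding weight_space_Psi[OF \<mu>] by (simp add: zero)
    qed
  qed
qed

text \<open>The multiplicity of a weight is the number of keys with that weight, so the sum over
  weights unfolds into a sum over keys.\<close>

lemma character_Vp: "character n (Vp n p) = (\<Sum>k\<in>fkeys n p (even n). formal_exp (key_weight k))"
proof -
  let ?S = "fkeys n p (even n)"
  have idx: "{\<mu>. Poly_Mapping.keys \<mu> \<subseteq> {..n} \<and> weight_space n (Vp n p) \<mu> \<noteq> {\<zero>\<^bsub>Vp n p\<^esub>}} = key_weight ` ?S"
    using key_weight_keys weight_space_nonzero by (fastforce simp: weight_keys_def)
  have "character n (Vp n p) = (\<Sum>\<mu>\<in>key_weight ` ?S. of_nat (card (weight_keys \<mu>)) * formal_exp \<mu>)"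
    unfolding character_def idx by (rule sum.cong) (auto simp: weight_space_dim key_weight_keys)
  also have "\<dots> = (\<Sum>\<mu>\<in>key_weight ` ?S. \<Sum>k | k \<in> ?S \<and> key_weight k = \<mu>. formal_exp (key_weight k))"
    by (rule sum.cong) (auto simp: weight_keys_def)
  also have "\<dots> = (\<Sum>k\<in>?S. formal_exp (key_weight k))"
    by (rule sum.image_gen[symmetric]) (rule finite_fkeys)
  finally show ?thesis .
qed

end

theorem mainTheorem6:
  fixes n p :: nat
  assumes "1 \<le> n" and "1 \<le> p"
  shows "vectorspace.fin_dim class_ring (Vp n p) \<and>
    character n (Vp n p) =
      (\<Sum>q | q \<le> n \<and> q mod 2 = n mod 2. complete_sym n (int p - int q) * elem_sym n q)"
proof -
  interpret vp n p by unfold_locales (fact assms(2))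
  show ?thesis using Vp_fin_dim character_Vp sum_fkeys_formal_exp by simp
qed

end
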